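(* Let $V\subset L^2(\mathbb{R}^d)$ be a shift-invariant space and let $\{\phi_1,\dots,\phi_n\}$ and $\{\psi_1,\dots,\psi_n\}$ be two Riesz generator sets of $V$. Then $\{\phi_1,\dots,\phi_n\}$ and $\{\psi_1,\dots,\psi_n\}$ are woven (as Riesz generator sets) if and only if there exist $A,B>0$ such that, for almost every $\omega\in\mathbb{T}^d$, the families $\{\tau\phi_1(\omega),\dots,\tau\phi_n(\omega)\}$ and $\{\tau\psi_1(\omega),\dots,\tau\psi_n(\omega)\}$ are woven in $J(\omega)$ with frame bounds $A$ and $B$.
   Context: A closed subspace $V\subset L^2(\mathbb{R}^d)$ is shift-invariant if $T_kf:=f(\cdot-k)\in V$ for all $f\in V$, $k\in\mathbb{Z}^d$. A family in a Hilbert space is a frame with bounds $A,B>0$ if $A\|f\|^2\le\sum_i|\langle f,x_i\rangle|^2\le B\|f\|^2$ for all $f$ in the space. A family $\{x_i\}$ is a Riesz sequence if for some $a,b>0$ one has $a\|c\|_2\le\|\sum_ic_ix_i\|\le b\|c\|_2$ for all finitely supported $c$; it is a Riesz basis if in addition it is a frame. A subset $\Phi\subset V$ is a Riesz generator set of $V$ if $\{T_k\phi:\phi\in\Phi,k\in\mathbb{Z}^d\}$ is a Riesz basis of $V$. Two Riesz generator sets $\{\phi_1,\dots,\phi_n\}$ and $\{\psi_1,\dots,\psi_n\}$ of $V$ are woven if for every $I\subset\{1,\dots,n\}$ the set $\{\phi_i\}_{i\in I}\cup\{\psi_i\}_{i\notin I}$ is a Riesz generator set of $V$. The map $\tau:L^2(\mathbb{R}^d)\to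 L^2(\mathbb{T}^d,\ell^2(\mathbb{Z}^d))$, $\tau f(\omega):=\{\widehat f(\omega+k)\}_{k\in\mathbb{Z}^d}$, is an isometric isomorphism, where $\widehat f(\xi)=\int f(x)e^{-2\pi i x\cdot\xi}\,dx$ and $\mathbb{T}^d$ is identified with $[-1/2,1/2)^d$. The range function of $V$ is $J(\omega)=J_V(\omega)=\{\tau f(\omega):f\in V\}\subset\ell^2(\mathbb{Z}^d)$, understood for almost every $\omega$ in the usual sense: if $V$ is the closed span of the integer translates of a countable set $\Phi$, then $J(\omega)=\overline{\mathrm{span}}\{\tau\phi(\omega):\phi\in\Phi\}$ for a.e. $\omega$. Two families $\{x_i\}_{i=1}^n$ and $\{y_i\}_{i=1}^n$ are woven in $J(\omega)$ with frame bounds $A$ and $B$ if for every $I\subset\{1,\dots,n\}$ the indexed family $\{x_i\}_{i\in I}\cup\{y_i\}_{i\notin I}$ is a frame of $J(\omega)$ with bounds $A$ and $B$. *)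

theory Defs
  imports "HOL-Analysis.Analysis"
begin

section \<open>Complex inner product spaces\<close>

text \<open>The inner product is linear in its first argument.\<close>

class complex_inner = real_inner +
  fixes scaleC :: "complex \<Rightarrow> 'a \<Rightarrow> 'a"  (infixr \<open>*\<^sub>C\<close> 75)
    and cinner :: "'a \<Rightarrow> 'a \<Rightarrow> complex"
  assumes scaleC_add_right: "c *\<^sub>C (x + y) = c *\<^sub>C x + c *\<^sub>C y"
    and scaleC_add_left: "(b + c) *\<^sub>C x = b *\<^sub>C x + c *\<^sub>C x"
    and scaleC_scaleC: "b *\<^sub>C (c *\<^sub>C x) = (b * c) *\<^sub>C x"
    and scaleR_eq_scaleC: "r *\<^sub>R x = complex_of_real r *\<^sub>C x"
    and cinner_commute: "cinner x y = cnj (cinner y x)"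
    and cinner_add_left: "cinner (x + y) z = cinner x z + cinner y z"
    and cinner_scaleC_left: "cinner (c *\<^sub>C x) y = c * cinner x y"
    and inner_eq_Re_cinner: "inner x y = Re (cinner x y)"

global_interpretation complex_vector:
  vector_space "scaleC :: complex \<Rightarrow> 'a \<Rightarrow> 'a::complex_inner"
proof
  fix x :: 'a
  show "1 *\<^sub>C x = x"
    using scaleR_eq_scaleC[of 1 x] by simp
qed (simp_all add: scaleC_add_right scaleC_add_left scaleC_scaleC)

abbreviation csubspace :: "'a::complex_inner set \<Rightarrow> bool"
  where "csubspace \<equiv> complex_vector.subspace"

abbreviation cspan :: "'a::complex_inner set \<Rightarrow> 'a set"
  where "cspan \<equiv> complex_vector.span"


section \<open>Frames and Riesz bases\<close>

definition frame_with_bounds ::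
    "'a::complex_inner set \<Rightarrow> real \<Rightarrow> real \<Rightarrow> 'i set \<Rightarrow> ('i \<Rightarrow> 'a) \<Rightarrow> bool" where
  "frame_with_bounds H A B I x \<longleftrightarrow>
     0 < A \<and> 0 < B \<and> x ` I \<subseteq> H \<and>
     (\<forall>f\<in>H. (\<lambda>i. (cmod (cinner f (x i)))\<^sup>2) summable_on I \<and>
            A * (norm f)\<^sup>2 \<le> (\<Sum>\<^sub>\<infinity>i\<in>I. (cmod (cinner f (x i)))\<^sup>2) \<and>
            (\<Sum>\<^sub>\<infinity>i\<in>I. (cmod (cinner f (x i)))\<^sup>2) \<le> B * (norm f)\<^sup>2)"

definition riesz_sequence :: "'i set \<Rightarrow> ('i \<Rightarrow> 'a::complex_inner) \<Rightarrow> bool" where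
  "riesz_sequence I x \<longleftrightarrow>
     (\<exists>a>0. \<exists>b>0. \<forall>F c. finite F \<and> F \<subseteq> I \<longrightarrow>
        a * sqrt (\<Sum>i\<in>F. (cmod (c i))\<^sup>2) \<le> norm (\<Sum>i\<in>F. c i *\<^sub>C x i) \<and>
        norm (\<Sum>i\<in>F. c i *\<^sub>C x i) \<le> b * sqrt (\<Sum>i\<in>F. (cmod (c i))\<^sup>2))"

definition riesz_basis :: "'a::complex_inner set \<Rightarrow> 'i set \<Rightarrow> ('i \<Rightarrow> 'a) \<Rightarrow> bool" where
  "riesz_basis H I x \<longleftrightarrow> riesz_sequence I x \<and> (\<exists>A B. frame_with_bounds H A B I x)"

definition woven_with_bounds ::
    "'a::complex_inner set \<Rightarrow> real \<Rightarrow> real \<Rightarrow> nat \<Rightarrow> (nat \<Rightarrow> 'a) \<Rightarrow> (nat \<Rightarrow> 'a) \<Rightarrow> bool" where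
  "woven_with_bounds H A B n x y \<longleftrightarrow>
     (\<forall>I\<subseteq>{1..n}. frame_with_bounds H A B {1..n} (\<lambda>i. if i \<in> I then x i else y i))"


section \<open>The Hilbert space \<open>L\<^sup>2\<close>\<close>

definition square_integrable :: "('a::euclidean_space \<Rightarrow> complex) \<Rightarrow> bool" where
  "square_integrable f \<longleftrightarrow>
     f \<in> borel_measurable lborel \<and> integrable lborel (\<lambda>x. (cmod (f x))\<^sup>2)"

definition L2_rel ::
    "('a::euclidean_space \<Rightarrow> complex) \<Rightarrow> ('a \<Rightarrow> complex) \<Rightarrow> bool" where
  "L2_rel f g \<longleftrightarrow> square_integrable f \<and> square_integrable g \<and> (AE x in lborel. f x = g x)"

lemma square_integrable_zero: "square_integrable (\<lambda>x. 0)"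
  by (simp add: square_integrable_def)

lemma part_equivp_L2_rel: "part_equivp L2_rel"
proof (rule part_equivpI)
  show "\<exists>f. L2_rel f f"
    using square_integrable_zero by (auto simp: L2_rel_def)
  show "symp L2_rel"
    by (rule sympI) (auto simp: L2_rel_def)
  show "transp L2_rel"
    by (rule transpI) (auto simp: L2_rel_def)
qed

quotient_type (overloaded) 'a L2 = "'a::euclidean_space \<Rightarrow> complex" / partial: L2_rel
  by (rule part_equivp_L2_rel)

lemma cmod_mult_cnj_le: "cmod (a * cnj b) \<le> (cmod a)\<^sup>2 + (cmod b)\<^sup>2"
proof -
  have "0 \<le> (cmod a - cmod b)\<^sup>2"
    by simp
  then have "2 * (cmod a * cmod b) \<le> (cmod a)\<^sup>2 + (cmod b)\<^sup>2"
    by (simp add: power2_diff)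
  moreover have "0 \<le> cmod a * cmod b"
    by simp
  ultimately have "cmod a * cmod b \<le> (cmod a)\<^sup>2 + (cmod b)\<^sup>2"
    by linarith
  then show ?thesis
    by (simp add: norm_mult)
qed

lemma cmod_add_square_le: "(cmod (a + b))\<^sup>2 \<le> 2 * (cmod a)\<^sup>2 + 2 * (cmod b)\<^sup>2"
proof -
  have "(cmod (a + b))\<^sup>2 \<le> (cmod a + cmod b)\<^sup>2"
    by (simp add: norm_triangle_ineq power_mono)
  moreover have "0 \<le> (cmod a - cmod b)\<^sup>2"
    by simp
  ultimately show ?thesis
    by (simp add: power2_diff power2_sum)
qed

lemma square_integrable_add:
  assumes "square_integrable f" "square_integrable g"
  shows "square_integrable (\<lambda>x. f x + g x)"
proof -
  have [measurable]: "f \<in> borel_measurable lborel" "g \<in> borel_measurable lborel"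
    using assms by (auto simp: square_integrable_def)
  have "integrable lborel (\<lambda>x. (cmod (f x + g x))\<^sup>2)"
  proof (rule Bochner_Integration.integrable_bound)
    show "integrable lborel (\<lambda>x. 2 * (cmod (f x))\<^sup>2 + 2 * (cmod (g x))\<^sup>2)"
      using assms by (auto simp: square_integrable_def)
  qed (use cmod_add_square_le in auto)
  then show ?thesis
    by (simp add: square_integrable_def)
qed

lemma square_integrable_scaleC:
  assumes "square_integrable f"
  shows "square_integrable (\<lambda>x. c * f x)"
  using assms by (auto simp: square_integrable_def norm_mult power_mult_distrib)

lemma integrable_mult_cnj:
  assumes "square_integrable f" "square_integrable g"
  shows "integrable lborel (\<lambda>x. f x * cnj (g x))"
proof -
  have [measurable]: "f \<in> borel_measurable lborel" "g \<in> borel_measurable lborel"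
    using assms by (auto simp: square_integrable_def)
  have [measurable]: "(\<lambda>x. cnj (g x)) \<in> borel_measurable borel"
    by (rule measurable_compose[of g _ borel])
      (auto intro!: borel_measurable_continuous_onI continuous_intros)
  show ?thesis
  proof (rule Bochner_Integration.integrable_bound)
    show "integrable lborel (\<lambda>x. (cmod (f x))\<^sup>2 + (cmod (g x))\<^sup>2)"
      using assms by (auto simp: square_integrable_def)
  qed (use cmod_mult_cnj_le in auto)
qed

instantiation L2 :: (euclidean_space) complex_inner
begin

lift_definition zero_L2 :: "'a L2" is "\<lambda>x. 0"
  using square_integrable_zero by (auto simp: L2_rel_def)

lift_definition plus_L2 :: "'a L2 \<Rightarrow> 'a L2 \<Rightarrow> 'a L2" is "\<lambda>f g x. f x + g x"
  by (auto simp: L2_rel_def square_integrable_add)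

lift_definition scaleC_L2 :: "complex \<Rightarrow> 'a L2 \<Rightarrow> 'a L2" is "\<lambda>c f x. c * f x"
  by (auto simp: L2_rel_def square_integrable_scaleC)

lift_definition cinner_L2 :: "'a L2 \<Rightarrow> 'a L2 \<Rightarrow> complex"
  is "\<lambda>f g. LINT x|lborel. f x * cnj (g x)"
proof -
  fix f f' g g' :: "'a \<Rightarrow> complex"
  assume "L2_rel f f'" "L2_rel g g'"
  then show "(LINT x|lborel. f x * cnj (g x)) = (LINT x|lborel. f' x * cnj (g' x))"
    using integrable_mult_cnj[of f g] integrable_mult_cnj[of f' g']
    by (intro integral_cong_AE) (auto simp: L2_rel_def)
qed

definition "- f = (- 1) *\<^sub>C (f :: 'a L2)"
definition "f - g = f + (- 1) *\<^sub>C (g :: 'a L2)"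
definition "r *\<^sub>R f = complex_of_real r *\<^sub>C (f :: 'a L2)"
definition "inner f g = Re (cinner f (g :: 'a L2))"
definition "norm f = sqrt (inner f (f :: 'a L2))"
definition "dist f g = norm (f - (g :: 'a L2))"
definition "sgn f = inverse (norm f) *\<^sub>R (f :: 'a L2)"
definition "(uniformity :: ('a L2 \<times> 'a L2) filter) = (INF e\<in>{0<..}. principal {(f, g). dist f g < e})"
definition "open (U :: 'a L2 set) \<longleftrightarrow> (\<forall>f\<in>U. \<forall>\<^sub>F (f', g) in uniformity. f' = f \<longrightarrow> g \<in> U)"

instance
proof
  fix f g h :: "'a L2" and b c :: complex and r s :: real
  show add_assoc: "f + g + h = f + (g + h)"
    by transfer (auto simp: L2_rel_def add.assoc intro!: square_integrable_add)
  show "f + g = g + f"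
    by transfer (auto simp: L2_rel_def add.commute intro!: square_integrable_add)
  show "0 + f = f"
    by transfer (auto simp: L2_rel_def)
  have zero: "0 *\<^sub>C f = 0"
    by transfer (auto simp: L2_rel_def square_integrable_zero)
  have one: "1 *\<^sub>C f = f"
    by transfer (auto simp: L2_rel_def)
  show addl: "(b + c) *\<^sub>C f = b *\<^sub>C f + c *\<^sub>C f" for b c
    by transfer
      (auto simp: L2_rel_def distrib_right
        intro!: square_integrable_add square_integrable_scaleC
          square_integrable_scaleC[of _ "_ + _", unfolded distrib_right])
  show addr: "c *\<^sub>C (f + g) = c *\<^sub>C f + c *\<^sub>C g" for c
    by transfer
      (auto simp: L2_rel_def distrib_left
        intro!: square_integrable_add square_integrable_scaleC)
  show scsc: "b *\<^sub>C (c *\<^sub>C f) = (b * c) *\<^sub>C f" for b c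
    by transfer
      (use square_integrable_scaleC in
        \<open>force simp: L2_rel_def mult.assoc intro: square_integrable_scaleC\<close>)
  show "- f + f = 0"
    using addl[of "- 1" 1] zero one by (simp add: uminus_L2_def)
  show "f - g = f + - g"
    by (simp add: minus_L2_def uminus_L2_def)
  show "r *\<^sub>R (f + g) = r *\<^sub>R f + r *\<^sub>R g"
    by (simp add: scaleR_L2_def addr)
  show "(r + s) *\<^sub>R f = r *\<^sub>R f + s *\<^sub>R f"
    by (simp add: scaleR_L2_def addl)
  show "r *\<^sub>R s *\<^sub>R f = (r * s) *\<^sub>R f"
    by (simp add: scaleR_L2_def scsc)
  show "1 *\<^sub>R f = f"
    by (simp add: scaleR_L2_def one)
  show "r *\<^sub>R f = complex_of_real r *\<^sub>C f"
    by (fact scaleR_L2_def)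
  show "sgn f = inverse (norm f) *\<^sub>R f"
    by (fact sgn_L2_def)
  show "dist f g = norm (f - g)"
    by (fact dist_L2_def)
  show "(uniformity :: ('a L2 \<times> 'a L2) filter) = (INF e\<in>{0<..}. principal {(f, g). dist f g < e})"
    by (fact uniformity_L2_def)
  show "open U \<longleftrightarrow> (\<forall>f\<in>U. \<forall>\<^sub>F (f', g) in uniformity. f' = f \<longrightarrow> g \<in> U)" for U :: "'a L2 set"
    by (fact open_L2_def)
  show comm: "cinner f g = cnj (cinner g f)" for f g :: "'a L2"
    by transfer (simp flip: Bochner_Integration.integral_cnj add: mult.commute)
  show cadd: "cinner (f + g) h = cinner f h + cinner g h"
    by transfer
      (simp add: L2_rel_def distrib_right integrable_mult_cnj flip: Bochner_Integration.integral_add)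
  show cscale: "cinner (c *\<^sub>C f) g = c * cinner f g" for c
    by transfer (simp add: mult.assoc)
  show "inner f g = Re (cinner f g)"
    by (fact inner_L2_def)
  show "inner f g = inner g f"
    using comm[of f g] by (simp add: inner_L2_def)
  show "inner (f + g) h = inner f h + inner g h"
    by (simp add: inner_L2_def cadd)
  show "inner (r *\<^sub>R f) g = r * inner f g"
    by (simp add: inner_L2_def scaleR_L2_def cscale)
  have self: "cinner f f = 0 \<longleftrightarrow> f = 0" "0 \<le> Re (cinner f f)" "Im (cinner f f) = 0"
  proof -
    have *: "f x * cnj (f x) = complex_of_real ((cmod (f x))\<^sup>2)" for f :: "'a \<Rightarrow> complex" and x
      by (rule complex_norm_square[symmetric])
    show "0 \<le> Re (cinner f f)" "Im (cinner f f) = 0"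
      by (transfer, simp only: * integral_complex_of_real, simp)+
    show "cinner f f = 0 \<longleftrightarrow> f = 0"
      by transfer
        (simp only: * integral_complex_of_real,
          auto simp: L2_rel_def square_integrable_def integral_nonneg_eq_0_iff_AE)
  qed
  show "0 \<le> inner f f"
    using self by (simp add: inner_L2_def)
  show "inner f f = 0 \<longleftrightarrow> f = 0"
    using self by (simp add: inner_L2_def complex_eq_iff)
  show "norm f = sqrt (inner f f)"
    by (fact norm_L2_def)
qed

end


section \<open>The Hilbert space \<open>\<ell>\<^sup>2\<close>\<close>

definition square_summable :: "('i \<Rightarrow> complex) \<Rightarrow> bool" where
  "square_summable x \<longleftrightarrow> (\<lambda>k. (cmod (x k))\<^sup>2) summable_on UNIV"

lemma square_summable_zero: "square_summable (\<lambda>k. 0)"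
  by (simp add: square_summable_def)

lemma square_summable_add:
  assumes "square_summable x" "square_summable y"
  shows "square_summable (\<lambda>k. x k + y k)"
  unfolding square_summable_def
proof (rule summable_on_comparison_test)
  show "(\<lambda>k. 2 * (cmod (x k))\<^sup>2 + 2 * (cmod (y k))\<^sup>2) summable_on UNIV"
    using assms unfolding square_summable_def
    by (intro summable_on_add summable_on_cmult_right)
qed (use cmod_add_square_le in auto)

lemma square_summable_scaleC:
  assumes "square_summable x"
  shows "square_summable (\<lambda>k. c * x k)"
  using assms unfolding square_summable_def norm_mult power_mult_distrib
  by (rule summable_on_cmult_right)

lemma summable_on_mult_cnj:
  assumes "square_summable x" "square_summable y"
  shows "(\<lambda>k. x k * cnj (y k)) summable_on UNIV"
proof (rule abs_summable_summable, rule summable_on_comparison_test)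
  show "(\<lambda>k. (cmod (x k))\<^sup>2 + (cmod (y k))\<^sup>2) summable_on UNIV"
    using assms unfolding square_summable_def by (rule summable_on_add)
qed (use cmod_mult_cnj_le in auto)

typedef 'i ell2 = "{x :: 'i \<Rightarrow> complex. square_summable x}"
  using square_summable_zero by auto

setup_lifting type_definition_ell2

instantiation ell2 :: (type) complex_inner
begin

lift_definition zero_ell2 :: "'a ell2" is "\<lambda>k. 0"
  by (rule square_summable_zero)

lift_definition plus_ell2 :: "'a ell2 \<Rightarrow> 'a ell2 \<Rightarrow> 'a ell2" is "\<lambda>x y k. x k + y k"
  by (rule square_summable_add)

lift_definition scaleC_ell2 :: "complex \<Rightarrow> 'a ell2 \<Rightarrow> 'a ell2" is "\<lambda>c x k. c * x k"
  by (rule square_summable_scaleC)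

lift_definition cinner_ell2 :: "'a ell2 \<Rightarrow> 'a ell2 \<Rightarrow> complex"
  is "\<lambda>x y. \<Sum>\<^sub>\<infinity>k. x k * cnj (y k)" .

definition "- x = (- 1) *\<^sub>C (x :: 'a ell2)"
definition "x - y = x + (- 1) *\<^sub>C (y :: 'a ell2)"
definition "r *\<^sub>R x = complex_of_real r *\<^sub>C (x :: 'a ell2)"
definition "inner x y = Re (cinner x (y :: 'a ell2))"
definition "norm x = sqrt (inner x (x :: 'a ell2))"
definition "dist x y = norm (x - (y :: 'a ell2))"
definition "sgn x = inverse (norm x) *\<^sub>R (x :: 'a ell2)"
definition "(uniformity :: ('a ell2 \<times> 'a ell2) filter) = (INF e\<in>{0<..}. principal {(x, y). dist x y < e})"
definition "open (U :: 'a ell2 set) \<longleftrightarrow> (\<forall>x\<in>U. \<forall>\<^sub>F (x', y) in uniformity. x' = x \<longrightarrow> y \<in> U)"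

instance
proof
  fix x y z :: "'a ell2" and b c :: complex and r s :: real
  show "x + y + z = x + (y + z)"
    by transfer (simp add: add.assoc)
  show "x + y = y + x"
    by transfer (simp add: add.commute)
  show "0 + x = x"
    by transfer simp
  have zero: "0 *\<^sub>C x = 0"
    by transfer simp
  have one: "1 *\<^sub>C x = x"
    by transfer simp
  show addl: "(b + c) *\<^sub>C x = b *\<^sub>C x + c *\<^sub>C x" for b c
    by transfer (simp add: distrib_right)
  show addr: "c *\<^sub>C (x + y) = c *\<^sub>C x + c *\<^sub>C y" for c
    by transfer (simp add: distrib_left)
  show scsc: "b *\<^sub>C (c *\<^sub>C x) = (b * c) *\<^sub>C x" for b c
    by transfer (simp add: mult.assoc)
  show "- x + x = 0"
    using addl[of "- 1" 1] zero one by (simp add: uminus_ell2_def)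
  show "x - y = x + - y"
    by (simp add: minus_ell2_def uminus_ell2_def)
  show "r *\<^sub>R (x + y) = r *\<^sub>R x + r *\<^sub>R y"
    by (simp add: scaleR_ell2_def addr)
  show "(r + s) *\<^sub>R x = r *\<^sub>R x + s *\<^sub>R x"
    by (simp add: scaleR_ell2_def addl)
  show "r *\<^sub>R s *\<^sub>R x = (r * s) *\<^sub>R x"
    by (simp add: scaleR_ell2_def scsc)
  show "1 *\<^sub>R x = x"
    by (simp add: scaleR_ell2_def one)
  show "r *\<^sub>R x = complex_of_real r *\<^sub>C x"
    by (fact scaleR_ell2_def)
  show "sgn x = inverse (norm x) *\<^sub>R x"
    by (fact sgn_ell2_def)
  show "dist x y = norm (x - y)"
    by (fact dist_ell2_def)
  show "(uniformity :: ('a ell2 \<times> 'a ell2) filter) = (INF e\<in>{0<..}. principal {(x, y). dist x y < e})"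
    by (fact uniformity_ell2_def)
  show "open U \<longleftrightarrow> (\<forall>x\<in>U. \<forall>\<^sub>F (x', y) in uniformity. x' = x \<longrightarrow> y \<in> U)" for U :: "'a ell2 set"
    by (fact open_ell2_def)
  show comm: "cinner x y = cnj (cinner y x)" for x y :: "'a ell2"
    by transfer (simp flip: infsum_cnj add: mult.commute)
  show cadd: "cinner (x + y) z = cinner x z + cinner y z"
    by transfer (simp add: distrib_right summable_on_mult_cnj infsum_add)
  show cscale: "cinner (c *\<^sub>C x) y = c * cinner x y" for c
    by transfer (simp add: mult.assoc infsum_cmult_right')
  show "inner x y = Re (cinner x y)"
    by (fact inner_ell2_def)
  show "inner x y = inner y x"
    using comm[of x y] by (simp add: inner_ell2_def)
  show "inner (x + y) z = inner x z + inner y z"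
    by (simp add: inner_ell2_def cadd)
  show "inner (r *\<^sub>R x) y = r * inner x y"
    by (simp add: inner_ell2_def scaleR_ell2_def cscale)
  have self: "inner x x = (\<Sum>\<^sub>\<infinity>k. (cmod (Rep_ell2 x k))\<^sup>2)"
    unfolding inner_ell2_def
    by transfer (simp add: infsum_Re[symmetric] summable_on_mult_cnj cmod_power2 flip: power2_eq_square)
  show "0 \<le> inner x x"
    unfolding self by (rule infsum_nonneg) simp
  show "inner x x = 0 \<longleftrightarrow> x = 0"
  proof
    assume "inner x x = 0"
    moreover have "(\<lambda>k. (cmod (Rep_ell2 x k))\<^sup>2) summable_on UNIV"
      using Rep_ell2[of x] by (simp add: square_summable_def)
    ultimately have "(cmod (Rep_ell2 x k))\<^sup>2 = 0" for k
      unfolding self by (intro nonneg_infsum_le_0D[where A = UNIV]) auto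
    then show "x = 0"
      by (simp add: Rep_ell2_inject[symmetric] zero_ell2.rep_eq fun_eq_iff)
  next
    assume "x = 0"
    then show "inner x x = 0"
      unfolding self by (simp add: zero_ell2.rep_eq)
  qed
  show "norm x = sqrt (inner x x)"
    by (fact norm_ell2_def)
qed

end


section \<open>The Fourier transform on \<open>L\<^sup>2\<close>\<close>

definition fourier_integral ::
    "('a::euclidean_space \<Rightarrow> complex) \<Rightarrow> 'a \<Rightarrow> complex" where
  "fourier_integral f \<xi> = (LINT x|lborel. f x * exp (- 2 * complex_of_real pi * \<i> * complex_of_real (x \<bullet> \<xi>)))"

text \<open>The extension by continuity from \<open>L\<^sup>1 \<inter> L\<^sup>2\<close>. Its graph is the closure of the
  graph of the integral transform; by Plancherel's theorem the limit \<open>g\<close> exists, is unique,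
  and the third condition on \<open>h\<close> is automatic.\<close>

definition fourier :: "'a::euclidean_space L2 \<Rightarrow> 'a L2" where
  "fourier f = (THE g. \<exists>h :: nat \<Rightarrow> 'a \<Rightarrow> complex.
     (\<forall>N. integrable lborel (h N) \<and> square_integrable (h N) \<and>
          square_integrable (fourier_integral (h N))) \<and>
     (\<lambda>N. abs_L2 (h N)) \<longlonglongrightarrow> f \<and>
     (\<lambda>N. abs_L2 (fourier_integral (h N))) \<longlonglongrightarrow> g)"


section \<open>Shift-invariant spaces and fiberization\<close>

definition int_vec :: "int ^ 'd \<Rightarrow> real ^ 'd" where
  "int_vec k = (\<chi> i. real_of_int (k $ i))"

lemma L2_rel_translate:
  assumes "L2_rel f g"
  shows "L2_rel (\<lambda>x. f (x - a)) (\<lambda>x. g (x - a))"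
proof -
  have distr: "distr lborel borel (\<lambda>x. x - a) = (lborel :: 'a measure)"
    using lborel_distr_plus[of "- a"] by (simp add: fun_eq_iff cong: distr_cong)
  have [measurable]: "f \<in> borel_measurable borel" "g \<in> borel_measurable borel"
    using assms by (auto simp: L2_rel_def square_integrable_def)
  have sq: "square_integrable (\<lambda>x. h (x - a))"
    if "square_integrable h" for h :: "'a \<Rightarrow> complex"
  proof -
    have [measurable]: "h \<in> borel_measurable borel"
      using that by (simp add: square_integrable_def)
    have "integrable (distr lborel borel (\<lambda>x. x - a)) (\<lambda>x. (cmod (h x))\<^sup>2)"
      unfolding distr using that by (simp add: square_integrable_def)
    then have "integrable lborel (\<lambda>x. (cmod (h (x - a)))\<^sup>2)"
      by (subst (asm) integrable_distr_eq) auto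
    then show ?thesis
      by (simp add: square_integrable_def)
  qed
  have "AE x in distr lborel borel (\<lambda>x. x - a). f x = g x"
    unfolding distr using assms by (simp add: L2_rel_def)
  then have "AE x in lborel. f (x - a) = g (x - a)"
    by (subst (asm) AE_distr_iff) auto
  then show ?thesis
    using assms sq by (simp add: L2_rel_def)
qed

lift_definition translate :: "int ^ 'd \<Rightarrow> (real ^ 'd) L2 \<Rightarrow> (real ^ 'd) L2"
  is "\<lambda>k f x. f (x - int_vec k)"
  by (rule L2_rel_translate)

definition shift_invariant :: "(real ^ 'd) L2 set \<Rightarrow> bool" where
  "shift_invariant V \<longleftrightarrow> csubspace V \<and> closed V \<and> (\<forall>f\<in>V. \<forall>k. translate k f \<in> V)"

definition riesz_generator_set :: "(real ^ 'd) L2 set \<Rightarrow> (real ^ 'd) L2 set \<Rightarrow> bool" where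
  "riesz_generator_set V \<Phi> \<longleftrightarrow>
     \<Phi> \<subseteq> V \<and> riesz_basis V (\<Phi> \<times> UNIV) (\<lambda>(\<phi>, k). translate k \<phi>)"

definition woven_generator_sets ::
    "(real ^ 'd) L2 set \<Rightarrow> nat \<Rightarrow> (nat \<Rightarrow> (real ^ 'd) L2) \<Rightarrow> (nat \<Rightarrow> (real ^ 'd) L2) \<Rightarrow> bool" where
  "woven_generator_sets V n \<phi> \<psi> \<longleftrightarrow>
     (\<forall>I\<subseteq>{1..n}. riesz_generator_set V (\<phi> ` I \<union> \<psi> ` ({1..n} - I)))"

definition torus :: "(real ^ 'd) set" where
  "torus = {\<omega>. \<forall>i. - 1 / 2 \<le> \<omega> $ i \<and> \<omega> $ i < 1 / 2}"

text \<open>The map \<open>\<tau>\<close>. It uses the representative of the Fourier transform that is picked by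
  \<open>rep_L2\<close>; another representative changes it only on a null set of \<open>\<omega>\<close>. The value \<open>0\<close>
  is also taken only on a null set, where the fiber is not square summable.\<close>

definition fiber :: "(real ^ 'd) L2 \<Rightarrow> real ^ 'd \<Rightarrow> (int ^ 'd) ell2" where
  "fiber f \<omega> = (let x = (\<lambda>k. rep_L2 (fourier f) (\<omega> + int_vec k))
                in if square_summable x then Abs_ell2 x else 0)"

text \<open>The literal set of all \<open>fiber f \<omega>\<close> with \<open>f \<in> V\<close> would depend on uncountably many
  choices of representatives. The range function is instead computed from a countable set whose
  integer translates span a dense subspace of \<open>V\<close>; such a set exists for every shift-invariant
  \<open>V\<close>, and two of them give the same \<open>J \<omega>\<close> for almost every \<open>\<omega>\<close>.\<close>

definition countable_generator :: "(real ^ 'd) L2 set \<Rightarrow> (real ^ 'd) L2 set \<Rightarrow> bool" where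
  "countable_generator V \<Phi> \<longleftrightarrow>
     countable \<Phi> \<and> V = closure (cspan {translate k \<phi> | k \<phi>. \<phi> \<in> \<Phi>})"

definition range_function :: "(real ^ 'd) L2 set \<Rightarrow> real ^ 'd \<Rightarrow> (int ^ 'd) ell2 set" where
  "range_function V \<omega> =
     closure (cspan ((\<lambda>\<phi>. fiber \<phi> \<omega>) ` (SOME \<Phi>. countable_generator V \<Phi>)))"

end

theory Submission
  imports Defs "HOL-Probability.Characteristic_Functions"
begin

text \<open>
  Fiberization is an isometry that turns the translation by \<open>k\<close> into the multiplication by the
  character \<open>wave \<omega> (int_vec k)\<close>. A combination of translates of finitely many functions \<open>\<theta>\<close> therefore
  has the fibers \<open>\<Sum>\<theta>. p \<theta> \<omega> *\<^sub>C fiber \<theta> \<omega>\<close> with trigonometric polynomials \<open>p \<theta>\<close>, and the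
  squared norm of the combination is the integral over the torus of the squared norms of these
  vectors. Since the characters are orthonormal, bounds for the fibers integrate to bounds for the
  translates (\<open>riesz_bounds_translates\<close>). Conversely, trigonometric polynomials concentrate their
  mass near any point of the torus, so that bounds for the translates localize to almost every
  fiber (\<open>AE_riesz_bounds_fiber\<close>). Thus the translates of a finite set form a Riesz sequence if and
  only if the fibers of the set satisfy uniform Riesz inequalities.

  The hypothesis on the \<open>\<phi> i\<close> gives almost every range function dimension \<open>n\<close>. This is what makes
  frames and Riesz bases exchangeable: \<open>n\<close> vectors that form a frame of an \<open>n\<close>-dimensional space are a
  basis of it, and frame bounds \<open>A\<close>, \<open>B\<close> correspond to Riesz bounds \<open>sqrt A\<close>, \<open>sqrt B\<close>
  (\<open>frame_of_riesz_bounds\<close>, \<open>riesz_bounds_of_independent_frame\<close>). If the two sets are woven, each of the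
  finitely many mixed families has uniform Riesz bounds on the fibers and hence uniform frame bounds,
  and extreme values over the index sets \<open>I\<close> serve all of them. If the fibers are woven, each mixed
  family has uniform Riesz bounds on the fibers, so its translates form a Riesz sequence. These
  translates are total in \<open>V\<close>: a function of \<open>V\<close> orthogonal to them has fibers that lie in the range
  function and are orthogonal to a frame of it. A Riesz sequence with dense span is a frame. Dimension
  counting also shows that the \<open>n\<close> members of a mixed family are distinct, which reconciles the
  indexed families of fibers with the sets of generators.

  The analytic basis has three parts. Plancherel's theorem (\<open>plancherel_L1_L2\<close>) is proved by comparing
  the energy of the transform in a Gaussian window with a Gaussian average of the autocorrelation;
  together with the completeness of \<open>L\<^sup>2\<close> it shows that the Fourier transform is a linear isometry. The
  integer translates of the torus tile the space (\<open>nn_integral_torus_tiling\<close>), which makes fiberization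
  isometric. The Weierstrass approximation theorem shows that an integrable function on the torus is
  nonnegative as soon as its integrals against squared moduli of trigonometric polynomials are
  (\<open>AE_nonneg_of_trig_poly\<close>).
\<close>

section \<open>Projections and Riesz bounds in complex inner product spaces\<close>

lemma norm_square_cinner: "complex_of_real ((norm (x::'a::complex_inner))\<^sup>2) = cinner x x"
proof -
  have "Im (cinner x x) = 0"
    using cinner_commute[of x x] by (metis Reals_cnj_iff complex_is_Real_iff)
  then show ?thesis
    by (simp add: complex_eq_iff power2_norm_eq_inner inner_eq_Re_cinner)
qed

lemma cinner_add_right: "cinner x (y + z) = cinner x y + cinner (x::'a::complex_inner) z"
  by (metis cinner_add_left cinner_commute complex_cnj_add)

lemma cinner_scaleC_right: "cinner x (c *\<^sub>C y) = cnj c * cinner (x::'a::complex_inner) y"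
  by (metis cinner_scaleC_left cinner_commute complex_cnj_mult)

lemma cinner_zero_left [simp]: "cinner 0 (y::'a::complex_inner) = 0"
  using cinner_add_left[of 0 0 y] by simp

lemma cinner_zero_right [simp]: "cinner (y::'a::complex_inner) 0 = 0"
  using cinner_add_right[of y 0 0] by simp

lemma cinner_diff_left: "cinner (x - y) z = cinner x z - cinner (y::'a::complex_inner) z"
  by (metis cinner_add_left diff_add_cancel add_diff_cancel_right')

lemma cinner_diff_right: "cinner z (x - y) = cinner z x - cinner z (y::'a::complex_inner)"
  by (metis cinner_add_right diff_add_cancel add_diff_cancel_right')

lemma cinner_sum_left: "cinner (\<Sum>i\<in>F. x i) (y::'a::complex_inner) = (\<Sum>i\<in>F. cinner (x i) y)"
  by (induction F rule: infinite_finite_induct) (auto simp: cinner_add_left)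

lemma cinner_sum_right: "cinner (y::'a::complex_inner) (\<Sum>i\<in>F. x i) = (\<Sum>i\<in>F. cinner y (x i))"
  by (induction F rule: infinite_finite_induct) (auto simp: cinner_add_right)

lemma norm_scaleC: "norm (c *\<^sub>C x) = cmod c * norm (x::'a::complex_inner)"
proof -
  have "complex_of_real ((norm (c *\<^sub>C x))\<^sup>2) = (c * cnj c) * cinner x x"
    by (simp only: norm_square_cinner cinner_scaleC_left cinner_scaleC_right mult_ac)
  also have "\<dots> = complex_of_real ((cmod c * norm x)\<^sup>2)"
    by (simp only: norm_square_cinner[symmetric] complex_norm_square[symmetric] power_mult_distrib of_real_mult)
  finally have "complex_of_real ((norm (c *\<^sub>C x))\<^sup>2) = complex_of_real ((cmod c * norm x)\<^sup>2)" .
  then have "(norm (c *\<^sub>C x))\<^sup>2 = (cmod c * norm x)\<^sup>2"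
    by (simp only: of_real_eq_iff)
  then show ?thesis
    by (simp add: power2_eq_iff_nonneg)
qed

lemma cmod_cinner_le: "cmod (cinner x y) \<le> norm x * norm (y::'a::complex_inner)"
proof (cases "cinner x y = 0")
  case False
  define u where "u = cnj (sgn (cinner x y))"
  have "u * cinner x y = complex_of_real (cmod (cinner x y))"
    unfolding u_def sgn_eq using False by (simp add: complex_norm_square[symmetric] power2_eq_square
      mult.commute[of "cnj _"])
  then have "cmod (cinner x y) = Re (cinner (u *\<^sub>C x) y)"
    by (simp add: cinner_scaleC_left)
  also have "\<dots> \<le> norm (u *\<^sub>C x) * norm y"
    by (simp flip: inner_eq_Re_cinner add: norm_cauchy_schwarz)
  also have "\<dots> = norm x * norm y"
    using False by (simp add: norm_scaleC u_def norm_sgn)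
  finally show ?thesis .
qed simp

lemma tendsto_scaleC [tendsto_intros]:
  assumes "(f \<longlongrightarrow> a) F" and "(g \<longlongrightarrow> (b::'a::complex_inner)) F"
  shows "((\<lambda>t. f t *\<^sub>C g t) \<longlongrightarrow> a *\<^sub>C b) F"
proof (rule Lim_null[THEN iffD2], rule Lim_null_comparison)
  have eq: "f t *\<^sub>C g t - a *\<^sub>C b = f t *\<^sub>C (g t - b) + (f t - a) *\<^sub>C b" for t
    by (simp add: complex_vector.scale_right_diff_distrib complex_vector.scale_left_diff_distrib)
  show "\<forall>\<^sub>F t in F. norm (f t *\<^sub>C g t - a *\<^sub>C b)
      \<le> cmod (f t) * norm (g t - b) + cmod (f t - a) * norm b"
    unfolding eq by (intro always_eventually allI order.trans[OF norm_triangle_ineq]) (simp add: norm_scaleC)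
  have "((\<lambda>t. cmod (f t) * norm (g t - b) + cmod (f t - a) * norm b) \<longlongrightarrow>
      cmod a * norm (b - b) + cmod (a - a) * norm b) F"
    using assms by (intro tendsto_intros)
  then show "((\<lambda>t. cmod (f t) * norm (g t - b) + cmod (f t - a) * norm b) \<longlongrightarrow> 0) F"
    by simp
qed

lemma tendsto_cinner [tendsto_intros]:
  assumes "(f \<longlongrightarrow> a) F" and "(g \<longlongrightarrow> (b::'a::complex_inner)) F"
  shows "((\<lambda>t. cinner (f t) (g t)) \<longlongrightarrow> cinner a b) F"
proof (rule Lim_null[THEN iffD2], rule Lim_null_comparison)
  have eq: "cinner (f t) (g t) - cinner a b = cinner (f t) (g t - b) + cinner (f t - a) b" for t
    by (simp add: cinner_diff_left cinner_diff_right)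
  show "\<forall>\<^sub>F t in F. cmod (cinner (f t) (g t) - cinner a b)
      \<le> norm (f t) * norm (g t - b) + norm (f t - a) * norm b"
    unfolding eq
    by (intro always_eventually allI order.trans[OF norm_triangle_ineq] add_mono cmod_cinner_le)
  have "((\<lambda>t. norm (f t) * norm (g t - b) + norm (f t - a) * norm b) \<longlongrightarrow>
      norm a * norm (b - b) + norm (a - a) * norm b) F"
    using assms by (intro tendsto_intros)
  then show "((\<lambda>t. norm (f t) * norm (g t - b) + norm (f t - a) * norm b) \<longlongrightarrow> 0) F"
    by simp
qed

lemma csubspace_closure:
  assumes "csubspace (S::'a::complex_inner set)"
  shows "csubspace (closure S)"
proof (rule complex_vector.subspaceI)
  show "0 \<in> closure S"
    using complex_vector.subspace_0[OF assms] closure_subset by blast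
next
  fix x y assume "x \<in> closure S" "y \<in> closure S"
  then obtain X Y where "\<And>n. X n \<in> S" "X \<longlonglongrightarrow> x" "\<And>n. Y n \<in> S" "Y \<longlonglongrightarrow> y"
    by (auto simp: closure_sequential)
  then show "x + y \<in> closure S"
    unfolding closure_sequential
    by (intro exI[of _ "\<lambda>n. X n + Y n"]) (auto intro: tendsto_add complex_vector.subspace_add[OF assms])
next
  fix c x assume "x \<in> closure S"
  then obtain X where "\<And>n. X n \<in> S" "X \<longlonglongrightarrow> x"
    by (auto simp: closure_sequential)
  then show "c *\<^sub>C x \<in> closure S"
    unfolding closure_sequential
    by (intro exI[of _ "\<lambda>n. c *\<^sub>C X n"])
      (auto intro: tendsto_scaleC tendsto_const complex_vector.subspace_scale[OF assms])
qed

lemma closure_cspan_minimal: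
  assumes "csubspace V" "closed V" "S \<subseteq> V"
  shows "closure (cspan S) \<subseteq> (V::'a::complex_inner set)"
  by (intro closure_minimal complex_vector.span_minimal assms)

lemma cinner_orthogonal_closure_cspan:
  assumes orth: "\<And>s. s \<in> S \<Longrightarrow> cinner f s = 0" and g: "g \<in> closure (cspan (S::'a::complex_inner set))"
  shows "cinner f g = 0"
proof -
  have "cinner f h = 0" if "h \<in> cspan S" for h
    using that
    by (induction rule: complex_vector.span_induct_alt)
      (auto simp: cinner_add_right cinner_scaleC_right orth)
  moreover obtain X where X: "\<And>n. X n \<in> cspan S" "X \<longlonglongrightarrow> g"
    using g by (auto simp: closure_sequential)
  ultimately have "(\<lambda>n. cinner f (X n)) = (\<lambda>_. 0)"
    by auto
  with tendsto_cinner[OF tendsto_const X(2), of f] show ?thesis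
    by (simp add: LIMSEQ_const_iff)
qed

lemma cinner_self_eq_0: "cinner x x = 0 \<longleftrightarrow> x = (0::'a::complex_inner)"
  by (simp flip: norm_square_cinner)

text \<open>Gram--Schmidt: project onto the span of the old vectors, then correct along the part of
  the new vector that is orthogonal to them.\<close>

lemma projection_cspan_finite:
  assumes "finite (S::'a::complex_inner set)"
  shows "\<exists>h\<in>cspan S. \<forall>s\<in>S. cinner (f - h) s = 0"
  using assms
proof (induction S arbitrary: f rule: finite_induct)
  case empty
  then show ?case by auto
next
  case (insert x S)
  obtain p where p: "p \<in> cspan S" "\<And>s. s \<in> S \<Longrightarrow> cinner (f - p) s = 0"
    using insert.IH[of f] by blast
  obtain q where q: "q \<in> cspan S" "\<And>s. s \<in> S \<Longrightarrow> cinner (x - q) s = 0"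
    using insert.IH[of x] by blast
  have mono: "cspan S \<subseteq> cspan (insert x S)"
    by (intro complex_vector.span_mono) auto
  have q': "cinner g q = 0" if "\<And>s. s \<in> S \<Longrightarrow> cinner g s = 0" for g
    using cinner_orthogonal_closure_cspan[of S g q] that q(1) closure_subset[of "cspan S"] by auto
  define c where "c = cinner (f - p) (x - q) / cinner (x - q) (x - q)"
  define h where "h = p + c *\<^sub>C (x - q)"
  have "h \<in> cspan (insert x S)"
    unfolding h_def using p(1) q(1) mono
    by (intro complex_vector.span_add complex_vector.span_scale complex_vector.span_diff)
      (auto intro: complex_vector.span_base)
  moreover have old: "cinner (f - h) s = 0" if "s \<in> S" for s
    using p(2)[OF that] q(2)[OF that]
    by (simp add: h_def cinner_diff_left cinner_add_left cinner_scaleC_left)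
  moreover have "cinner (f - h) x = 0"
  proof -
    have "cinner (f - h) (x - q) = 0"
      by (cases "x - q = 0")
        (simp_all add: h_def c_def diff_diff_eq[symmetric] cinner_diff_left[of "f - p"]
          cinner_scaleC_left cinner_self_eq_0)
    with q'[OF old] show ?thesis
      by (simp add: cinner_diff_right)
  qed
  ultimately show ?case by blast
qed

text \<open>Subtract from a vector of the closure its projection onto the span. The difference is orthogonal
  to the generators, hence to the closure of their span, to which it belongs itself.\<close>

lemma closure_cspan_finite:
  assumes "finite (S::'a::complex_inner set)"
  shows "closure (cspan S) = cspan S"
proof (rule antisym[OF _ closure_subset], rule subsetI)
  fix f assume f: "f \<in> closure (cspan S)"
  obtain h where h: "h \<in> cspan S" "\<And>s. s \<in> S \<Longrightarrow> cinner (f - h) s = 0"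
    using projection_cspan_finite[OF assms, of f] by blast
  have "f - h \<in> closure (cspan S)"
    using f h(1) closure_subset[of "cspan S"]
    by (intro complex_vector.subspace_diff csubspace_closure) auto
  from cinner_orthogonal_closure_cspan[OF h(2) this] have "f = h"
    by (simp add: cinner_self_eq_0)
  with h(1) show "f \<in> cspan S" by simp
qed

lemma norm_square_orthogonal_part:
  assumes "cinner (x - y) y = 0"
  shows "(norm x)\<^sup>2 = (norm (x - y))\<^sup>2 + (norm (y::'a::complex_inner))\<^sup>2"
  using norm_add_Pythagorean[of "x - y" y] assms by (simp add: orthogonal_def inner_eq_Re_cinner)

text \<open>A sequence in \<open>V\<close> whose distances to \<open>f\<close> approach the infimum is Cauchy by the
  parallelogram law. Its limit \<open>h\<close> is a nearest point, so the part of \<open>f - h\<close> along any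
  vector of \<open>V\<close> vanishes: moving \<open>h\<close> by that part would bring it closer to \<open>f\<close>.\<close>

lemma projection_closed_csubspace:
  fixes V :: "'a::{complex_inner,complete_space} set"
  assumes "csubspace V" "closed V"
  shows "\<exists>h\<in>V. \<forall>v\<in>V. cinner (f - h) v = 0"
proof -
  define d where "d = (INF v\<in>V. (norm (f - v))\<^sup>2)"
  have bdd: "bdd_below ((\<lambda>v. (norm (f - v))\<^sup>2) ` V)"
    by (rule bdd_belowI[of _ 0]) auto
  have ne: "V \<noteq> {}"
    using complex_vector.subspace_0[OF assms(1)] by auto
  have d_le: "d \<le> (norm (f - v))\<^sup>2" if "v \<in> V" for v
    unfolding d_def using bdd that by (rule cINF_lower)
  have "\<exists>v\<in>V. (norm (f - v))\<^sup>2 < d + inverse (real (Suc n))" for n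
    using cINF_less_iff[OF ne bdd, of "d + inverse (real (Suc n))"] by (simp add: d_def)
  then obtain X where X: "\<And>n. X n \<in> V" "\<And>n. (norm (f - X n))\<^sup>2 < d + inverse (real (Suc n))"
    by metis
  \<comment> \<open>Linear arithmetic on the squared norms, stated for real variables.\<close>
  have aux1: "m \<le> 2 * (p - d) + 2 * (q - d)" if "d \<le> h" "m + 4 * h = 2 * p + 2 * q" for m p q h :: real
    using that by simp
  have aux2: "2 * p + 2 * q < e" if "p < e / 4" "q < e / 4" for p q e :: real
    using that by simp
  have aux3: "q \<le> 0" if "m = p + q" "d \<le> p" "m \<le> d" for m p q :: real
    using that by simp
  have half: "(1/2) *\<^sub>R (u + v) \<in> V" if "u \<in> V" "v \<in> V" for u v
    using that assms(1)
    by (simp add: scaleR_eq_scaleC complex_vector.subspace_add complex_vector.subspace_scale)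
  have par: "(norm (u - v))\<^sup>2 \<le> 2 * ((norm (f - u))\<^sup>2 - d) + 2 * ((norm (f - v))\<^sup>2 - d)"
    if "u \<in> V" "v \<in> V" for u v
  proof -
    have "(norm (u - v))\<^sup>2 + 4 * (norm (f - (1/2) *\<^sub>R (u + v)))\<^sup>2 =
        2 * (norm (f - u))\<^sup>2 + 2 * (norm (f - v))\<^sup>2"
    proof -
      define p q where "p = f - u" and "q = f - v"
      have eqs: "u - v = q - p" "f - (1/2) *\<^sub>R (u + v) = (1/2) *\<^sub>R (p + q)"
        "f - u = p" "f - v = q"
        by (simp_all add: p_def q_def scaleR_right_distrib scaleR_right_diff_distrib flip: scaleR_add_left)
      have "(norm (q - p))\<^sup>2 + (norm (p + q))\<^sup>2 = 2 * (norm p)\<^sup>2 + 2 * (norm q)\<^sup>2"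
        by (simp add: power2_norm_eq_inner inner_diff_left inner_diff_right inner_add_left
          inner_add_right inner_commute)
      then show ?thesis
        unfolding eqs norm_scaleR power_mult_distrib by (simp add: power2_eq_square)
    qed
    with d_le[OF half[OF that]] show ?thesis by (rule aux1)
  qed
  have "Cauchy X"
    unfolding Cauchy_altdef
  proof (intro allI impI)
    fix e :: real assume "0 < e"
    then obtain M where M: "inverse (real (Suc M)) < e\<^sup>2 / 4"
      using reals_Archimedean[of "e\<^sup>2 / 4"] by auto
    have "dist (X m) (X n) < e" if "M \<le> m" "m < n" for m n
    proof -
      have "inverse (real (Suc m)) \<le> inverse (real (Suc M))" "inverse (real (Suc n)) \<le> inverse (real (Suc M))"
        using that by (auto intro!: le_imp_inverse_le)
      then have "(norm (f - X m))\<^sup>2 - d < e\<^sup>2 / 4" "(norm (f - X n))\<^sup>2 - d < e\<^sup>2 / 4"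
        using X(2)[of m] X(2)[of n] M by linarith+
      then have "2 * ((norm (f - X m))\<^sup>2 - d) + 2 * ((norm (f - X n))\<^sup>2 - d) < e\<^sup>2"
        by (rule aux2)
      with par[OF X(1) X(1), of m n] have "(norm (X m - X n))\<^sup>2 < e\<^sup>2"
        by (rule le_less_trans)
      then show ?thesis
        using \<open>0 < e\<close> by (simp add: dist_norm power2_less_imp_less)
    qed
    then show "\<exists>M. \<forall>m\<ge>M. \<forall>n>m. dist (X m) (X n) < e" by blast
  qed
  then obtain h where h: "X \<longlonglongrightarrow> h"
    using Cauchy_convergent_iff convergent_def by blast
  have hV: "h \<in> V"
    using closed_sequentially[OF assms(2) X(1) h] .
  have "(\<lambda>n. (norm (f - X n))\<^sup>2) \<longlonglongrightarrow> (norm (f - h))\<^sup>2"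
    using h by (intro tendsto_intros)
  moreover have "(\<lambda>n. d + inverse (real (Suc n))) \<longlonglongrightarrow> d + 0"
    by (intro tendsto_intros LIMSEQ_inverse_real_of_nat)
  ultimately have "(norm (f - h))\<^sup>2 \<le> d + 0"
    by (rule LIMSEQ_le) (use X(2) less_imp_le in blast)
  then have min: "(norm (f - h))\<^sup>2 \<le> d" by simp
  have "cinner (f - h) v = 0" if v: "v \<in> V" for v
  proof -
    obtain p where p: "p \<in> cspan {v}" "cinner (f - h - p) v = 0"
      using projection_cspan_finite[of "{v}" "f - h"] by auto
    have pV: "p \<in> V" using p(1) complex_vector.span_minimal[OF _ assms(1), of "{v}"] v by blast
    have "cinner (f - h - p) p = 0"
      by (rule cinner_orthogonal_closure_cspan[of "{v}"]) (use p closure_subset in auto)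
    then have "(norm (f - h))\<^sup>2 = (norm (f - h - p))\<^sup>2 + (norm p)\<^sup>2"
      by (intro norm_square_orthogonal_part)
    moreover have "d \<le> (norm (f - h - p))\<^sup>2"
      using d_le[of "h + p"] hV pV assms(1) by (simp add: complex_vector.subspace_add diff_diff_eq)
    ultimately have "(norm p)\<^sup>2 \<le> 0" using min by (rule aux3)
    then show ?thesis using p(2) by simp
  qed
  with hV show ?thesis by blast
qed

text \<open>The bounds of a Riesz sequence as parameters: the passage between \<open>L\<^sup>2\<close> and the fibers
  preserves them, and it must do so with the same constants for almost every fiber.\<close>

definition riesz_bounds :: "real \<Rightarrow> real \<Rightarrow> 'i set \<Rightarrow> ('i \<Rightarrow> 'a::complex_inner) \<Rightarrow> bool" where
  "riesz_bounds a b I x \<longleftrightarrow> 0 < a \<and> 0 < b \<and>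
     (\<forall>F c. finite F \<and> F \<subseteq> I \<longrightarrow>
        a * sqrt (\<Sum>i\<in>F. (cmod (c i))\<^sup>2) \<le> norm (\<Sum>i\<in>F. c i *\<^sub>C x i) \<and>
        norm (\<Sum>i\<in>F. c i *\<^sub>C x i) \<le> b * sqrt (\<Sum>i\<in>F. (cmod (c i))\<^sup>2))"

lemma riesz_sequence_iff_riesz_bounds: "riesz_sequence I x \<longleftrightarrow> (\<exists>a b. riesz_bounds a b I x)"
  unfolding riesz_sequence_def riesz_bounds_def by blast

lemma riesz_bounds_finiteI:
  assumes "finite I" "0 < a" "0 < b"
    and "\<And>c. a * sqrt (\<Sum>i\<in>I. (cmod (c i))\<^sup>2) \<le> norm (\<Sum>i\<in>I. c i *\<^sub>C x i)"
    and "\<And>c. norm (\<Sum>i\<in>I. c i *\<^sub>C x i) \<le> b * sqrt (\<Sum>i\<in>I. (cmod (c i))\<^sup>2)"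
  shows "riesz_bounds a b I x"
  unfolding riesz_bounds_def
proof (intro conjI allI impI; (elim conjE)?)
  fix F and c :: "'a \<Rightarrow> complex" assume F: "finite F" "F \<subseteq> I"
  \<comment> \<open>Coefficients on a part of \<open>I\<close>, padded with zeros.\<close>
  define d where "d i = (if i \<in> F then c i else 0)" for i
  have "(\<Sum>i\<in>I. (cmod (d i))\<^sup>2) = (\<Sum>i\<in>F. (cmod (c i))\<^sup>2)"
    using F assms(1) by (intro sum.mono_neutral_cong_right) (auto simp: d_def)
  moreover have "(\<Sum>i\<in>I. d i *\<^sub>C x i) = (\<Sum>i\<in>F. c i *\<^sub>C x i)"
    using F assms(1) by (intro sum.mono_neutral_cong_right) (auto simp: d_def)
  ultimately show "a * sqrt (\<Sum>i\<in>F. (cmod (c i))\<^sup>2) \<le> norm (\<Sum>i\<in>F. c i *\<^sub>C x i)"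
    "norm (\<Sum>i\<in>F. c i *\<^sub>C x i) \<le> b * sqrt (\<Sum>i\<in>F. (cmod (c i))\<^sup>2)"
    using assms(4)[of d] assms(5)[of d] by simp_all
qed (use assms in auto)

lemma riesz_bounds_reindex:
  assumes fin: "finite J" and inj: "inj_on h J"
  shows "riesz_bounds a b (h ` J) x \<longleftrightarrow> riesz_bounds a b J (x \<circ> h)"
proof
  assume L: "riesz_bounds a b (h ` J) x"
  then have ab: "0 < a" "0 < b" by (simp_all add: riesz_bounds_def)
  show "riesz_bounds a b J (x \<circ> h)"
  proof (rule riesz_bounds_finiteI[OF fin ab])
    fix c :: "'a \<Rightarrow> complex"
    have "(\<Sum>i\<in>h ` J. (cmod (c (inv_into J h i)))\<^sup>2) = (\<Sum>i\<in>J. (cmod (c i))\<^sup>2)"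
      "(\<Sum>i\<in>h ` J. c (inv_into J h i) *\<^sub>C x i) = (\<Sum>i\<in>J. c i *\<^sub>C (x \<circ> h) i)"
      by (simp_all add: sum.reindex[OF inj] inj)
    then show "a * sqrt (\<Sum>i\<in>J. (cmod (c i))\<^sup>2) \<le> norm (\<Sum>i\<in>J. c i *\<^sub>C (x \<circ> h) i)"
      "norm (\<Sum>i\<in>J. c i *\<^sub>C (x \<circ> h) i) \<le> b * sqrt (\<Sum>i\<in>J. (cmod (c i))\<^sup>2)"
      using L[unfolded riesz_bounds_def, THEN conjunct2, THEN conjunct2, rule_format,
          of "h ` J" "c \<circ> inv_into J h"] fin by simp_all
  qed
next
  assume R: "riesz_bounds a b J (x \<circ> h)"
  then have ab: "0 < a" "0 < b" by (simp_all add: riesz_bounds_def)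
  show "riesz_bounds a b (h ` J) x"
    using R[unfolded riesz_bounds_def, THEN conjunct2, THEN conjunct2, rule_format, of J "_ \<circ> h"] fin
    by (intro riesz_bounds_finiteI ab) (simp_all add: sum.reindex[OF inj])
qed

text \<open>The last step of every Cauchy--Schwarz argument below: a quantity estimated by itself times a
  bound is below the bound.\<close>

lemma norm_square_le_mult_imp_le:
  assumes "(s::real)\<^sup>2 \<le> s * t" "0 \<le> t" shows "s \<le> t"
  using assms by (cases "s \<le> 0") (auto simp: power2_eq_square mult_le_cancel_left)

text \<open>Expanding one factor of the squared norm of a combination and applying the
  Cauchy--Schwarz inequality to the coefficients.\<close>

lemma cmod_cinner_sum_le:
  fixes x :: "'i \<Rightarrow> 'a::complex_inner"
  shows "cmod (cinner g (\<Sum>i\<in>F. c i *\<^sub>C x i))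
    \<le> sqrt (\<Sum>i\<in>F. (cmod (c i))\<^sup>2) * sqrt (\<Sum>i\<in>F. (cmod (cinner g (x i)))\<^sup>2)"
proof -
  have "cmod (cinner g (\<Sum>i\<in>F. c i *\<^sub>C x i)) \<le> (\<Sum>i\<in>F. cmod (c i) * cmod (cinner g (x i)))"
    unfolding cinner_sum_right cinner_scaleC_right
    by (rule order.trans[OF norm_sum]) (simp add: norm_mult)
  also have "\<dots> \<le> L2_set (\<lambda>i. cmod (c i)) F * L2_set (\<lambda>i. cmod (cinner g (x i))) F"
    using L2_set_mult_ineq[of "\<lambda>i. cmod (c i)" "\<lambda>i. cmod (cinner g (x i))" F] by simp
  finally show ?thesis by (simp add: L2_set_def)
qed

text \<open>Synthesis with the coefficients \<open>cinner f (x i)\<close> and testing against \<open>f\<close> dualizes the upper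
  Riesz bound into the Bessel inequality, with the same constant.\<close>

lemma riesz_bounds_bessel:
  assumes "riesz_bounds a b I x" "finite F" "F \<subseteq> I"
  shows "sqrt (\<Sum>i\<in>F. (cmod (cinner f (x i)))\<^sup>2) \<le> b * norm f"
proof -
  define g where "g = (\<Sum>i\<in>F. cinner f (x i) *\<^sub>C x i)"
  define s where "s = sqrt (\<Sum>i\<in>F. (cmod (cinner f (x i)))\<^sup>2)"
  have b: "0 < b" using assms by (simp add: riesz_bounds_def)
  have "complex_of_real (s\<^sup>2) = cinner f g"
    unfolding g_def cinner_sum_right cinner_scaleC_right s_def
    by (simp add: sum_nonneg complex_norm_square mult.commute del: of_real_power)
  then have "s\<^sup>2 \<le> norm f * norm g"
    using cmod_cinner_le[of f g] by (metis norm_of_real abs_power2 real_norm_def of_real_power)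
  also have "\<dots> \<le> norm f * (b * s)"
    unfolding g_def s_def using assms
    by (intro mult_left_mono) (auto simp: riesz_bounds_def)
  finally have "s\<^sup>2 \<le> s * (b * norm f)" by (simp add: mult_ac)
  then show ?thesis
    using norm_square_le_mult_imp_le[of s "b * norm f"] b by (simp add: s_def)
qed

lemma cspan_image_sumE:
  assumes "f \<in> cspan (x ` I)"
  obtains F c where "finite F" "F \<subseteq> I" "f = (\<Sum>i\<in>F. c i *\<^sub>C (x i :: 'a::complex_inner))"
proof -
  obtain t r where t: "finite t" "t \<subseteq> x ` I" "f = (\<Sum>a\<in>t. r a *\<^sub>C a)"
    using assms unfolding complex_vector.span_explicit mem_Collect_eq by (elim exE conjE)
  from iffD1[OF subset_image_inj t(2)] obtain F where F: "F \<subseteq> I" "inj_on x F" "t = x ` F"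
    by (elim exE conjE)
  then have "finite F" using t(1) finite_image_iff by blast
  moreover have "f = (\<Sum>i\<in>F. (r \<circ> x) i *\<^sub>C x i)"
    using t(3) F by (simp add: sum.reindex)
  ultimately show ?thesis using F(1) that by blast
qed

text \<open>The lower frame inequality holds with the square of the lower Riesz bound on the span; it
  passes to the closure because the Bessel inequality makes both sides continuous.\<close>

lemma frame_of_riesz_bounds:
  assumes "riesz_bounds a b I (x :: 'i \<Rightarrow> 'a::complex_inner)"
  shows "frame_with_bounds (closure (cspan (x ` I))) (a\<^sup>2) (b\<^sup>2) I x"
  unfolding frame_with_bounds_def
proof (intro conjI ballI)
  have a: "0 < a" and b: "0 < b" using assms by (simp_all add: riesz_bounds_def)
  then show "0 < a\<^sup>2" "0 < b\<^sup>2" by simp_all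
  show "x ` I \<subseteq> closure (cspan (x ` I))"
    using complex_vector.span_superset[of "x ` I"] closure_subset[of "cspan (x ` I)"] by (rule order.trans)
  fix f assume f: "f \<in> closure (cspan (x ` I))"
  let ?s = "\<lambda>f i. (cmod (cinner f (x i)))\<^sup>2"
  have fin: "sum (?s f) F \<le> b\<^sup>2 * (norm f)\<^sup>2" if "finite F" "F \<subseteq> I" for f F
    using sqrt_le_D[OF riesz_bounds_bessel[OF assms that, of f]] by (simp add: power_mult_distrib)
  show summ: "?s f summable_on I"
    by (rule nonneg_bounded_partial_sums_imp_summable_on[of _ _ "b\<^sup>2 * (norm f)\<^sup>2"])
      (auto intro!: eventually_finite_subsets_at_top_weakI fin)
  show "infsum (?s f) I \<le> b\<^sup>2 * (norm f)\<^sup>2"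
    using summ fin by (rule infsum_le_finite_sums)
  obtain X where X: "\<And>n. X n \<in> cspan (x ` I)" "X \<longlonglongrightarrow> f"
    using f by (auto simp: closure_sequential)
  have bound: "a * norm g \<le> sqrt (infsum (?s f) I) + b * norm (g - f)" if g: "g \<in> cspan (x ` I)" for g
  proof -
    from g obtain F c where F: "finite F" "F \<subseteq> I" and gF: "g = (\<Sum>i\<in>F. c i *\<^sub>C x i)"
      by (rule cspan_image_sumE)
    define t where "t = sqrt (\<Sum>i\<in>F. (cmod (c i))\<^sup>2)"
    have t: "a * t \<le> norm g"
      using assms F by (simp add: riesz_bounds_def gF t_def)
    have "(norm g)\<^sup>2 = cmod (cinner g g)"
      by (metis norm_square_cinner norm_of_real abs_power2)
    also have "\<dots> \<le> t * sqrt (sum (?s g) F)"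
      using cmod_cinner_sum_le[of g c x F] by (simp add: gF t_def)
    finally have "a * (norm g)\<^sup>2 \<le> (a * t) * sqrt (sum (?s g) F)"
      using a by simp
    also have "\<dots> \<le> norm g * sqrt (sum (?s g) F)"
      using t by (intro mult_right_mono) (simp_all add: sum_nonneg)
    finally have "(a * norm g)\<^sup>2 \<le> (a * norm g) * sqrt (sum (?s g) F)"
      using a by (simp add: power2_eq_square mult_ac)
    then have "a * norm g \<le> sqrt (sum (?s g) F)"
      by (rule norm_square_le_mult_imp_le) (simp add: sum_nonneg)
    also have "\<dots> = L2_set (\<lambda>i. cmod (cinner f (x i) + cinner (g - f) (x i))) F"
      by (simp add: L2_set_def cinner_diff_left)
    also have "\<dots> \<le> L2_set (\<lambda>i. cmod (cinner f (x i)) + cmod (cinner (g - f) (x i))) F"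
      by (intro L2_set_mono norm_triangle_ineq) simp
    also have "\<dots> \<le> sqrt (sum (?s f) F) + sqrt (sum (?s (g - f)) F)"
      using L2_set_triangle_ineq[of "\<lambda>i. cmod (cinner f (x i))" _ F] by (simp add: L2_set_def)
    also have "\<dots> \<le> sqrt (infsum (?s f) I) + b * norm (g - f)"
      using riesz_bounds_bessel[OF assms F, of "g - f"] finite_sum_le_infsum[OF summ F]
      by (intro add_mono) auto
    finally show ?thesis .
  qed
  have "(\<lambda>n. a * norm (X n)) \<longlonglongrightarrow> a * norm f"
    using X(2) by (intro tendsto_intros)
  moreover have "(\<lambda>n. sqrt (infsum (?s f) I) + b * norm (X n - f)) \<longlonglongrightarrow>
      sqrt (infsum (?s f) I) + b * norm (f - f)"
    using X(2) by (intro tendsto_intros)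
  ultimately have "a * norm f \<le> sqrt (infsum (?s f) I)"
    using bound X(1) LIMSEQ_le by force
  then have "(a * norm f)\<^sup>2 \<le> (sqrt (infsum (?s f) I))\<^sup>2"
    using a by (intro power_mono) auto
  then show "a\<^sup>2 * (norm f)\<^sup>2 \<le> infsum (?s f) I"
    by (simp add: power_mult_distrib infsum_nonneg)
qed

lemma frame_orthogonal_eq_0:
  assumes "frame_with_bounds H A B I x" "f \<in> H" "\<And>i. i \<in> I \<Longrightarrow> cinner f (x i) = 0"
  shows "f = (0::'a::complex_inner)"
proof -
  have "A * (norm f)\<^sup>2 \<le> infsum (\<lambda>i. (cmod (cinner f (x i)))\<^sup>2) I"
    using assms by (simp add: frame_with_bounds_def)
  also have "\<dots> = 0" using assms(3) by (simp add: infsum_0)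
  finally show ?thesis using assms(1) by (simp add: frame_with_bounds_def mult_le_0_iff)
qed

text \<open>The difference between a vector of \<open>V\<close> and its projection onto the closed span is orthogonal
  to every generator.\<close>

lemma closure_cspan_eq_of_total:
  fixes V :: "'a::{complex_inner,complete_space} set"
  assumes V: "csubspace V" "closed V" and S: "S \<subseteq> V"
    and total: "\<And>f. f \<in> V \<Longrightarrow> (\<And>s. s \<in> S \<Longrightarrow> cinner f s = 0) \<Longrightarrow> f = 0"
  shows "closure (cspan S) = V"
proof
  show sub: "closure (cspan S) \<subseteq> V" using closure_cspan_minimal[OF V S] .
  show "V \<subseteq> closure (cspan S)"
  proof
    fix f assume f: "f \<in> V"
    have "csubspace (closure (cspan S))" by (intro csubspace_closure) simp
    then obtain h where h: "h \<in> closure (cspan S)" "\<And>v. v \<in> closure (cspan S) \<Longrightarrow> cinner (f - h) v = 0"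
      using projection_closed_csubspace[of "closure (cspan S)" f] by auto
    have "f - h \<in> V" using f h(1) sub V(1) by (auto intro: complex_vector.subspace_diff)
    moreover have "cinner (f - h) s = 0" if "s \<in> S" for s
      using h(2) that complex_vector.span_superset closure_subset by blast
    ultimately have "f - h = 0" by (rule total)
    then show "f \<in> closure (cspan S)" using h(1) by simp
  qed
qed

text \<open>The projection onto the finite span leaves a vector of \<open>H\<close> that is orthogonal to the frame,
  and the lower frame bound forces it to vanish.\<close>

lemma cspan_eq_of_finite_frame:
  fixes x :: "'i \<Rightarrow> 'a::complex_inner"
  assumes H: "csubspace H" and fin: "finite I" and fr: "frame_with_bounds H A B I x"
  shows "cspan (x ` I) = H"
proof
  show sub: "cspan (x ` I) \<subseteq> H"
    using H fr by (intro complex_vector.span_minimal) (auto simp: frame_with_bounds_def)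
  show "H \<subseteq> cspan (x ` I)"
  proof
    fix f assume f: "f \<in> H"
    obtain h where h: "h \<in> cspan (x ` I)" "\<And>s. s \<in> x ` I \<Longrightarrow> cinner (f - h) s = 0"
      using projection_cspan_finite[of "x ` I" f] fin by auto
    have "f - h \<in> H" using f h(1) sub H by (auto intro: complex_vector.subspace_diff)
    then have "f - h = 0" using h(2) by (intro frame_orthogonal_eq_0[OF fr]) auto
    then show "f \<in> cspan (x ` I)" using h(1) by simp
  qed
qed

lemma riesz_bounds_independent:
  assumes "riesz_bounds a b I (x :: 'i \<Rightarrow> 'a::complex_inner)"
  shows "inj_on x I" "complex_vector.independent (x ` I)"
proof -
  have a: "0 < a" using assms by (simp add: riesz_bounds_def)
  show inj: "inj_on x I"
  proof (rule inj_onI, rule ccontr)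
    fix i j assume ij: "i \<in> I" "j \<in> I" "x i = x j" "i \<noteq> j"
    \<comment> \<open>Two equal vectors would allow the combination \<open>x i - x j = 0\<close> with coefficients \<open>1\<close> and \<open>-1\<close>.\<close>
    define c where "c k = (if k = i then 1 else -1 :: complex)" for k
    have "a * sqrt (\<Sum>k\<in>{i,j}. (cmod (c k))\<^sup>2) \<le> norm (\<Sum>k\<in>{i,j}. c k *\<^sub>C x k)"
      using assms[unfolded riesz_bounds_def, THEN conjunct2, THEN conjunct2, rule_format, of "{i,j}" c] ij
      by auto
    also have "\<dots> = 0" using ij by (simp add: c_def)
    finally show False using ij a by (simp add: c_def mult_le_0_iff)
  qed
  show "complex_vector.independent (x ` I)"
    unfolding complex_vector.independent_explicit_module
  proof (intro allI impI)
    fix t u v assume t: "finite t" "t \<subseteq> x ` I" "(\<Sum>v\<in>t. u v *\<^sub>C v) = 0" "v \<in> t"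
    from iffD1[OF subset_image_inj t(2)] obtain F where F: "F \<subseteq> I" "inj_on x F" "t = x ` F"
      by (elim exE conjE)
    then have fF: "finite F" using t(1) finite_image_iff by blast
    have "(\<Sum>i\<in>F. (u \<circ> x) i *\<^sub>C x i) = 0"
      using t(3) F by (simp add: sum.reindex)
    moreover have "a * sqrt (\<Sum>i\<in>F. (cmod ((u \<circ> x) i))\<^sup>2) \<le> norm (\<Sum>i\<in>F. (u \<circ> x) i *\<^sub>C x i)"
      using assms[unfolded riesz_bounds_def, THEN conjunct2, THEN conjunct2, rule_format, of F "u \<circ> x"] F fF
      by auto
    ultimately have "(\<Sum>i\<in>F. (cmod ((u \<circ> x) i))\<^sup>2) \<le> 0"
      using a by (simp add: mult_le_0_iff)
    then have "(\<Sum>i\<in>F. (cmod ((u \<circ> x) i))\<^sup>2) = 0"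
      by (meson antisym sum_nonneg zero_le_power2)
    then have "\<forall>i\<in>F. (cmod ((u \<circ> x) i))\<^sup>2 = 0"
      using fF by (subst (asm) sum_nonneg_eq_0_iff) auto
    then show "u v = 0" using t(4) F by auto
  qed
qed

text \<open>The coefficients of a combination are recovered by testing against a dual vector; the lower
  frame bound controls the norm of that dual vector.\<close>

lemma riesz_bounds_of_independent_frame:
  fixes x :: "'i \<Rightarrow> 'a::complex_inner"
  assumes H: "csubspace H" and fin: "finite I" and fr: "frame_with_bounds H A B I x"
    and inj: "inj_on x I" and indep: "complex_vector.independent (x ` I)"
  shows "riesz_bounds (sqrt A) (sqrt B) I x"
proof (rule riesz_bounds_finiteI[OF fin])
  have AB: "0 < A" "0 < B" and xH: "x ` I \<subseteq> H"
    and fr': "\<And>f. f \<in> H \<Longrightarrow> A * (norm f)\<^sup>2 \<le> (\<Sum>i\<in>I. (cmod (cinner f (x i)))\<^sup>2) \<and>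
      (\<Sum>i\<in>I. (cmod (cinner f (x i)))\<^sup>2) \<le> B * (norm f)\<^sup>2"
    using fr fin by (auto simp: frame_with_bounds_def)
  then show "0 < sqrt A" "0 < sqrt B" by simp_all
  fix c :: "'i \<Rightarrow> complex"
  define g where "g = (\<Sum>i\<in>I. c i *\<^sub>C x i)"
  define t where "t = sqrt (\<Sum>i\<in>I. (cmod (c i))\<^sup>2)"
  have sqrtle: "sqrt A * norm f \<le> sqrt (\<Sum>i\<in>I. (cmod (cinner f (x i)))\<^sup>2)"
    "sqrt (\<Sum>i\<in>I. (cmod (cinner f (x i)))\<^sup>2) \<le> sqrt B * norm f" if "f \<in> H" for f
    using fr'[OF that] AB
    by (metis real_sqrt_le_iff real_sqrt_mult real_sqrt_abs abs_norm_cancel)+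
  have gH: "g \<in> H"
    unfolding g_def using H xH
    by (intro complex_vector.subspace_sum complex_vector.subspace_scale) auto
  have "(norm g)\<^sup>2 = cmod (cinner g g)"
    by (metis norm_square_cinner norm_of_real abs_power2)
  also have "\<dots> \<le> t * sqrt (\<Sum>i\<in>I. (cmod (cinner g (x i)))\<^sup>2)"
    using cmod_cinner_sum_le[of g c x I] by (simp add: g_def t_def)
  also have "\<dots> \<le> t * (sqrt B * norm g)"
    using sqrtle(2)[OF gH] by (intro mult_left_mono) (simp_all add: t_def sum_nonneg)
  finally have "(norm g)\<^sup>2 \<le> norm g * (sqrt B * t)" by (simp add: mult_ac)
  then show "norm (\<Sum>i\<in>I. c i *\<^sub>C x i) \<le> sqrt B * sqrt (\<Sum>i\<in>I. (cmod (c i))\<^sup>2)"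
    using norm_square_le_mult_imp_le[of "norm g" "sqrt B * t"] AB by (simp add: g_def t_def sum_nonneg)
  \<comment> \<open>The dual vectors: the part of \<open>x i\<close> orthogonal to the other members, rescaled.\<close>
  have "\<exists>y\<in>H. (\<forall>j\<in>I. cinner y (x j) = (if j = i then 1 else 0))" if i: "i \<in> I" for i
  proof -
    obtain h where h: "h \<in> cspan (x ` (I - {i}))" "\<And>s. s \<in> x ` (I - {i}) \<Longrightarrow> cinner (x i - h) s = 0"
      using projection_cspan_finite[of "x ` (I - {i})" "x i"] fin by auto
    have img: "x ` (I - {i}) = x ` I - {x i}" using inj i by (auto simp: inj_on_def)
    have "x i \<notin> cspan (x ` (I - {i}))"
      using indep i unfolding img complex_vector.dependent_def by blast
    then have ne: "x i - h \<noteq> 0" using h(1) by auto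
    have hH: "h \<in> H" using h(1) complex_vector.span_minimal[OF _ H, of "x ` (I - {i})"] xH by blast
    have "cinner (x i - h) h = 0"
      using cinner_orthogonal_closure_cspan[OF h(2)] h(1) closure_subset by blast
    then have xi: "cinner (x i - h) (x i) = cinner (x i - h) (x i - h)"
      by (simp add: cinner_diff_right[of "x i - h"])
    define y where "y = (1 / cinner (x i - h) (x i)) *\<^sub>C (x i - h)"
    have "y \<in> H" unfolding y_def using H hH xH i
      by (intro complex_vector.subspace_scale complex_vector.subspace_diff) auto
    moreover have "\<forall>j\<in>I. cinner y (x j) = (if j = i then 1 else 0)"
      using h(2) ne by (auto simp: y_def cinner_scaleC_left xi cinner_self_eq_0)
    ultimately show ?thesis by blast
  qed
  then obtain y where y: "\<And>i. i \<in> I \<Longrightarrow> y i \<in> H"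
    "\<And>i j. i \<in> I \<Longrightarrow> j \<in> I \<Longrightarrow> cinner (y i) (x j) = (if j = i then 1 else 0)"
    by metis
  define f where "f = (\<Sum>i\<in>I. c i *\<^sub>C y i)"
  have fH: "f \<in> H" unfolding f_def using H y(1)
    by (intro complex_vector.subspace_sum complex_vector.subspace_scale) auto
  have fx: "cinner f (x j) = c j" if "j \<in> I" for j
  proof -
    have "cinner f (x j) = (\<Sum>i\<in>I. if j = i then c i else 0)"
      unfolding f_def cinner_sum_left cinner_scaleC_left using y(2) that by (intro sum.cong) auto
    then show ?thesis using that fin by (simp add: sum.delta)
  qed
  have Af: "sqrt A * norm f \<le> t" using sqrtle(1)[OF fH] fx by (simp add: t_def)
  have "complex_of_real (t\<^sup>2) = cinner f g"
    unfolding g_def cinner_sum_right cinner_scaleC_right t_def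
    by (simp add: fx sum_nonneg complex_norm_square mult.commute del: of_real_power)
  then have "t\<^sup>2 \<le> norm f * norm g"
    using cmod_cinner_le[of f g] by (metis norm_of_real abs_power2 real_norm_def of_real_power)
  then have "sqrt A * t\<^sup>2 \<le> (sqrt A * norm f) * norm g"
    using AB by simp
  also have "\<dots> \<le> t * norm g" using Af by (rule mult_right_mono) simp
  finally have "sqrt A * (sqrt A * t\<^sup>2) \<le> sqrt A * (t * norm g)"
    using AB by (intro mult_left_mono) auto
  then have "(sqrt A * t)\<^sup>2 \<le> (sqrt A * t) * norm g"
    by (simp only: power2_eq_square mult_ac)
  then show "sqrt A * sqrt (\<Sum>i\<in>I. (cmod (c i))\<^sup>2) \<le> norm (\<Sum>i\<in>I. c i *\<^sub>C x i)"
    using norm_square_le_mult_imp_le[of "sqrt A * t" "norm g"] by (simp add: g_def t_def)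
qed

section \<open>The space \<open>L\<^sup>2\<close>: representatives and completeness\<close>

lemma L2_rel_rep: "L2_rel (rep_L2 f) (rep_L2 f)"
  using Quotient3_rep_reflp[OF Quotient3_L2] .

lemma square_integrable_rep: "square_integrable (rep_L2 f)"
  using L2_rel_rep[of f] by (simp add: L2_rel_def)

lemma measurable_rep_L2 [measurable]: "rep_L2 f \<in> borel_measurable borel"
  using square_integrable_rep[of f] by (simp add: square_integrable_def)

lemma L2_rel_refl: "square_integrable h \<Longrightarrow> L2_rel h h"
  by (simp add: L2_rel_def)

lemma abs_L2_eq_iff:
  "square_integrable g \<Longrightarrow> square_integrable h \<Longrightarrow> abs_L2 g = abs_L2 h \<longleftrightarrow> (AE x in lborel. g x = h x)"
  using Quotient3_rel[OF Quotient3_L2, of g h] by (auto simp: L2_rel_def)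

lemma abs_rep_L2: "abs_L2 (rep_L2 f) = f"
  using Quotient3_abs_rep[OF Quotient3_L2] .

lemma rep_abs_L2: "square_integrable h \<Longrightarrow> AE x in lborel. rep_L2 (abs_L2 h) x = h x"
  using abs_L2_eq_iff[of "rep_L2 (abs_L2 h)" h] by (simp add: abs_rep_L2 square_integrable_rep)

lemma abs_L2_add:
  "square_integrable g \<Longrightarrow> square_integrable h \<Longrightarrow> abs_L2 g + abs_L2 h = abs_L2 (\<lambda>x. g x + h x)"
  by (simp add: plus_L2.abs_eq L2_rel_refl)

lemma abs_L2_scaleC: "square_integrable g \<Longrightarrow> c *\<^sub>C abs_L2 g = abs_L2 (\<lambda>x. c * g x)"
  by (simp add: scaleC_L2.abs_eq L2_rel_refl)

lemma square_integrable_diff: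
  "square_integrable g \<Longrightarrow> square_integrable h \<Longrightarrow> square_integrable (\<lambda>x. g x - h x)"
  using square_integrable_add[of g "\<lambda>x. -1 * h x"] square_integrable_scaleC[of h "-1"] by simp

lemma abs_L2_diff:
  assumes "square_integrable g" "square_integrable h"
  shows "abs_L2 g - abs_L2 h = abs_L2 (\<lambda>x. g x - h x)"
  unfolding minus_L2_def abs_L2_scaleC[OF assms(2)]
    abs_L2_add[OF assms(1) square_integrable_scaleC[OF assms(2)]] by simp

lemma rep_L2_add: "AE x in lborel. rep_L2 (f + g) x = rep_L2 f x + rep_L2 g x"
  using rep_abs_L2[OF square_integrable_add[OF square_integrable_rep[of f] square_integrable_rep[of g]]]
  by (simp add: abs_L2_add[symmetric] square_integrable_rep abs_rep_L2)

lemma rep_L2_scaleC: "AE x in lborel. rep_L2 (c *\<^sub>C f) x = c * rep_L2 f x"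
  using rep_abs_L2[OF square_integrable_scaleC[OF square_integrable_rep[of f], of c]]
  by (simp add: abs_L2_scaleC[symmetric] square_integrable_rep abs_rep_L2)

lemma cinner_abs_L2:
  "square_integrable g \<Longrightarrow> square_integrable h \<Longrightarrow>
    cinner (abs_L2 g) (abs_L2 h) = (LINT x|lborel. g x * cnj (h x))"
  by (simp add: cinner_L2.abs_eq L2_rel_refl)

lemma norm_abs_L2:
  assumes "square_integrable h"
  shows "(norm (abs_L2 h))\<^sup>2 = (LINT x|lborel. (cmod (h x))\<^sup>2)"
  using assms by (simp add: norm_L2_def inner_L2_def cinner_abs_L2 complex_norm_square[symmetric]
      flip: of_real_power)

lemma ennreal_norm_abs_L2:
  assumes "square_integrable h"
  shows "ennreal ((norm (abs_L2 h))\<^sup>2) = (\<integral>\<^sup>+x. ennreal ((cmod (h x))\<^sup>2) \<partial>lborel)"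
  unfolding norm_abs_L2[OF assms] using assms
  by (intro nn_integral_eq_integral[symmetric]) (auto simp: square_integrable_def)

lemma ennreal_norm_L2: "ennreal ((norm f)\<^sup>2) = (\<integral>\<^sup>+x. ennreal ((cmod (rep_L2 f x))\<^sup>2) \<partial>lborel)"
  using ennreal_norm_abs_L2[OF square_integrable_rep[of f]] by (simp add: abs_rep_L2)

lemma square_integrable_iff_nn_integral:
  "square_integrable h \<longleftrightarrow>
    h \<in> borel_measurable borel \<and> (\<integral>\<^sup>+x. ennreal ((cmod (h x))\<^sup>2) \<partial>lborel) < \<infinity>"
  unfolding square_integrable_def by (auto simp: integrable_iff_bounded)

text \<open>Riesz--Fischer: along a rapidly Cauchy subsequence the representatives converge almost
  everywhere, and Fatou's lemma bounds the distance to the pointwise limit.\<close>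

instance L2 :: (euclidean_space) complete_space
proof
  fix X :: "nat \<Rightarrow> 'a L2" assume X: "Cauchy X"
  \<comment> \<open>Along the subsequence \<open>r\<close> the distances are below powers of \<open>1/2\<close>. The weights \<open>2^k\<close> in \<open>S\<close> leave the
    integral of \<open>S\<close> finite and force the increments to decay geometrically wherever \<open>S\<close> is finite.\<close>
  have "\<exists>M. \<forall>m\<ge>M. \<forall>n\<ge>M. norm (X m - X n) < (1/2)^k" for k
    using X unfolding Cauchy_iff by auto
  then obtain M where M: "\<And>k m n. m \<ge> M k \<Longrightarrow> n \<ge> M k \<Longrightarrow> norm (X m - X n) < (1/2)^k"
    by metis
  have quarter: "(1/4 :: real)^k = ((1/2)^k)\<^sup>2" for k
    by (simp add: power2_eq_square power_divide flip: power_mult_distrib)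
  define r where "r k = (\<Sum>j\<le>k. M j)" for k
  have rM: "M k \<le> r k" for k unfolding r_def by (intro member_le_sum) auto
  have rmono: "r j \<le> r k" if "j \<le> k" for j k unfolding r_def using that by (intro sum_mono2) auto
  define f where "f k = rep_L2 (X (r k))" for k
  have [measurable]: "f k \<in> borel_measurable borel" for k unfolding f_def by measurable
  have rep_diff: "(\<integral>\<^sup>+x. ennreal ((cmod (rep_L2 g x - rep_L2 h x))\<^sup>2) \<partial>lborel) = ennreal ((norm (g - h))\<^sup>2)"
    for g h :: "'a L2"
    using ennreal_norm_abs_L2[OF square_integrable_diff[OF square_integrable_rep[of g] square_integrable_rep[of h]]]
    by (simp add: abs_L2_diff[symmetric] square_integrable_rep abs_rep_L2)
  have small: "(\<integral>\<^sup>+x. ennreal ((cmod (f j x - f k x))\<^sup>2) \<partial>lborel) \<le> ennreal ((1/4)^i)"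
    if "i \<le> j" "i \<le> k" for i j k
  proof -
    have "norm (X (r j) - X (r k)) < (1/2)^i"
      using rM rmono that by (intro M) (meson order.trans)+
    then have "(norm (X (r j) - X (r k)))\<^sup>2 \<le> ((1/2)^i)\<^sup>2"
      by (intro power_mono) auto
    also have "\<dots> = (1/4)^i" by (rule quarter[symmetric])
    finally show ?thesis unfolding f_def rep_diff by (rule ennreal_leI)
  qed
  define S where "S x = (\<Sum>k. ennreal (2^k * (cmod (f (Suc k) x - f k x))\<^sup>2))" for x
  have [measurable]: "S \<in> borel_measurable borel" unfolding S_def by measurable
  have "(\<integral>\<^sup>+x. S x \<partial>lborel) = (\<Sum>k. \<integral>\<^sup>+x. ennreal (2^k * (cmod (f (Suc k) x - f k x))\<^sup>2) \<partial>lborel)"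
    unfolding S_def by (rule nn_integral_suminf) simp
  also have "\<dots> \<le> (\<Sum>k. ennreal ((1/2)^k))"
  proof (intro suminf_le)
    fix k
    have "(\<integral>\<^sup>+x. ennreal (2^k * (cmod (f (Suc k) x - f k x))\<^sup>2) \<partial>lborel) =
        ennreal (2^k) * (\<integral>\<^sup>+x. ennreal ((cmod (f (Suc k) x - f k x))\<^sup>2) \<partial>lborel)"
      by (simp add: ennreal_mult nn_integral_cmult)
    also have "\<dots> \<le> ennreal (2^k) * ennreal ((1/4)^k)"
      using small[of k "Suc k" k] by (intro mult_left_mono) auto
    also have "\<dots> = ennreal ((1/2)^k)"
      by (simp add: ennreal_mult[symmetric] power_mult_distrib[symmetric])
    finally show "(\<integral>\<^sup>+x. ennreal (2^k * (cmod (f (Suc k) x - f k x))\<^sup>2) \<partial>lborel) \<le> ennreal ((1/2)^k)" .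
  qed auto
  also have "\<dots> < \<infinity>"
    by (subst suminf_ennreal2) (simp_all only: summable_geometric power_one_over, simp_all)
  finally have "AE x in lborel. S x \<noteq> \<infinity>"
    by (intro nn_integral_PInf_AE) auto
  then have conv: "AE x in lborel. convergent (\<lambda>k. f k x)"
  proof eventually_elim
    fix x assume "S x \<noteq> \<infinity>"
    define C where "C = enn2real (S x)"
    have C: "2^k * (cmod (f (Suc k) x - f k x))\<^sup>2 \<le> C" for k
    proof -
      have "ennreal (2^k * (cmod (f (Suc k) x - f k x))\<^sup>2) \<le> S x"
        unfolding S_def using sum_le_suminf[OF summableI, of "{k}"] by simp
      also have "\<dots> = ennreal C" using \<open>S x \<noteq> \<infinity>\<close> by (simp add: C_def less_top)
      finally show ?thesis by (subst (asm) ennreal_le_iff) (simp_all add: C_def)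
    qed
    have le: "norm (f (Suc k) x - f k x) \<le> sqrt C * sqrt (1/2)^k" for k
    proof -
      have "(cmod (f (Suc k) x - f k x))\<^sup>2 \<le> C * (1/2)^k"
        using C[of k] by (simp add: field_simps power_divide)
      from real_sqrt_le_mono[OF this] show ?thesis
        by (simp add: real_sqrt_mult real_sqrt_power)
    qed
    have "sqrt (1/2) < (1::real)" by simp
    then have sm: "summable (\<lambda>k. sqrt C * sqrt (1/2)^k)"
      by (intro summable_mult summable_geometric) auto
    have "summable (\<lambda>k. f (Suc k) x - f k x)"
      by (rule summable_comparison_test'[OF sm]) (rule le)
    then have "convergent (\<lambda>n. \<Sum>k<n. f (Suc k) x - f k x)"
      by (simp add: summable_iff_convergent)
    then have "convergent (\<lambda>n. (f n x - f 0 x) + f 0 x)"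
      unfolding sum_lessThan_telescope[of "\<lambda>k. f k x"] by (intro convergent_add convergent_const)
    then show "convergent (\<lambda>k. f k x)" by simp
  qed
  define g where "g x = (if convergent (\<lambda>k. f k x) then lim (\<lambda>k. f k x) else 0)" for x
  have [measurable]: "Measurable.pred borel (\<lambda>x. convergent (\<lambda>k. f k x))"
    unfolding Cauchy_convergent_iff[symmetric] by measurable
  have gm [measurable]: "g \<in> borel_measurable borel" unfolding g_def by measurable
  have gle: "(\<integral>\<^sup>+x. ennreal ((cmod (g x - f k x))\<^sup>2) \<partial>lborel) \<le> ennreal ((1/4)^k)" for k
  proof -
    have "(\<integral>\<^sup>+x. ennreal ((cmod (g x - f k x))\<^sup>2) \<partial>lborel) =
        (\<integral>\<^sup>+x. liminf (\<lambda>j. ennreal ((cmod (f j x - f k x))\<^sup>2)) \<partial>lborel)"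
    proof (rule nn_integral_cong_AE, use conv in eventually_elim)
      fix x assume c: "convergent (\<lambda>k. f k x)"
      then have "(\<lambda>j. f j x) \<longlonglongrightarrow> g x" by (simp add: g_def convergent_LIMSEQ_iff)
      then have "(\<lambda>j. ennreal ((cmod (f j x - f k x))\<^sup>2)) \<longlonglongrightarrow> ennreal ((cmod (g x - f k x))\<^sup>2)"
        by (intro tendsto_ennrealI tendsto_intros)
      then show "ennreal ((cmod (g x - f k x))\<^sup>2) = liminf (\<lambda>j. ennreal ((cmod (f j x - f k x))\<^sup>2))"
        by (rule lim_imp_Liminf[OF sequentially_bot, symmetric])
    qed
    also have "\<dots> \<le> liminf (\<lambda>j. \<integral>\<^sup>+x. ennreal ((cmod (f j x - f k x))\<^sup>2) \<partial>lborel)"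
      by (rule nn_integral_liminf) simp
    also have "\<dots> \<le> limsup (\<lambda>j. \<integral>\<^sup>+x. ennreal ((cmod (f j x - f k x))\<^sup>2) \<partial>lborel)"
      by (rule Liminf_le_Limsup) simp
    also have "\<dots> \<le> ennreal ((1/4)^k)"
      by (rule Limsup_bounded) (auto simp: eventually_sequentially intro!: exI[of _ k] small)
    finally show ?thesis .
  qed
  have "square_integrable (\<lambda>x. g x - f 0 x)"
    unfolding square_integrable_iff_nn_integral using gle[of 0] by (auto intro: le_less_trans)
  from square_integrable_add[OF this square_integrable_rep[of "X (r 0)"]]
  have gsq: "square_integrable g" by (simp add: f_def)
  have dist: "norm (abs_L2 g - X (r k)) \<le> (1/2)^k" for k
  proof -
    have "ennreal ((norm (abs_L2 g - X (r k)))\<^sup>2) \<le> ennreal ((1/4)^k)"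
      using gle[of k] ennreal_norm_abs_L2[OF square_integrable_diff[OF gsq square_integrable_rep[of "X (r k)"]]]
      by (simp add: abs_L2_diff[symmetric] gsq square_integrable_rep abs_rep_L2 f_def)
    then have "(norm (abs_L2 g - X (r k)))\<^sup>2 \<le> (1/4)^k"
      by (subst (asm) ennreal_le_iff) auto
    also have "\<dots> = ((1/2)^k)\<^sup>2" by (rule quarter)
    finally show ?thesis by (rule power2_le_imp_le) simp
  qed
  have "X \<longlonglongrightarrow> abs_L2 g"
  proof (rule LIMSEQ_I)
    fix e :: real assume "0 < e"
    then obtain k where k: "(1/2)^k < e / 2"
      using real_arch_pow_inv[of "e/2" "1/2"] by auto
    have "norm (X n - abs_L2 g) < e" if "n \<ge> M k" for n
    proof -
      have "norm (X n - abs_L2 g) \<le> norm (X n - X (r k)) + norm (X (r k) - abs_L2 g)"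
        using norm_triangle_ineq[of "X n - X (r k)" "X (r k) - abs_L2 g"] by simp
      also have "\<dots> < e"
        using M[OF that rM] dist[of k] k by (simp add: norm_minus_commute)
      finally show ?thesis .
    qed
    then show "\<exists>no. \<forall>n\<ge>no. norm (X n - abs_L2 g) < e" by blast
  qed
  then show "convergent X" by (auto simp: convergent_def)
qed

text \<open>Dominated convergence. The factor \<open>2\<close> is the one with which simple functions approximate a
  measurable function.\<close>

lemma tendsto_abs_L2I:
  assumes sq: "\<And>n. square_integrable (h n)"
    and lim: "\<And>x. (\<lambda>n. h n x) \<longlonglongrightarrow> rep_L2 f x" and le: "\<And>n x. cmod (h n x) \<le> 2 * cmod (rep_L2 f x)"
  shows "(\<lambda>n. abs_L2 (h n)) \<longlonglongrightarrow> f"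
proof -
  have [measurable]: "h n \<in> borel_measurable borel" for n
    using sq[of n] by (simp add: square_integrable_def)
  have "(\<lambda>n. LINT x|lborel. (cmod (h n x - rep_L2 f x))\<^sup>2) \<longlonglongrightarrow> (LINT x|(lborel::'a measure). 0)"
  proof (rule integral_dominated_convergence[where w = "\<lambda>x. 9 * (cmod (rep_L2 f x))\<^sup>2"])
    show "integrable lborel (\<lambda>x. 9 * (cmod (rep_L2 f x))\<^sup>2)"
      using square_integrable_rep[of f] by (simp add: square_integrable_def)
    have "(\<lambda>n. (cmod (h n x - rep_L2 f x))\<^sup>2) \<longlonglongrightarrow> (cmod (rep_L2 f x - rep_L2 f x))\<^sup>2" for x
      by (intro tendsto_intros lim)
    then show "AE x in lborel. (\<lambda>n. (cmod (h n x - rep_L2 f x))\<^sup>2) \<longlonglongrightarrow> 0" by simp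
    have "(cmod (h n x - rep_L2 f x))\<^sup>2 \<le> 9 * (cmod (rep_L2 f x))\<^sup>2" for n x
    proof -
      have "cmod (h n x - rep_L2 f x) \<le> 3 * cmod (rep_L2 f x)"
        using norm_triangle_ineq4[of "h n x" "rep_L2 f x"] le[of n x] by simp
      from power_mono[OF this, of 2] show ?thesis by (simp add: power_mult_distrib)
    qed
    then show "AE x in lborel. norm ((cmod (h n x - rep_L2 f x))\<^sup>2) \<le> 9 * (cmod (rep_L2 f x))\<^sup>2" for n
      by simp
  qed auto
  moreover have "(LINT x|lborel. (cmod (h n x - rep_L2 f x))\<^sup>2) = (norm (abs_L2 (h n) - f))\<^sup>2" for n
    using norm_abs_L2[OF square_integrable_diff[OF sq[of n] square_integrable_rep[of f]]]
    by (simp add: abs_L2_diff[symmetric] sq square_integrable_rep abs_rep_L2)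
  ultimately have "(\<lambda>n. (norm (abs_L2 (h n) - f))\<^sup>2) \<longlonglongrightarrow> 0" by simp
  then have "(\<lambda>n. sqrt ((norm (abs_L2 (h n) - f))\<^sup>2)) \<longlonglongrightarrow> sqrt 0" by (rule tendsto_real_sqrt)
  then show ?thesis by (simp add: tendsto_norm_zero_iff flip: Lim_null)
qed

section \<open>Continuity of translations in \<open>L\<^sup>2\<close>\<close>

lift_definition shift :: "'a::euclidean_space \<Rightarrow> 'a L2 \<Rightarrow> 'a L2" is "\<lambda>t f x. f (x - t)"
  by (rule L2_rel_translate)

lemma shift_abs_L2: "square_integrable h \<Longrightarrow> shift t (abs_L2 h) = abs_L2 (\<lambda>x. h (x - t))"
  by (simp add: shift.abs_eq L2_rel_refl)

lemma square_integrable_shift: "square_integrable h \<Longrightarrow> square_integrable (\<lambda>x. h (x - t))"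
  using L2_rel_translate[of h h t] by (simp add: L2_rel_def)

lemma nn_integral_lborel_shift:
  assumes [measurable]: "f \<in> borel_measurable borel"
  shows "(\<integral>\<^sup>+x. f (x + t) \<partial>lborel) = (\<integral>\<^sup>+x. f x \<partial>(lborel :: 'a::euclidean_space measure))"
proof -
  have "(\<integral>\<^sup>+x. f x \<partial>lborel) = (\<integral>\<^sup>+x. f x \<partial>(distr lborel borel ((+) t)))"
    by (simp add: lborel_distr_plus)
  also have "\<dots> = (\<integral>\<^sup>+x. f (t + x) \<partial>lborel)" by (rule nn_integral_distr) auto
  finally show ?thesis by (simp add: add.commute)
qed

lemma norm_shift: "norm (shift t f) = norm f"
proof -
  have "ennreal ((norm (shift t (abs_L2 (rep_L2 f))))\<^sup>2) = (\<integral>\<^sup>+x. ennreal ((cmod (rep_L2 f (x + (- t))))\<^sup>2) \<partial>lborel)"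
    using ennreal_norm_abs_L2[OF square_integrable_shift[OF square_integrable_rep[of f], of t]]
    by (simp add: shift_abs_L2 square_integrable_rep)
  also have "\<dots> = ennreal ((norm f)\<^sup>2)"
    by (subst nn_integral_lborel_shift[where f = "\<lambda>x. ennreal ((cmod (rep_L2 f x))\<^sup>2)"]) (simp_all add: ennreal_norm_L2)
  finally show ?thesis by (simp add: abs_rep_L2 power2_eq_iff_nonneg)
qed

lemma shift_add: "shift t (f + g) = shift t f + shift t g"
proof -
  have "shift t (abs_L2 (rep_L2 f) + abs_L2 (rep_L2 g)) = shift t (abs_L2 (rep_L2 f)) + shift t (abs_L2 (rep_L2 g))"
    by (simp add: abs_L2_add shift_abs_L2 square_integrable_rep square_integrable_add square_integrable_shift)
  then show ?thesis by (simp add: abs_rep_L2)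
qed

lemma shift_scaleC: "shift t (c *\<^sub>C f) = c *\<^sub>C shift t f"
proof -
  have "shift t (c *\<^sub>C abs_L2 (rep_L2 f)) = c *\<^sub>C shift t (abs_L2 (rep_L2 f))"
    by (simp add: abs_L2_scaleC shift_abs_L2 square_integrable_rep square_integrable_scaleC square_integrable_shift)
  then show ?thesis by (simp add: abs_rep_L2)
qed

lemma shift_diff: "shift t (f - g) = shift t f - shift t g"
  using shift_add[of t "f - g" g] by simp

definition translation_continuous :: "'a::euclidean_space L2 \<Rightarrow> bool" where
  "translation_continuous f \<longleftrightarrow> (\<forall>X. X \<longlonglongrightarrow> 0 \<longrightarrow> (\<lambda>n. shift (X n) f) \<longlonglongrightarrow> f)"

lemma translation_continuous_add:
  "translation_continuous f \<Longrightarrow> translation_continuous g \<Longrightarrow> translation_continuous (f + g)"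
  unfolding translation_continuous_def shift_add by (auto intro: tendsto_add)

text \<open>Translations are isometries, so an approximation of \<open>f\<close> is as good after translation as
  before.\<close>

lemma translation_continuous_closed:
  assumes Y: "\<And>k. translation_continuous (Y k)" and lim: "Y \<longlonglongrightarrow> f"
  shows "translation_continuous f"
  unfolding translation_continuous_def
proof (intro allI impI LIMSEQ_I)
  fix X :: "nat \<Rightarrow> 'a" and e :: real assume X: "X \<longlonglongrightarrow> 0" and e: "0 < e"
  obtain k where k: "norm (Y k - f) < e / 3"
    using LIMSEQ_D[OF lim, of "e/3"] e by auto
  obtain N where N: "\<And>n. n \<ge> N \<Longrightarrow> norm (shift (X n) (Y k) - Y k) < e / 3"
    using Y[of k] X LIMSEQ_D[of "\<lambda>n. shift (X n) (Y k)" "Y k" "e/3"] e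
    by (auto simp: translation_continuous_def)
  have "norm (shift (X n) f - f) < e" if "n \<ge> N" for n
  proof -
    have "shift (X n) f - f = shift (X n) (f - Y k) + ((shift (X n) (Y k) - Y k) + (Y k - f))"
      by (simp add: shift_diff)
    then have "norm (shift (X n) f - f) \<le>
        norm (shift (X n) (f - Y k)) + (norm (shift (X n) (Y k) - Y k) + norm (Y k - f))"
      by (metis norm_triangle_mono norm_triangle_ineq order_refl)
    also have "\<dots> < e"
      using k N[OF that] by (simp add: norm_shift norm_minus_commute)
    finally show ?thesis .
  qed
  then show "\<exists>no. \<forall>n\<ge>no. norm (shift (X n) f - f) < e" by blast
qed

lemma square_integrable_indicator:
  assumes "A \<in> sets borel" "emeasure lborel A < \<infinity>"
  shows "square_integrable (\<lambda>x. c * indicator A x)"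
proof (rule square_integrable_scaleC)
  have "(cmod (indicator A x))\<^sup>2 = indicator A x" for x by (simp split: split_indicator)
  then show "square_integrable (indicator A)"
    using assms by (simp add: square_integrable_def)
qed

text \<open>For an open set \<open>U\<close> every point of \<open>U\<close> stays in \<open>U\<close> under small translations, so
  the measure of the intersection of \<open>U\<close> with its translate tends to the measure of \<open>U\<close>.\<close>

lemma translation_continuous_indicator_open:
  assumes U: "open U" and fin: "emeasure lborel U < \<infinity>"
  shows "translation_continuous (abs_L2 (indicator U :: 'a::euclidean_space \<Rightarrow> complex))"
  unfolding translation_continuous_def
proof (intro allI impI)
  fix X :: "nat \<Rightarrow> 'a" assume X: "X \<longlonglongrightarrow> 0"
  define f where "f = abs_L2 (indicator U :: 'a \<Rightarrow> complex)"
  have [measurable]: "U \<in> sets borel" using U by simp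
  have sq: "square_integrable (indicator U :: 'a \<Rightarrow> complex)"
    using square_integrable_indicator[of U 1] fin by simp
  have norm_f: "(norm f)\<^sup>2 = (LINT x|lborel. indicator U x)"
    unfolding f_def norm_abs_L2[OF sq] by (intro Bochner_Integration.integral_cong) (auto split: split_indicator)
  have inner_f: "inner (shift t f) f = (LINT x|lborel. indicator U (x - t) * indicator U x)" for t
  proof -
    have "inner (shift t f) f = Re (LINT x|lborel. of_real (indicator U (x - t) * indicator U x))"
      unfolding f_def shift_abs_L2[OF sq] inner_L2_def cinner_abs_L2[OF square_integrable_shift[OF sq] sq]
      by (intro arg_cong[of _ _ Re] Bochner_Integration.integral_cong) (auto split: split_indicator)
    then show ?thesis by (simp only: integral_complex_of_real Re_complex_of_real)
  qed
  have "(\<lambda>n. LINT x|lborel. indicator U (x - X n) * indicator U x :: real) \<longlonglongrightarrow> (LINT x|lborel. indicator U x)"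
  proof (rule integral_dominated_convergence[where w = "indicator U"])
    show "integrable lborel (indicator U :: 'a \<Rightarrow> real)" using fin by simp
    have "(\<lambda>n. indicator U (x - X n) * indicator U x) \<longlonglongrightarrow> (indicator U x :: real)" for x
    proof (cases "x \<in> U")
      case True
      have "(\<lambda>n. x - X n) \<longlonglongrightarrow> x - 0" using X by (intro tendsto_intros)
      then have "\<forall>\<^sub>F n in sequentially. x - X n \<in> U"
        using U True by (simp add: topological_tendstoD)
      then have "\<forall>\<^sub>F n in sequentially. indicator U (x - X n) * indicator U x = (indicator U x :: real)"
        by eventually_elim simp
      then show ?thesis by (rule tendsto_eventually)
    qed simp
    then show "AE x in lborel. (\<lambda>n. indicator U (x - X n) * indicator U x) \<longlonglongrightarrow> (indicator U x :: real)" by simp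
  qed (auto split: split_indicator)
  then have "(\<lambda>n. 2 * (norm f)\<^sup>2 - 2 * inner (shift (X n) f) f) \<longlonglongrightarrow> 2 * (norm f)\<^sup>2 - 2 * (norm f)\<^sup>2"
    unfolding inner_f norm_f by (intro tendsto_intros)
  \<comment> \<open>The translates have the norm of \<open>f\<close>, so weak convergence gives norm convergence.\<close>
  moreover have "2 * (norm f)\<^sup>2 - 2 * inner (shift t f) f = (norm (shift t f - f))\<^sup>2" for t
  proof -
    have "(norm (shift t f - f))\<^sup>2 = (norm (shift t f))\<^sup>2 + (norm f)\<^sup>2 - 2 * inner (shift t f) f"
      by (simp add: power2_norm_eq_inner inner_diff_left inner_diff_right inner_commute)
    then show ?thesis by (simp add: norm_shift)
  qed
  ultimately have "(\<lambda>n. (norm (shift (X n) f - f))\<^sup>2) \<longlonglongrightarrow> 0" by simp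
  then have "(\<lambda>n. sqrt ((norm (shift (X n) f - f))\<^sup>2)) \<longlonglongrightarrow> sqrt 0" by (rule tendsto_real_sqrt)
  then show "(\<lambda>n. shift (X n) f) \<longlonglongrightarrow> f" by (simp add: tendsto_norm_zero_iff flip: Lim_null)
qed

text \<open>Outer regularity: the indicator is an \<open>L\<^sup>2\<close> limit of indicators of open sets.\<close>

lemma translation_continuous_indicator:
  assumes A: "A \<in> sets borel" and fin: "emeasure lborel A < \<infinity>"
  shows "translation_continuous (abs_L2 (indicator A :: 'a::euclidean_space \<Rightarrow> complex))"
proof -
  note [measurable] = A
  have "\<exists>U. open U \<and> A \<subseteq> U \<and> emeasure lborel (U - A) < ennreal (inverse (real (Suc n)))" for n
    using outer_regular_lborel[OF A, of "inverse (real (Suc n))"] by (metis inverse_positive_iff_positive of_nat_0_less_iff zero_less_Suc)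
  then obtain U where U: "\<And>n. open (U n)" "\<And>n. A \<subseteq> U n"
    "\<And>n. emeasure lborel (U n - A) < ennreal (inverse (real (Suc n)))"
    by metis
  have [measurable]: "U n \<in> sets borel" for n using U(1) by simp
  have Ufin: "emeasure lborel (U n) < \<infinity>" for n
  proof -
    have "emeasure lborel (U n) = emeasure lborel A + emeasure lborel (U n - A)"
      using U(2)[of n] by (subst plus_emeasure) (auto simp: Un_absorb1)
    also have "\<dots> < \<infinity>" using fin U(3)[of n] by (simp add: less_top[symmetric]) (metis top.not_eq_extremum ennreal_less_top order.strict_trans)
    finally show ?thesis .
  qed
  have sqU: "square_integrable (indicator (U n) :: 'a \<Rightarrow> complex)" for n
    using square_integrable_indicator[of "U n" 1] Ufin by simp
  have sqA: "square_integrable (indicator A :: 'a \<Rightarrow> complex)"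
    using square_integrable_indicator[of A 1] fin A by simp
  have le: "norm (abs_L2 (indicator (U n)) - abs_L2 (indicator A :: 'a \<Rightarrow> complex)) \<le> sqrt (inverse (real (Suc n)))" for n
  proof -
    have "ennreal ((norm (abs_L2 (indicator (U n)) - abs_L2 (indicator A :: 'a \<Rightarrow> complex)))\<^sup>2) =
        (\<integral>\<^sup>+x. ennreal ((cmod (indicator (U n) x - indicator A x))\<^sup>2) \<partial>lborel)"
      using ennreal_norm_abs_L2[OF square_integrable_diff[OF sqU sqA]] by (simp add: abs_L2_diff sqU sqA)
    also have "\<dots> = (\<integral>\<^sup>+x. indicator (U n - A) x \<partial>lborel)"
      using U(2)[of n] by (intro nn_integral_cong) (auto split: split_indicator)
    also have "\<dots> \<le> ennreal (inverse (real (Suc n)))" using U(3)[of n] by simp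
    finally have "(norm (abs_L2 (indicator (U n)) - abs_L2 (indicator A :: 'a \<Rightarrow> complex)))\<^sup>2 \<le> inverse (real (Suc n))"
      by (subst (asm) ennreal_le_iff) auto
    then show ?thesis by (rule real_le_rsqrt)
  qed
  have "(\<lambda>n. sqrt (inverse (real (Suc n)))) \<longlonglongrightarrow> sqrt 0"
    by (intro tendsto_real_sqrt LIMSEQ_inverse_real_of_nat)
  then have lim: "(\<lambda>n. sqrt (inverse (real (Suc n)))) \<longlonglongrightarrow> 0" by simp
  have "(\<lambda>n. abs_L2 (indicator (U n)) - abs_L2 (indicator A :: 'a \<Rightarrow> complex)) \<longlonglongrightarrow> 0"
    by (rule Lim_null_comparison[OF always_eventually[OF allI] lim]) (rule le)
  then have "(\<lambda>n. abs_L2 (indicator (U n))) \<longlonglongrightarrow> abs_L2 (indicator A :: 'a \<Rightarrow> complex)"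
    by (simp flip: Lim_null)
  with translation_continuous_closed[OF translation_continuous_indicator_open[OF U(1) Ufin]] show ?thesis .
qed

lemma translation_continuous_zero: "translation_continuous (0 :: 'a::euclidean_space L2)"
  unfolding translation_continuous_def using shift_diff[of _ "0::'a L2" 0] by simp

lemma translation_continuous_simple:
  assumes s: "simple_function lborel s" and sq: "square_integrable (s :: 'a::euclidean_space \<Rightarrow> complex)"
  shows "translation_continuous (abs_L2 s)"
proof -
  have [measurable]: "s \<in> borel_measurable borel" using sq by (simp add: square_integrable_def)
  have finr: "finite (range s)" using s by (simp add: simple_function_def)
  define A where "A y = s -` {y}" for y
  have Am: "A y \<in> sets borel" for y
    unfolding A_def using measurable_sets_borel[of s borel "{y}"] by simp
  \<comment> \<open>Chebyshev's inequality; the level set of the value \<open>0\<close> may have infinite measure.\<close>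
  have Afin: "emeasure lborel (A y) < \<infinity>" if "y \<noteq> 0" for y
  proof -
    have "ennreal ((cmod y)\<^sup>2) * emeasure lborel (A y) = (\<integral>\<^sup>+x. ennreal ((cmod y)\<^sup>2) * indicator (A y) x \<partial>lborel)"
      using Am by (simp add: nn_integral_cmult_indicator)
    also have "\<dots> \<le> (\<integral>\<^sup>+x. ennreal ((cmod (s x))\<^sup>2) \<partial>lborel)"
      by (intro nn_integral_mono) (auto simp: A_def split: split_indicator)
    also have "\<dots> < \<infinity>" using sq by (simp add: square_integrable_iff_nn_integral)
    finally show ?thesis using that by (auto simp: ennreal_mult_less_top)
  qed
  have sqA: "square_integrable (\<lambda>x. y * indicator (A y) x :: complex)" for y
    using square_integrable_indicator[OF Am Afin, of y y] by (cases "y = 0") (simp_all add: square_integrable_zero)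
  have "square_integrable (\<lambda>x. \<Sum>y\<in>R. y * indicator (A y) x) \<and>
      translation_continuous (abs_L2 (\<lambda>x. \<Sum>y\<in>R. y * indicator (A y) x))" if "finite R" for R
    using that
  proof (induction R)
    case empty
    then show ?case using translation_continuous_zero
      by (simp add: square_integrable_zero zero_L2_def)
  next
    case (insert y R)
    have "translation_continuous (abs_L2 (\<lambda>x. y * indicator (A y) x))"
    proof (cases "y = 0")
      case True
      then show ?thesis using translation_continuous_zero by (simp add: zero_L2_def)
    next
      case False
      then have sq1: "square_integrable (indicator (A y) :: 'a \<Rightarrow> complex)"
        using square_integrable_indicator[OF Am Afin, of y 1] by simp
      have "translation_continuous (y *\<^sub>C abs_L2 (indicator (A y)))"
        using translation_continuous_indicator[OF Am Afin[OF False]]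
        unfolding translation_continuous_def shift_scaleC
        by (auto intro!: tendsto_scaleC tendsto_const)
      then show ?thesis by (simp add: abs_L2_scaleC[OF sq1])
    qed
    moreover have "(\<lambda>x. \<Sum>y\<in>insert y R. y * indicator (A y) x) =
        (\<lambda>x. y * indicator (A y) x + (\<Sum>y\<in>R. y * indicator (A y) x))"
      by (simp only: sum.insert[OF insert(1,2)])
    ultimately show ?case
      using insert(3) sqA[of y] by (auto simp only: abs_L2_add[symmetric]
        intro!: translation_continuous_add square_integrable_add)
  qed
  note step = this[OF finr, THEN conjunct2]
  have "(\<Sum>y\<in>range s. y * indicator (A y) x) = s x" for x
  proof -
    have "(\<Sum>y\<in>range s. y * indicator (A y) x) = (\<Sum>y\<in>range s. if y = s x then y else 0)"
      by (intro sum.cong) (auto simp: A_def split: split_indicator)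
    then show ?thesis using finr by simp
  qed
  with step show ?thesis by (simp only:)
qed

lemma translation_continuous_L2: "translation_continuous f"
proof -
  obtain S where S: "\<And>i. simple_function lborel (S i)" "\<And>x. (\<lambda>i. S i x) \<longlonglongrightarrow> rep_L2 f x"
    "\<And>i x. cmod (S i x) \<le> 2 * cmod (rep_L2 f x)"
    using borel_measurable_implies_sequence_metric[of "rep_L2 f" lborel 0] by (auto simp: dist_norm)
  have sq: "square_integrable (S i)" for i
    unfolding square_integrable_def
  proof
    show [measurable]: "S i \<in> borel_measurable lborel" using S(1) by (rule borel_measurable_simple_function)
    show "integrable lborel (\<lambda>x. (cmod (S i x))\<^sup>2)"
    proof (rule Bochner_Integration.integrable_bound)
      show "integrable lborel (\<lambda>x. 4 * (cmod (rep_L2 f x))\<^sup>2)"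
        using square_integrable_rep[of f] by (simp add: square_integrable_def)
      have "(cmod (S i x))\<^sup>2 \<le> 4 * (cmod (rep_L2 f x))\<^sup>2" for x
        using power_mono[OF S(3)[of i x], of 2] by (simp add: power_mult_distrib)
      then show "AE x in lborel. norm ((cmod (S i x))\<^sup>2) \<le> norm (4 * (cmod (rep_L2 f x))\<^sup>2)" by simp
    qed simp
  qed
  show ?thesis
    using translation_continuous_closed[OF translation_continuous_simple[OF S(1) sq] tendsto_abs_L2I[OF sq S(2,3)]] .
qed

section \<open>Plancherel's theorem\<close>

lemma lborel_integrable_affine:
  fixes f :: "'a::euclidean_space \<Rightarrow> complex"
  assumes f: "integrable lborel f" and c: "c \<noteq> 0"
  shows "integrable lborel (\<lambda>x. f (t + c *\<^sub>R x))"
proof -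
  have [measurable]: "f \<in> borel_measurable borel" using f by auto
  have "integrable (density (distr lborel borel (\<lambda>x. t + c *\<^sub>R x)) (\<lambda>_. ennreal (\<bar>c\<bar>^DIM('a)))) f"
    using f lborel_affine[OF c, of t] by simp
  then have "integrable (distr lborel borel (\<lambda>x. t + c *\<^sub>R x)) (\<lambda>x. \<bar>c\<bar>^DIM('a) *\<^sub>R f x)"
    by (subst (asm) integrable_density) auto
  then have "integrable (distr lborel borel (\<lambda>x. t + c *\<^sub>R x))
      (\<lambda>x. (1 / \<bar>c\<bar>^DIM('a)) *\<^sub>R (\<bar>c\<bar>^DIM('a) *\<^sub>R f x))"
    by (rule integrable_scaleR_right)
  then have "integrable (distr lborel borel (\<lambda>x. t + c *\<^sub>R x)) f"
    using c by simp
  then show ?thesis by (subst (asm) integrable_distr_eq) auto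
qed

lemma lborel_integral_affine:
  fixes f :: "'a::euclidean_space \<Rightarrow> complex"
  assumes f [measurable]: "f \<in> borel_measurable borel" and c: "c \<noteq> 0"
  shows "(LINT x|lborel. f x) = \<bar>c\<bar>^DIM('a) *\<^sub>R (LINT x|lborel. f (t + c *\<^sub>R x))"
proof -
  have "(LINT x|lborel. f x) = (LINT x|density (distr lborel borel (\<lambda>x. t + c *\<^sub>R x)) (\<lambda>_. ennreal (\<bar>c\<bar>^DIM('a))). f x)"
    using lborel_affine[OF c, of t] by simp
  also have "\<dots> = (LINT x|distr lborel borel (\<lambda>x. t + c *\<^sub>R x). \<bar>c\<bar>^DIM('a) *\<^sub>R f x)"
    by (rule integral_density) auto
  also have "\<dots> = (LINT x|lborel. \<bar>c\<bar>^DIM('a) *\<^sub>R f (t + c *\<^sub>R x))"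
    by (rule integral_distr) auto
  finally show ?thesis by simp
qed

lemma lborel_integral_prod:
  fixes f :: "'a::euclidean_space \<Rightarrow> real \<Rightarrow> complex"
  assumes f: "\<And>b. b \<in> Basis \<Longrightarrow> integrable lborel (f b)"
  shows "integrable lborel (\<lambda>x. \<Prod>b\<in>Basis. f b (x \<bullet> b))"
    and "(LINT x|lborel. (\<Prod>b\<in>Basis. f b (x \<bullet> b))) = (\<Prod>b\<in>Basis. LINT x|lborel. f b x)"
proof -
  interpret product_sigma_finite "\<lambda>_ :: 'a. lborel :: real measure" ..
  have [measurable]: "b \<in> Basis \<Longrightarrow> f b \<in> borel_measurable borel" for b using f by auto
  have eq: "(\<Prod>b\<in>Basis. f b ((\<Sum>c\<in>Basis. y c *\<^sub>R c) \<bullet> b)) = (\<Prod>b\<in>Basis. f b (y b))" for y :: "'a \<Rightarrow> real"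
    by (intro prod.cong) auto
  have [measurable]: "(\<lambda>x. \<Prod>b\<in>Basis. f b (x \<bullet> b)) \<in> borel_measurable (borel :: 'a measure)"
    by measurable
  show "integrable lborel (\<lambda>x. \<Prod>b\<in>Basis. f b (x \<bullet> b))"
    by (subst lborel_eq, subst integrable_distr_eq) (auto simp: eq intro!: product_integrable_prod f)
  show "(LINT x|lborel. (\<Prod>b\<in>Basis. f b (x \<bullet> b))) = (\<Prod>b\<in>Basis. LINT x|lborel. f b x)"
    by (subst lborel_eq, subst integral_distr) (auto simp: eq intro!: product_integral_prod f)
qed

text \<open>The density of the standard normal distribution without its normalization, so that the
  transform of \<open>gauss\<close> is \<open>sqrt (2 * pi) ^ DIM('a)\<close> times \<open>gauss\<close> itself.\<close>

definition gauss :: "'a::euclidean_space \<Rightarrow> real" where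
  "gauss x = exp (- (norm x)\<^sup>2 / 2)"

lemma gauss_prod: "gauss x = (\<Prod>b\<in>Basis. exp (- (x \<bullet> b)\<^sup>2 / 2))"
proof -
  have "(norm x)\<^sup>2 = (\<Sum>b\<in>Basis. (x \<bullet> b)\<^sup>2)"
    unfolding power2_norm_eq_inner by (subst euclidean_inner) (simp add: power2_eq_square)
  then show ?thesis
    by (simp add: gauss_def exp_sum[symmetric] sum_negf sum_divide_distrib)
qed

lemma measurable_gauss [measurable]: "gauss \<in> borel_measurable borel"
  unfolding gauss_def[abs_def] by measurable

lemma gauss_transform_real:
  fixes t :: real
  defines "f \<equiv> \<lambda>x. complex_of_real (exp (- x\<^sup>2 / 2)) * exp (- \<i> * complex_of_real (t * x))"
  shows "integrable lborel f" and "(LINT x|lborel. f x) = complex_of_real (sqrt (2 * pi) * exp (- t\<^sup>2 / 2))"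
proof -
  have f: "f x = sqrt (2 * pi) *\<^sub>R (std_normal_density x *\<^sub>R iexp (- t * x))" for x
    by (simp add: f_def std_normal_density_def scaleR_conv_of_real)
  have int: "integrable lborel (\<lambda>x. std_normal_density x *\<^sub>R iexp (- t * x))"
  proof (rule Bochner_Integration.integrable_bound)
    show "integrable lborel std_normal_density" by simp
  qed auto
  then show "integrable lborel f" unfolding f by (rule integrable_scaleR_right)
  have "(LINT x|lborel. f x) = sqrt (2 * pi) *\<^sub>R (LINT x|lborel. std_normal_density x *\<^sub>R iexp (- t * x))"
    unfolding f by (rule integral_scaleR_right)
  also have "(LINT x|lborel. std_normal_density x *\<^sub>R iexp (- t * x)) = char std_normal_distribution (- t)"
    unfolding char_def by (subst integral_density) auto
  also have "\<dots> = complex_of_real (exp (- t\<^sup>2 / 2))"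
    by (simp add: char_std_normal_distribution)
  finally show "(LINT x|lborel. f x) = complex_of_real (sqrt (2 * pi) * exp (- t\<^sup>2 / 2))"
    by (simp add: scaleR_conv_of_real)
qed

text \<open>Both factors of the integrand are products over the coordinates, which reduces the claim to the
  characteristic function of the normal distribution.\<close>

lemma gauss_transform:
  fixes t :: "'a::euclidean_space"
  shows "integrable lborel (\<lambda>x. complex_of_real (gauss x) * exp (- \<i> * complex_of_real (t \<bullet> x)))"
    and "(LINT x|lborel. complex_of_real (gauss x) * exp (- \<i> * complex_of_real (t \<bullet> x))) =
      complex_of_real (sqrt (2 * pi) ^ DIM('a) * gauss t)"
proof -
  let ?f = "\<lambda>b x. complex_of_real (exp (- x\<^sup>2 / 2)) * exp (- \<i> * complex_of_real ((t \<bullet> b) * x))"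
  have eq: "complex_of_real (gauss x) * exp (- \<i> * complex_of_real (t \<bullet> x)) = (\<Prod>b\<in>Basis. ?f b (x \<bullet> b))" for x
  proof -
    have "exp (- \<i> * complex_of_real (t \<bullet> x)) = (\<Prod>b\<in>Basis. exp (- \<i> * complex_of_real ((t \<bullet> b) * (x \<bullet> b))))"
      unfolding euclidean_inner[of t x] by (simp add: exp_sum[symmetric] sum_distrib_left sum_negf)
    then show ?thesis by (simp add: gauss_prod prod.distrib)
  qed
  show "integrable lborel (\<lambda>x. complex_of_real (gauss x) * exp (- \<i> * complex_of_real (t \<bullet> x)))"
    unfolding eq by (rule lborel_integral_prod(1)) (rule gauss_transform_real(1))
  have "(LINT x|lborel. complex_of_real (gauss x) * exp (- \<i> * complex_of_real (t \<bullet> x))) =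
      (\<Prod>b\<in>Basis. complex_of_real (sqrt (2 * pi) * exp (- (t \<bullet> b)\<^sup>2 / 2)))"
    unfolding eq by (subst lborel_integral_prod(2)) (simp_all only: gauss_transform_real)
  also have "\<dots> = complex_of_real (sqrt (2 * pi) ^ DIM('a) * gauss t)"
    by (simp add: gauss_prod prod.distrib)
  finally show "(LINT x|lborel. complex_of_real (gauss x) * exp (- \<i> * complex_of_real (t \<bullet> x))) =
      complex_of_real (sqrt (2 * pi) ^ DIM('a) * gauss t)" .
qed

lemma integrable_gauss: "integrable lborel (gauss :: 'a::euclidean_space \<Rightarrow> real)"
  using gauss_transform(1)[of "0::'a"] by (simp add: complex_of_real_integrable_eq)

lemma integral_gauss:
  "(LINT x|lborel. complex_of_real (gauss (x::'a::euclidean_space))) = complex_of_real (sqrt (2 * pi) ^ DIM('a))"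
  using gauss_transform(2)[of "0::'a"] by (simp add: gauss_def)

text \<open>The kernel of the Fourier integral. It is symmetric in its arguments, and both roles occur: a
  frequency against a point, and a point of the torus against an integer vector.\<close>

definition wave :: "'a::euclidean_space \<Rightarrow> 'a \<Rightarrow> complex" where
  "wave \<xi> x = exp (- 2 * complex_of_real pi * \<i> * complex_of_real (x \<bullet> \<xi>))"

lemma fourier_integral_eq_wave: "fourier_integral f \<xi> = (LINT x|lborel. f x * wave \<xi> x)"
  by (simp add: fourier_integral_def wave_def)

lemma norm_wave [simp]: "cmod (wave \<xi> x) = 1"
  by (simp add: wave_def)

lemma wave_add: "wave \<xi> (x + y) = wave \<xi> x * wave \<xi> y"
  by (simp add: wave_def inner_add_left exp_add[symmetric] algebra_simps)

lemma wave_add_left: "wave (\<xi> + \<eta>) x = wave \<xi> x * wave \<eta> x"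
  by (simp add: wave_def inner_add_right exp_add[symmetric] algebra_simps)

lemma wave_mult_cnj [simp]: "wave \<xi> x * cnj (wave \<xi> x) = 1"
  by (simp add: complex_norm_square[symmetric])

lemma wave_diff: "wave \<xi> (x - y) = wave \<xi> x * cnj (wave \<xi> y)"
proof -
  have "wave \<xi> (x - y) * (wave \<xi> y * cnj (wave \<xi> y)) = wave \<xi> x * cnj (wave \<xi> y)"
    by (simp add: mult.assoc[symmetric] wave_add[symmetric] del: wave_mult_cnj)
  then show ?thesis by simp
qed

lemma measurable_wave [measurable]:
  assumes [measurable]: "f \<in> borel_measurable M" "g \<in> borel_measurable M"
  shows "(\<lambda>x. wave (f x) (g x)) \<in> borel_measurable M"
  unfolding wave_def by measurable

lemma measurable_cnj [measurable (raw)]: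
  assumes "f \<in> borel_measurable M"
  shows "(\<lambda>x. cnj (f x)) \<in> borel_measurable M"
  by (rule measurable_compose[OF assms])
    (auto intro!: borel_measurable_continuous_onI continuous_intros)

lemma measurable_fourier_integral [measurable]:
  fixes h :: "'a::euclidean_space \<Rightarrow> complex"
  assumes [measurable]: "h \<in> borel_measurable borel"
  shows "fourier_integral h \<in> borel_measurable borel"
  unfolding fourier_integral_eq_wave[abs_def] by measurable

lemma integrable_mult_wave:
  fixes h :: "'a::euclidean_space \<Rightarrow> complex"
  assumes h: "integrable lborel h"
  shows "integrable lborel (\<lambda>x. h x * wave \<xi> x)"
proof (rule Bochner_Integration.integrable_bound[OF h])
  have [measurable]: "h \<in> borel_measurable borel" using h by auto
  show "(\<lambda>x. h x * wave \<xi> x) \<in> borel_measurable lborel" by measurable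
qed (simp add: norm_mult)

lemma norm_fourier_integral_le:
  assumes h: "integrable lborel h"
  shows "cmod (fourier_integral h \<xi>) \<le> (LINT x|lborel. cmod (h x))"
  unfolding fourier_integral_eq_wave
  by (rule order.trans[OF integral_norm_bound]) (simp add: norm_mult)

definition autocorrelation :: "('a::euclidean_space \<Rightarrow> complex) \<Rightarrow> 'a \<Rightarrow> complex" where
  "autocorrelation h t = (LINT x|lborel. h x * cnj (h (x - t)))"

lemma reflect_integrable:
  fixes h :: "'a::euclidean_space \<Rightarrow> complex"
  assumes h: "integrable lborel h"
  shows "integrable lborel (\<lambda>t. h (x - t))" "(LINT t|lborel. h (x - t)) = (LINT t|lborel. h t)"
  using lborel_integrable_affine[OF h, of "-1" x] lborel_integral_affine[of h "-1" x] h by auto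

lemma integrable_autocorrelation_kernel:
  fixes h :: "'a::euclidean_space \<Rightarrow> complex"
  assumes h: "integrable lborel h"
  shows "integrable (lborel \<Otimes>\<^sub>M lborel) (\<lambda>(x, t). h x * cnj (h (x - t)))"
proof (rule lborel_pair.Fubini_integrable)
  have [measurable]: "h \<in> borel_measurable borel" using h by auto
  show "(\<lambda>(x, t). h x * cnj (h (x - t))) \<in> borel_measurable (lborel \<Otimes>\<^sub>M lborel)" by measurable
  have ch: "integrable lborel (\<lambda>x. complex_of_real (cmod (h x)))"
    using h by (simp add: complex_of_real_integrable_eq)
  have "(LINT t|lborel. cmod (h (x - t))) = (LINT t|lborel. cmod (h t))" for x
    using reflect_integrable(2)[OF ch, of x] by (simp only: integral_complex_of_real of_real_eq_iff)
  then have "(LINT t|lborel. norm (case (x, t) of (x, t) \<Rightarrow> h x * cnj (h (x - t)))) =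
      cmod (h x) * (LINT t|lborel. cmod (h t))" for x
    by (simp add: norm_mult)
  then show "integrable lborel (\<lambda>x. LINT t|lborel. norm (case (x, t) of (x, t) \<Rightarrow> h x * cnj (h (x - t))))"
    using h by simp
  show "AE x in lborel. integrable lborel (\<lambda>t. case (x, t) of (x, t) \<Rightarrow> h x * cnj (h (x - t)))"
    using reflect_integrable(1)[OF h] by auto
qed

lemma integrable_autocorrelation:
  fixes h :: "'a::euclidean_space \<Rightarrow> complex"
  assumes h: "integrable lborel h"
  shows "integrable lborel (autocorrelation h)"
  using lborel_pair.integrable_snd[OF integrable_autocorrelation_kernel[OF h]]
  by (simp add: autocorrelation_def[abs_def])

text \<open>The autocorrelation is the convolution of \<open>h\<close> with its conjugate reflection, so its transform is
  the squared modulus of the transform of \<open>h\<close>.\<close>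

lemma fourier_autocorrelation:
  fixes h :: "'a::euclidean_space \<Rightarrow> complex"
  assumes h: "integrable lborel h"
  shows "(LINT t|lborel. autocorrelation h t * wave \<xi> t) = complex_of_real ((cmod (fourier_integral h \<xi>))\<^sup>2)"
proof -
  have [measurable]: "h \<in> borel_measurable borel" using h by auto
  let ?K = "\<lambda>x t. h x * cnj (h (x - t)) * wave \<xi> t"
  have K: "?K x t = (h x * wave \<xi> x) * cnj (h (x - t) * wave \<xi> (x - t))" for x t
  proof -
    have "wave \<xi> x * cnj (wave \<xi> (x - t)) = wave \<xi> t * (wave \<xi> x * cnj (wave \<xi> x))"
      unfolding wave_diff by (simp only: complex_cnj_mult complex_cnj_cnj mult_ac)
    then show ?thesis by (simp add: mult_ac)
  qed
  have int: "integrable (lborel \<Otimes>\<^sub>M lborel) (\<lambda>(x, t). ?K x t)"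
  proof (rule Bochner_Integration.integrable_bound[OF integrable_autocorrelation_kernel[OF h]])
    show "(\<lambda>(x, t). ?K x t) \<in> borel_measurable (lborel \<Otimes>\<^sub>M lborel)" by measurable
  qed (auto simp: norm_mult)
  have "(LINT t|lborel. autocorrelation h t * wave \<xi> t) = (LINT t|lborel. LINT x|lborel. ?K x t)"
    by (simp add: autocorrelation_def)
  also have "\<dots> = (LINT x|lborel. LINT t|lborel. ?K x t)"
    by (rule lborel_pair.Fubini_integral[OF int])
  also have "\<dots> = (LINT x|lborel. (h x * wave \<xi> x) * cnj (fourier_integral h \<xi>))"
    unfolding K fourier_integral_eq_wave
    by (simp only: integral_mult_right_zero Bochner_Integration.integral_cnj
        reflect_integrable(2)[OF integrable_mult_wave[OF h]])
  also have "\<dots> = fourier_integral h \<xi> * cnj (fourier_integral h \<xi>)"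
    by (simp add: fourier_integral_eq_wave)
  finally show ?thesis by (simp only: complex_norm_square)
qed

text \<open>Integrating the previous identity against a Gaussian window and interchanging the integrals
  replaces the window by its transform, a Gaussian that concentrates at \<open>0\<close> as \<open>s\<close> tends to
  \<open>0\<close>.\<close>

lemma gauss_window_energy:
  fixes h :: "'a::euclidean_space \<Rightarrow> complex"
  assumes h: "integrable lborel h" and s: "0 < s"
  shows "integrable lborel (\<lambda>\<xi>. gauss (s *\<^sub>R \<xi>) * (cmod (fourier_integral h \<xi>))\<^sup>2)" (is ?int)
    and "complex_of_real (LINT \<xi>|lborel. gauss (s *\<^sub>R \<xi>) * (cmod (fourier_integral h \<xi>))\<^sup>2) =
      (LINT u|lborel. complex_of_real (gauss u) * autocorrelation h ((s / (2 * pi)) *\<^sub>R u)) /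
        complex_of_real (sqrt (2 * pi) ^ DIM('a))" (is ?eq)
proof -
  have [measurable]: "h \<in> borel_measurable borel" using h by auto
  let ?R = "autocorrelation h"
  have R: "integrable lborel ?R" by (rule integrable_autocorrelation[OF h])
  then have [measurable]: "?R \<in> borel_measurable borel" by auto
  define c where "c = sqrt (2 * pi) ^ DIM('a)"
  have c0: "c > 0" by (simp add: c_def)
  have cc: "c * c = (2 * pi) ^ DIM('a)" by (simp only: c_def power_mult_distrib[symmetric]) simp
  have gs: "integrable lborel (\<lambda>\<xi>::'a. complex_of_real (gauss (s *\<^sub>R \<xi>)))"
    using lborel_integrable_affine[of "\<lambda>x::'a. complex_of_real (gauss x)" s 0] s integrable_gauss[where 'a='a]
    by (simp add: complex_of_real_integrable_eq)
  then have gsr: "integrable lborel (\<lambda>\<xi>::'a. gauss (s *\<^sub>R \<xi>))" by (simp add: complex_of_real_integrable_eq)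
  have gpos: "gauss (x::'a) \<ge> 0" for x by (simp add: gauss_def)
  show ?int
  proof (rule Bochner_Integration.integrable_bound)
    show "integrable lborel (\<lambda>\<xi>::'a. gauss (s *\<^sub>R \<xi>) * (LINT x|lborel. cmod (h x))\<^sup>2)" using gsr by simp
    have "(cmod (fourier_integral h \<xi>))\<^sup>2 \<le> (LINT x|lborel. cmod (h x))\<^sup>2" for \<xi>
      using norm_fourier_integral_le[OF h] by (intro power_mono) auto
    then show "AE \<xi> in lborel. norm (gauss (s *\<^sub>R \<xi>) * (cmod (fourier_integral h \<xi>))\<^sup>2) \<le>
        norm (gauss (s *\<^sub>R \<xi>) * (LINT x|lborel. cmod (h x))\<^sup>2)"
      by (simp add: abs_mult gpos mult_left_mono)
  qed measurable
  let ?K = "\<lambda>\<xi> t. complex_of_real (gauss (s *\<^sub>R \<xi>)) * (?R t * wave \<xi> t)"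
  have int: "integrable (lborel \<Otimes>\<^sub>M lborel) (\<lambda>(\<xi>, t). ?K \<xi> t)"
  proof (rule lborel_pair.Fubini_integrable)
    show "(\<lambda>(\<xi>, t). ?K \<xi> t) \<in> borel_measurable (lborel \<Otimes>\<^sub>M lborel)" by measurable
    show "integrable lborel (\<lambda>\<xi>. LINT t|lborel. norm (case (\<xi>, t) of (\<xi>, t) \<Rightarrow> ?K \<xi> t))"
      using gsr gpos by (simp add: norm_mult)
    show "AE \<xi> in lborel. integrable lborel (\<lambda>t. case (\<xi>, t) of (\<xi>, t) \<Rightarrow> ?K \<xi> t)"
      using integrable_mult_wave[OF R] by auto
  qed
  \<comment> \<open>The substitution \<open>\<xi> = \<eta> / s\<close> reduces the transform of the window to that of \<open>gauss\<close>.\<close>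
  have inner: "(LINT \<xi>|lborel. complex_of_real (gauss (s *\<^sub>R \<xi>)) * wave \<xi> t) =
      complex_of_real ((1 / s) ^ DIM('a) * c * gauss ((2 * pi / s) *\<^sub>R t))" for t :: 'a
  proof -
    have "(LINT \<xi>|lborel. complex_of_real (gauss (s *\<^sub>R \<xi>)) * wave \<xi> t) =
        \<bar>1 / s\<bar> ^ DIM('a) *\<^sub>R (LINT \<eta>|lborel. complex_of_real (gauss (s *\<^sub>R (0 + (1 / s) *\<^sub>R \<eta>))) * wave (0 + (1 / s) *\<^sub>R \<eta>) t)"
      using s by (intro lborel_integral_affine) auto
    also have "(\<lambda>\<eta>. complex_of_real (gauss (s *\<^sub>R (0 + (1 / s) *\<^sub>R \<eta>))) * wave (0 + (1 / s) *\<^sub>R \<eta>) t) =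
        (\<lambda>\<eta>. complex_of_real (gauss \<eta>) * exp (- \<i> * complex_of_real (((2 * pi / s) *\<^sub>R t) \<bullet> \<eta>)))"
      using s by (simp add: wave_def fun_eq_iff mult_ac)
    also have "(LINT \<eta>|lborel. complex_of_real (gauss \<eta>) * exp (- \<i> * complex_of_real (((2 * pi / s) *\<^sub>R t) \<bullet> \<eta>))) =
        complex_of_real (c * gauss ((2 * pi / s) *\<^sub>R t))"
      unfolding c_def by (rule gauss_transform(2))
    finally show ?thesis using s by (simp add: scaleR_conv_of_real mult_ac)
  qed
  have "complex_of_real (LINT \<xi>|lborel. gauss (s *\<^sub>R \<xi>) * (cmod (fourier_integral h \<xi>))\<^sup>2) =
      (LINT \<xi>|lborel. complex_of_real (gauss (s *\<^sub>R \<xi>)) * complex_of_real ((cmod (fourier_integral h \<xi>))\<^sup>2))"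
    by (simp only: integral_complex_of_real[symmetric] of_real_mult)
  also have "\<dots> = (LINT \<xi>|lborel. LINT t|lborel. ?K \<xi> t)"
    unfolding fourier_autocorrelation[OF h, symmetric] by simp
  also have "\<dots> = (LINT t|lborel. LINT \<xi>|lborel. ?K \<xi> t)"
    by (rule lborel_pair.Fubini_integral[OF int, symmetric])
  also have "\<dots> = (LINT t|lborel. ?R t * (LINT \<xi>|lborel. complex_of_real (gauss (s *\<^sub>R \<xi>)) * wave \<xi> t))"
    by (simp add: mult.left_commute)
  also have "\<dots> = complex_of_real ((1 / s) ^ DIM('a) * c) *
      (LINT t|lborel. complex_of_real (gauss ((2 * pi / s) *\<^sub>R t)) * ?R t)"
    unfolding inner by (simp add: mult_ac flip: integral_mult_right_zero)
  also have "(LINT t|lborel. complex_of_real (gauss ((2 * pi / s) *\<^sub>R t)) * ?R t) =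
      \<bar>s / (2 * pi)\<bar> ^ DIM('a) *\<^sub>R (LINT u|lborel. complex_of_real (gauss ((2 * pi / s) *\<^sub>R (0 + (s / (2 * pi)) *\<^sub>R u))) *
        ?R (0 + (s / (2 * pi)) *\<^sub>R u))"
    using s by (intro lborel_integral_affine) auto
  also have "\<dots> = \<bar>s / (2 * pi)\<bar> ^ DIM('a) *\<^sub>R (LINT u|lborel. complex_of_real (gauss u) * ?R ((s / (2 * pi)) *\<^sub>R u))"
    using s by simp
  \<comment> \<open>The powers of \<open>s\<close> of the two substitutions cancel, and the factors \<open>2 * pi\<close> are absorbed by \<open>c * c\<close>.\<close>
  also have "complex_of_real ((1 / s) ^ DIM('a) * c) * (\<bar>s / (2 * pi)\<bar> ^ DIM('a) *\<^sub>R z) = z / complex_of_real c" for z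
  proof -
    have "(1 / s) ^ DIM('a) * c * \<bar>s / (2 * pi)\<bar> ^ DIM('a) = ((1 / s) * (s / (2 * pi))) ^ DIM('a) * c"
      using s by (simp only: power_mult_distrib) simp
    also have "\<dots> = c / (c * c)" using s by (simp add: cc power_divide)
    also have "\<dots> = 1 / c" using c0 by simp
    finally have "complex_of_real ((1 / s) ^ DIM('a) * c) * complex_of_real (\<bar>s / (2 * pi)\<bar> ^ DIM('a)) = complex_of_real (1 / c)"
      by (simp only: of_real_mult[symmetric])
    then show ?thesis by (simp only: scaleR_conv_of_real mult.assoc[symmetric]) simp
  qed
  finally show ?eq by (simp only: c_def)
qed

lemma autocorrelation_eq_cinner:
  assumes "square_integrable h"
  shows "autocorrelation h t = cinner (abs_L2 h) (shift t (abs_L2 h))"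
  using assms by (simp add: autocorrelation_def shift_abs_L2 cinner_abs_L2 square_integrable_shift)

text \<open>As \<open>s\<close> decreases to \<open>0\<close> the windows increase to \<open>1\<close>, so the windowed energies of the transform
  increase to its full energy. The Gaussian averages of the autocorrelation tend to its value at
  \<open>0\<close>, the energy of \<open>h\<close>, because the autocorrelation is bounded and, by the continuity of
  translations, continuous at \<open>0\<close>.\<close>

theorem plancherel_L1_L2:
  fixes h :: "'a::euclidean_space \<Rightarrow> complex"
  assumes h: "integrable lborel h" and sq: "square_integrable h"
  shows "square_integrable (fourier_integral h)"
    and "norm (abs_L2 (fourier_integral h)) = norm (abs_L2 h)"
proof -
  have [measurable]: "h \<in> borel_measurable borel" using h by auto
  define f where "f = abs_L2 h"
  define s where "s n = inverse (real (Suc n))" for n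
  have s: "0 < s n" for n by (simp add: s_def)
  have slim: "s \<longlonglongrightarrow> 0" unfolding s_def by (rule LIMSEQ_inverse_real_of_nat)
  have sdec: "s n \<le> s m" if "m \<le> n" for m n unfolding s_def using that by (intro le_imp_inverse_le) auto
  let ?R = "autocorrelation h" and ?c = "complex_of_real (sqrt (2 * pi) ^ DIM('a))"
  have Req: "?R t = cinner f (shift t f)" for t
    unfolding f_def by (rule autocorrelation_eq_cinner[OF sq])
  have [measurable]: "?R \<in> borel_measurable borel" using integrable_autocorrelation[OF h] by auto
  have "(\<lambda>n. LINT u|lborel. complex_of_real (gauss u) * ?R ((s n / (2 * pi)) *\<^sub>R u)) \<longlonglongrightarrow>
      (LINT u|lborel. complex_of_real (gauss (u::'a)) * complex_of_real ((norm f)\<^sup>2))"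
  proof (rule integral_dominated_convergence[where w = "\<lambda>u. gauss u * (norm f)\<^sup>2"])
    show "integrable lborel (\<lambda>u::'a. gauss u * (norm f)\<^sup>2)" using integrable_gauss[where 'a='a] by simp
    have "(\<lambda>n. complex_of_real (gauss u) * ?R ((s n / (2 * pi)) *\<^sub>R u)) \<longlonglongrightarrow>
        complex_of_real (gauss u) * complex_of_real ((norm f)\<^sup>2)" for u
    proof -
      have "(\<lambda>n. (s n / (2 * pi)) *\<^sub>R u) \<longlonglongrightarrow> (0 / (2 * pi)) *\<^sub>R u"
        by (intro tendsto_intros slim) simp
      then have "(\<lambda>n. shift ((s n / (2 * pi)) *\<^sub>R u) f) \<longlonglongrightarrow> f"
        using translation_continuous_L2[of f] by (simp add: translation_continuous_def)
      then show ?thesis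
        unfolding Req norm_square_cinner by (intro tendsto_intros)
    qed
    then show "AE u in lborel. (\<lambda>n. complex_of_real (gauss u) * ?R ((s n / (2 * pi)) *\<^sub>R u)) \<longlonglongrightarrow>
        complex_of_real (gauss u) * complex_of_real ((norm f)\<^sup>2)" by simp
    have "cmod (?R t) \<le> (norm f)\<^sup>2" for t
      unfolding Req using cmod_cinner_le[of f "shift t f"] by (simp add: norm_shift power2_eq_square)
    then show "AE u in lborel. norm (complex_of_real (gauss u) * ?R ((s n / (2 * pi)) *\<^sub>R u)) \<le> gauss u * (norm f)\<^sup>2" for n
      by (simp add: norm_mult gauss_def mult_left_mono)
  qed measurable
  also have "(LINT u|lborel. complex_of_real (gauss (u::'a)) * complex_of_real ((norm f)\<^sup>2)) = ?c * complex_of_real ((norm f)\<^sup>2)"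
    using integral_gauss[where 'a='a] by simp
  finally have lim: "(\<lambda>n. (LINT u|lborel. complex_of_real (gauss u) * ?R ((s n / (2 * pi)) *\<^sub>R u)) / ?c) \<longlonglongrightarrow>
      ?c * complex_of_real ((norm f)\<^sup>2) / ?c"
    by (intro tendsto_divide tendsto_const) simp_all
  define E where "E n = (LINT \<xi>|lborel. gauss (s n *\<^sub>R \<xi>) * (cmod (fourier_integral h \<xi>))\<^sup>2)" for n
  have "(\<lambda>n. complex_of_real (E n)) \<longlonglongrightarrow> complex_of_real ((norm f)\<^sup>2)"
    unfolding E_def gauss_window_energy(2)[OF h s] using lim by simp
  then have "E \<longlonglongrightarrow> (norm f)\<^sup>2" by (simp only: tendsto_of_real_iff)
  then have "(\<lambda>n. ennreal (E n)) \<longlonglongrightarrow> ennreal ((norm f)\<^sup>2)" by (rule tendsto_ennrealI)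
  moreover have "ennreal (E n) = (\<integral>\<^sup>+\<xi>. ennreal (gauss (s n *\<^sub>R \<xi>) * (cmod (fourier_integral h \<xi>))\<^sup>2) \<partial>lborel)" for n
    unfolding E_def
    by (rule nn_integral_eq_integral[symmetric, OF gauss_window_energy(1)[OF h s]]) (simp add: gauss_def)
  moreover have "(\<lambda>n. \<integral>\<^sup>+\<xi>. ennreal (gauss (s n *\<^sub>R \<xi>) * (cmod (fourier_integral h \<xi>))\<^sup>2) \<partial>lborel) \<longlonglongrightarrow>
      (\<integral>\<^sup>+\<xi>. ennreal ((cmod (fourier_integral h \<xi>))\<^sup>2) \<partial>lborel)"
  proof (rule nn_integral_LIMSEQ)
    have "gauss (s m *\<^sub>R \<xi>) \<le> gauss (s n *\<^sub>R \<xi>)" if "m \<le> n" for m n and \<xi> :: 'a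
    proof -
      have "norm (s n *\<^sub>R \<xi>) \<le> norm (s m *\<^sub>R \<xi>)"
        using sdec[OF that] s less_imp_le by (simp add: mult_right_mono abs_of_pos)
      from power_mono[OF this, of 2] show ?thesis by (simp add: gauss_def)
    qed
    then show "incseq (\<lambda>n \<xi>. ennreal (gauss (s n *\<^sub>R \<xi>) * (cmod (fourier_integral h \<xi>))\<^sup>2))"
      by (auto simp: incseq_def le_fun_def intro!: ennreal_leI mult_right_mono)
    show "(\<lambda>\<xi>. ennreal (gauss (s n *\<^sub>R \<xi>) * (cmod (fourier_integral h \<xi>))\<^sup>2)) \<in> borel_measurable lborel" for n
      by measurable
    have "(\<lambda>n. gauss (s n *\<^sub>R \<xi>) * (cmod (fourier_integral h \<xi>))\<^sup>2) \<longlonglongrightarrow>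
        exp (- (norm (0 *\<^sub>R \<xi>))\<^sup>2 / 2) * (cmod (fourier_integral h \<xi>))\<^sup>2" for \<xi> :: 'a
      unfolding gauss_def by (intro tendsto_intros slim) simp
    then show "(\<lambda>n. ennreal (gauss (s n *\<^sub>R \<xi>) * (cmod (fourier_integral h \<xi>))\<^sup>2)) \<longlonglongrightarrow>
        ennreal ((cmod (fourier_integral h \<xi>))\<^sup>2)" for \<xi> :: 'a
      by (intro tendsto_ennrealI) simp
  qed
  ultimately have eq: "(\<integral>\<^sup>+\<xi>. ennreal ((cmod (fourier_integral h \<xi>))\<^sup>2) \<partial>lborel) = ennreal ((norm f)\<^sup>2)"
    using LIMSEQ_unique by fastforce
  show F: "square_integrable (fourier_integral h)"
    unfolding square_integrable_iff_nn_integral eq by simp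
  have "ennreal ((norm (abs_L2 (fourier_integral h)))\<^sup>2) = ennreal ((norm f)\<^sup>2)"
    unfolding ennreal_norm_abs_L2[OF F] by (rule eq)
  then show "norm (abs_L2 (fourier_integral h)) = norm (abs_L2 h)"
    by (simp add: f_def power2_eq_iff_nonneg)
qed

section \<open>The Fourier transform as an isometry of \<open>L\<^sup>2\<close>\<close>

text \<open>The relation whose unique value defines the Fourier transform, split so that the approximating
  sequence can be named.\<close>

definition fourier_approx ::
    "'a::euclidean_space L2 \<Rightarrow> 'a L2 \<Rightarrow> (nat \<Rightarrow> 'a \<Rightarrow> complex) \<Rightarrow> bool" where
  "fourier_approx f g h \<longleftrightarrow>
     (\<forall>N. integrable lborel (h N) \<and> square_integrable (h N) \<and>
          square_integrable (fourier_integral (h N))) \<and>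
     (\<lambda>N. abs_L2 (h N)) \<longlonglongrightarrow> f \<and>
     (\<lambda>N. abs_L2 (fourier_integral (h N))) \<longlonglongrightarrow> g"

definition fourier_limit :: "'a::euclidean_space L2 \<Rightarrow> 'a L2 \<Rightarrow> bool" where
  "fourier_limit f g \<longleftrightarrow> (\<exists>h. fourier_approx f g h)"

lemma fourier_eq_The: "fourier f = (THE g. fourier_limit f g)"
  by (simp only: fourier_def fourier_limit_def fourier_approx_def)

lemma fourier_approxD:
  assumes "fourier_approx f g h"
  shows "\<And>N. integrable lborel (h N)" "\<And>N. square_integrable (h N)"
    "\<And>N. square_integrable (fourier_integral (h N))"
    "(\<lambda>N. abs_L2 (h N)) \<longlonglongrightarrow> f" "(\<lambda>N. abs_L2 (fourier_integral (h N))) \<longlonglongrightarrow> g"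
  using assms by (simp_all add: fourier_approx_def)

lemma fourier_integral_add:
  assumes "integrable lborel h" "integrable lborel h'"
  shows "fourier_integral (\<lambda>x. h x + h' x) = (\<lambda>\<xi>. fourier_integral h \<xi> + fourier_integral h' \<xi>)"
  using assms by (auto simp: fourier_integral_eq_wave fun_eq_iff distrib_right integrable_mult_wave)

lemma fourier_integral_cmult: "fourier_integral (\<lambda>x. c * h x) = (\<lambda>\<xi>. c * fourier_integral h \<xi>)"
  by (auto simp: fourier_integral_eq_wave fun_eq_iff mult.assoc)

lemma fourier_integral_shift:
  fixes h :: "'a::euclidean_space \<Rightarrow> complex"
  assumes h: "integrable lborel h"
  shows "fourier_integral (\<lambda>x. h (x - a)) = (\<lambda>\<xi>. wave \<xi> a * fourier_integral h \<xi>)"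
proof
  fix \<xi>
  have [measurable]: "h \<in> borel_measurable borel" using h by auto
  have "fourier_integral (\<lambda>x. h (x - a)) \<xi> =
      \<bar>1\<bar> ^ DIM('a) *\<^sub>R (LINT x|lborel. h (a + 1 *\<^sub>R x - a) * wave \<xi> (a + 1 *\<^sub>R x))"
    unfolding fourier_integral_eq_wave by (rule lborel_integral_affine) auto
  also have "\<dots> = (LINT x|lborel. wave \<xi> a * (h x * wave \<xi> x))"
    by (simp add: wave_add mult.left_commute)
  finally show "fourier_integral (\<lambda>x. h (x - a)) \<xi> = wave \<xi> a * fourier_integral h \<xi>"
    by (simp only: fourier_integral_eq_wave integral_mult_right_zero)
qed

lemma fourier_limit_add:
  assumes "fourier_limit f g" "fourier_limit f' g'"
  shows "fourier_limit (f + f') (g + g')"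
proof -
  obtain h where "fourier_approx f g h"
    using assms(1) by (auto simp: fourier_limit_def)
  note h = fourier_approxD[OF this]
  obtain h' where "fourier_approx f' g' h'"
    using assms(2) by (auto simp: fourier_limit_def)
  note h' = fourier_approxD[OF this]
  show ?thesis
    unfolding fourier_limit_def fourier_approx_def
    using tendsto_add[OF h(4) h'(4)] tendsto_add[OF h(5) h'(5)]
    by (intro exI[of _ "\<lambda>N x. h N x + h' N x"])
      (simp add: fourier_integral_add abs_L2_add[symmetric] h h' square_integrable_add)
qed

lemma fourier_limit_scaleC:
  assumes "fourier_limit f g"
  shows "fourier_limit (c *\<^sub>C f) (c *\<^sub>C g)"
proof -
  obtain h where "fourier_approx f g h"
    using assms(1) by (auto simp: fourier_limit_def)
  note h = fourier_approxD[OF this]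
  show ?thesis
    unfolding fourier_limit_def fourier_approx_def
    using tendsto_scaleC[OF tendsto_const h(4), of c] tendsto_scaleC[OF tendsto_const h(5), of c]
    by (intro exI[of _ "\<lambda>N x. c * h N x"])
      (simp add: fourier_integral_cmult abs_L2_scaleC[symmetric] h square_integrable_scaleC)
qed

lemma fourier_limit_norm:
  assumes "fourier_limit f g"
  shows "norm g = norm f"
proof -
  obtain h where "fourier_approx f g h"
    using assms(1) by (auto simp: fourier_limit_def)
  note h = fourier_approxD[OF this]
  have "(\<lambda>N. norm (abs_L2 (h N))) \<longlonglongrightarrow> norm g"
    using tendsto_norm[OF h(5)] by (simp only: plancherel_L1_L2(2)[OF h(1,2)])
  with tendsto_norm[OF h(4)] show ?thesis by (rule LIMSEQ_unique[rotated])
qed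

text \<open>The difference of two limits is a limit for the zero function, and limits preserve norms.\<close>

lemma fourier_limit_unique:
  assumes "fourier_limit f g" "fourier_limit f g'"
  shows "g = g'"
proof -
  have "fourier_limit (f + (-1) *\<^sub>C f) (g + (-1) *\<^sub>C g')"
    by (intro fourier_limit_add fourier_limit_scaleC assms)
  from fourier_limit_norm[OF this] show ?thesis
    by (simp add: minus_L2_def[symmetric])
qed

text \<open>Truncation to balls gives integrable approximations. Their transforms form a Cauchy sequence,
  by Plancherel's theorem for integrable functions, and \<open>L\<^sup>2\<close> is complete.\<close>

lemma fourier_limit_exists: "\<exists>g. fourier_limit (f :: 'a::euclidean_space L2) g"
proof -
  define h :: "nat \<Rightarrow> 'a \<Rightarrow> complex" where "h N x = rep_L2 f x * indicator (cball 0 (real N)) x" for N x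
  have [measurable]: "cball (0::'a) r \<in> sets borel" for r by simp
  have [measurable]: "h N \<in> borel_measurable borel" for N unfolding h_def by measurable
  have le: "cmod (h N x) \<le> cmod (rep_L2 f x)" for N x
    by (simp add: h_def split: split_indicator)
  have fsq: "integrable lborel (\<lambda>x. (cmod (rep_L2 f x))\<^sup>2)"
    using square_integrable_rep[of f] by (simp add: square_integrable_def)
  have sq: "square_integrable (h N)" for N
    unfolding square_integrable_def
  proof
    show "integrable lborel (\<lambda>x. (cmod (h N x))\<^sup>2)"
      by (rule Bochner_Integration.integrable_bound[OF fsq]) (auto intro: power_mono le)
  qed simp
  have int: "integrable lborel (h N)" for N
  proof (rule Bochner_Integration.integrable_bound)
    have "emeasure lborel (cball (0::'a) (real N)) < \<infinity>" by (rule emeasure_lborel_cball_finite)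
    then show "integrable lborel (\<lambda>x. (cmod (rep_L2 f x))\<^sup>2 + indicator (cball 0 (real N)) x)"
      using fsq by auto
    have "cmod (h N x) \<le> (cmod (rep_L2 f x))\<^sup>2 + indicator (cball 0 (real N)) x" for x
    proof -
      have "cmod (rep_L2 f x) \<le> 2 * cmod (rep_L2 f x)" by simp
      also have "\<dots> \<le> (cmod (rep_L2 f x))\<^sup>2 + 1"
        using zero_le_power2[of "cmod (rep_L2 f x) - 1"] by (simp add: power2_diff)
      finally have "cmod (rep_L2 f x) \<le> (cmod (rep_L2 f x))\<^sup>2 + 1" .
      then show ?thesis by (simp add: h_def split: split_indicator)
    qed
    then show "AE x in lborel. norm (h N x) \<le> norm ((cmod (rep_L2 f x))\<^sup>2 + indicator (cball 0 (real N)) x)"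
      by simp
  qed simp
  have lim: "(\<lambda>N. abs_L2 (h N)) \<longlonglongrightarrow> f"
  proof (rule tendsto_abs_L2I[OF sq])
    show "(\<lambda>N. h N x) \<longlonglongrightarrow> rep_L2 f x" for x
    proof (rule tendsto_eventually)
      obtain M :: nat where M: "norm x \<le> real M" using real_arch_simple by blast
      have "h N x = rep_L2 f x" if "M \<le> N" for N
        using M that by (simp add: h_def indicator_def)
      then show "\<forall>\<^sub>F N in sequentially. h N x = rep_L2 f x"
        unfolding eventually_sequentially by blast
    qed
    show "cmod (h N x) \<le> 2 * cmod (rep_L2 f x)" for N x
      using le[of N x] by (rule order.trans) simp
  qed
  have Fsq: "square_integrable (fourier_integral (h N))" for N
    using plancherel_L1_L2(1)[OF int sq] .
  have iso: "dist (abs_L2 (fourier_integral (h M))) (abs_L2 (fourier_integral (h N))) =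
      dist (abs_L2 (h M)) (abs_L2 (h N))" for M N
  proof -
    have mi: "integrable lborel (\<lambda>x. -1 * h N x)" using int[of N] by simp
    have "(\<lambda>\<xi>. fourier_integral (h M) \<xi> - fourier_integral (h N) \<xi>) = fourier_integral (\<lambda>x. h M x + (-1) * h N x)"
      unfolding fourier_integral_add[OF int mi] fourier_integral_cmult by simp
    then have "abs_L2 (fourier_integral (h M)) - abs_L2 (fourier_integral (h N)) =
        abs_L2 (fourier_integral (\<lambda>x. h M x - h N x))"
      by (simp add: abs_L2_diff Fsq)
    moreover have "norm (abs_L2 (fourier_integral (\<lambda>x. h M x - h N x))) = norm (abs_L2 (\<lambda>x. h M x - h N x))"
      using int sq by (intro plancherel_L1_L2(2) square_integrable_diff) auto
    ultimately show ?thesis by (simp add: dist_norm abs_L2_diff sq)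
  qed
  have "Cauchy (\<lambda>N. abs_L2 (h N))" using lim by (intro convergent_Cauchy) (auto simp: convergent_def)
  then have "Cauchy (\<lambda>N. abs_L2 (fourier_integral (h N)))"
    unfolding Cauchy_def iso .
  then obtain g where "(\<lambda>N. abs_L2 (fourier_integral (h N))) \<longlonglongrightarrow> g"
    using Cauchy_convergent convergent_def by blast
  then show ?thesis unfolding fourier_limit_def fourier_approx_def using int sq Fsq lim by blast
qed

lemma fourier_limit_fourier: "fourier_limit f (fourier f)"
  unfolding fourier_eq_The
  by (rule theI') (use fourier_limit_exists fourier_limit_unique in blast)

lemma fourier_add: "fourier (f + g) = fourier f + fourier g"
  using fourier_limit_add fourier_limit_fourier fourier_limit_unique by blast

lemma fourier_scaleC: "fourier (c *\<^sub>C f) = c *\<^sub>C fourier f"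
  using fourier_limit_scaleC fourier_limit_fourier fourier_limit_unique by blast

lemma norm_fourier: "norm (fourier f) = norm f"
  using fourier_limit_norm fourier_limit_fourier by blast

lemma square_integrable_modulate:
  fixes g :: "'a::euclidean_space \<Rightarrow> complex"
  assumes "square_integrable g"
  shows "square_integrable (\<lambda>\<xi>. wave \<xi> a * g \<xi>)"
proof -
  have [measurable]: "g \<in> borel_measurable borel" using assms by (simp add: square_integrable_def)
  show ?thesis using assms by (simp add: square_integrable_def norm_mult)
qed

text \<open>Along an approximating sequence the transforms of the translates are the modulated
  transforms, and modulation is isometric.\<close>

lemma fourier_shift:
  "AE \<xi> in lborel. rep_L2 (fourier (shift a f)) \<xi> = wave \<xi> a * rep_L2 (fourier (f :: 'a::euclidean_space L2)) \<xi>"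
proof -
  define g where "g = abs_L2 (\<lambda>\<xi>. wave \<xi> a * rep_L2 (fourier f) \<xi>)"
  obtain h where "fourier_approx f (fourier f) h"
    using fourier_limit_fourier[of f] by (auto simp: fourier_limit_def)
  note h = fourier_approxD[OF this]
  have "(\<lambda>N. shift a (abs_L2 (h N))) \<longlonglongrightarrow> shift a f"
    using h(4) tendsto_dist_iff[of "\<lambda>N. shift a (abs_L2 (h N))" "shift a f"]
      tendsto_dist_iff[of "\<lambda>N. abs_L2 (h N)" f]
    by (simp only: dist_norm shift_diff[symmetric] norm_shift)
  then have lim1: "(\<lambda>N. abs_L2 (\<lambda>x. h N (x - a))) \<longlonglongrightarrow> shift a f"
    by (simp add: shift_abs_L2 h)
  have sqm: "square_integrable (\<lambda>\<xi>. wave \<xi> a * fourier_integral (h N) \<xi>)" for N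
    by (rule square_integrable_modulate[OF h(3)])
  have sqg: "square_integrable (\<lambda>\<xi>. wave \<xi> a * rep_L2 (fourier f) \<xi>)"
    by (rule square_integrable_modulate[OF square_integrable_rep])
  have "dist (abs_L2 (\<lambda>\<xi>. wave \<xi> a * fourier_integral (h N) \<xi>)) g = dist (abs_L2 (fourier_integral (h N))) (fourier f)" for N
  proof -
    have "(norm (abs_L2 (\<lambda>\<xi>. wave \<xi> a * fourier_integral (h N) \<xi>) - g))\<^sup>2 =
        (LINT \<xi>|lborel. (cmod (wave \<xi> a * fourier_integral (h N) \<xi> - wave \<xi> a * rep_L2 (fourier f) \<xi>))\<^sup>2)"
      unfolding g_def abs_L2_diff[OF sqm sqg] by (rule norm_abs_L2[OF square_integrable_diff[OF sqm sqg]])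
    also have "\<dots> = (LINT \<xi>|lborel. (cmod (fourier_integral (h N) \<xi> - rep_L2 (fourier f) \<xi>))\<^sup>2)"
      by (simp add: right_diff_distrib[symmetric] norm_mult)
    also have "\<dots> = (norm (abs_L2 (fourier_integral (h N)) - fourier f))\<^sup>2"
      using norm_abs_L2[OF square_integrable_diff[OF h(3) square_integrable_rep]]
      by (simp add: abs_L2_diff[OF h(3) square_integrable_rep, symmetric] abs_rep_L2)
    finally show ?thesis by (simp add: dist_norm power2_eq_iff_nonneg)
  qed
  then have lim2: "(\<lambda>N. abs_L2 (\<lambda>\<xi>. wave \<xi> a * fourier_integral (h N) \<xi>)) \<longlonglongrightarrow> g"
    using h(5) tendsto_dist_iff[of "\<lambda>N. abs_L2 (\<lambda>\<xi>. wave \<xi> a * fourier_integral (h N) \<xi>)" g]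
      tendsto_dist_iff[of "\<lambda>N. abs_L2 (fourier_integral (h N))" "fourier f"]
    by (simp only:)
  have "fourier_limit (shift a f) g"
    unfolding fourier_limit_def fourier_approx_def
  proof (intro exI[of _ "\<lambda>N x. h N (x - a)"] conjI allI)
    show "integrable lborel (\<lambda>x. h N (x - a))" for N
      using lborel_integrable_affine[of "h N" 1 "- a"] h(1) by simp
  qed (use lim1 lim2 sqm in \<open>simp_all add: fourier_integral_shift h square_integrable_shift\<close>)
  then have "fourier (shift a f) = g"
    using fourier_limit_fourier fourier_limit_unique by blast
  then show ?thesis using rep_abs_L2[OF sqg] by (simp add: g_def)
qed

lemma translate_eq_shift: "translate k f = shift (int_vec k) f"
proof -
  have "translate k (abs_L2 (rep_L2 f)) = shift (int_vec k) (abs_L2 (rep_L2 f))"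
    by (simp add: translate.abs_eq L2_rel_rep shift_abs_L2 square_integrable_rep)
  then show ?thesis by (simp add: abs_rep_L2)
qed

section \<open>The torus as a fundamental domain\<close>

abbreviation torus_measure :: "(real ^ 'd) measure" where
  "torus_measure \<equiv> restrict_space lborel torus"

lemma torus_sets [measurable]: "torus \<in> sets borel"
  unfolding torus_def by measurable

lemma AE_torus_measure: "(AE \<omega> in torus_measure. P \<omega>) \<longleftrightarrow> (AE \<omega> in lborel. \<omega> \<in> torus \<longrightarrow> P \<omega>)"
  by (subst AE_restrict_space_iff) auto

text \<open>Completion adds no null sets up to inclusion, so almost every statement may be proved for the
  Borel measure, for which Fubini's theorem and the measurability rules are at hand.\<close>

lemma AE_lebesgue_on_torus: "(AE \<omega> in lebesgue_on torus. P \<omega>) \<longleftrightarrow> (AE \<omega> in torus_measure. P \<omega>)"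
  unfolding AE_torus_measure by (subst AE_restrict_space_iff) (auto simp: AE_completion_iff)

lemma AE_lborel_shift:
  assumes "AE x in lborel. P x"
  shows "AE x in lborel. P (x + (t :: 'a::euclidean_space))"
proof -
  obtain N where N: "{x \<in> space lborel. \<not> P x} \<subseteq> N" "emeasure lborel N = 0" "N \<in> sets lborel"
    using AE_E[OF assms] by metis
  then have [measurable]: "N \<in> sets borel" by simp
  define N' where "N' = (\<lambda>x. x + t) -` N"
  have N'm: "N' \<in> sets borel"
    unfolding N'_def using measurable_sets_borel[of "\<lambda>x. x + t" borel N] N(3) by simp
  have "emeasure lborel N' = (\<integral>\<^sup>+x. indicator N (x + t) \<partial>lborel)"
    using N'm by (simp add: N'_def indicator_def flip: nn_integral_indicator)
  also have "\<dots> = 0" using N(2) by (subst nn_integral_lborel_shift) auto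
  finally have "N' \<in> null_sets lborel" using N'm by auto
  then show ?thesis
    by (rule AE_I') (use N(1) in \<open>auto simp: N'_def\<close>)
qed

lemma AE_torus_shifts:
  assumes "AE x in lborel. P x"
  shows "AE \<omega> in torus_measure. \<forall>k. P (\<omega> + int_vec k)"
proof -
  have "AE x in lborel. \<forall>k\<in>UNIV. P (x + int_vec k)"
    using AE_lborel_shift[OF assms] by (subst AE_ball_countable) auto
  then show ?thesis unfolding AE_torus_measure by auto
qed

text \<open>In each coordinate exactly one integer brings a real number into the half-open interval
  \<open>[-1/2, 1/2)\<close>: the one obtained by rounding.\<close>

lemma torus_tiling: "\<exists>k. {k. x - int_vec k \<in> torus} = {k}"
proof
  show "{k. x - int_vec k \<in> torus} = {\<chi> i. \<lfloor>x $ i + 1 / 2\<rfloor>}"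
  proof (intro set_eqI)
    fix k
    have "k $ i = \<lfloor>x $ i + 1 / 2\<rfloor> \<longleftrightarrow> - 1 / 2 \<le> x $ i - real_of_int (k $ i) \<and> x $ i - real_of_int (k $ i) < 1 / 2" for i
      unfolding eq_commute[of "k $ i"] floor_eq_iff by auto
    then have "x - int_vec k \<in> torus \<longleftrightarrow> (\<forall>i. k $ i = \<lfloor>x $ i + 1 / 2\<rfloor>)"
      by (simp add: torus_def int_vec_def)
    then show "k \<in> {k. x - int_vec k \<in> torus} \<longleftrightarrow> k \<in> {\<chi> i. \<lfloor>x $ i + 1 / 2\<rfloor>}"
      by (auto simp: vec_eq_iff)
  qed
qed

lemma nn_integral_torus_tiling:
  fixes f :: "real ^ 'd \<Rightarrow> ennreal"
  assumes [measurable]: "f \<in> borel_measurable borel"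
  shows "(\<integral>\<^sup>+\<omega>. (\<integral>\<^sup>+k. f (\<omega> + int_vec k) \<partial>count_space UNIV) \<partial>torus_measure) = (\<integral>\<^sup>+x. f x \<partial>lborel)"
proof -
  have one: "(\<integral>\<^sup>+k. indicator torus (x - int_vec k) \<partial>count_space UNIV) = (1::ennreal)" for x :: "real ^ 'd"
  proof -
    obtain k0 where "{k. x - int_vec k \<in> torus} = {k0}" using torus_tiling by blast
    then have "indicator torus (x - int_vec k) = (indicator {k0} k :: ennreal)" for k
      by (auto simp: indicator_def)
    then show ?thesis by simp
  qed
  have meas: "(\<lambda>x. f x * indicator torus (x - int_vec k)) \<in> borel_measurable lborel" for k
    by measurable
  have "(\<integral>\<^sup>+\<omega>. (\<integral>\<^sup>+k. f (\<omega> + int_vec k) \<partial>count_space UNIV) \<partial>torus_measure) =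
      (\<integral>\<^sup>+\<omega>. (\<integral>\<^sup>+k. f (\<omega> + int_vec k) \<partial>count_space UNIV) * indicator torus \<omega> \<partial>lborel)"
    by (subst nn_integral_restrict_space) auto
  also have "\<dots> = (\<integral>\<^sup>+\<omega>. (\<integral>\<^sup>+k. f (\<omega> + int_vec k) * indicator torus \<omega> \<partial>count_space UNIV) \<partial>lborel)"
    by (simp add: nn_integral_multc)
  also have "\<dots> = (\<integral>\<^sup>+k. (\<integral>\<^sup>+\<omega>. f (\<omega> + int_vec k) * indicator torus \<omega> \<partial>lborel) \<partial>count_space UNIV)"
    by (rule nn_integral_count_space_nn_integral) auto
  also have "\<dots> = (\<integral>\<^sup>+k. (\<integral>\<^sup>+x. f x * indicator torus (x - int_vec k) \<partial>lborel) \<partial>count_space UNIV)"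
  proof (rule nn_integral_cong)
    fix k :: "int ^ 'd"
    show "(\<integral>\<^sup>+\<omega>. f (\<omega> + int_vec k) * indicator torus \<omega> \<partial>lborel) = (\<integral>\<^sup>+x. f x * indicator torus (x - int_vec k) \<partial>lborel)"
      using nn_integral_lborel_shift[of "\<lambda>x. f x * indicator torus (x - int_vec k)" "int_vec k"] by simp
  qed
  also have "\<dots> = (\<integral>\<^sup>+x. (\<integral>\<^sup>+k. f x * indicator torus (x - int_vec k) \<partial>count_space UNIV) \<partial>lborel)"
    by (rule nn_integral_count_space_nn_integral[symmetric]) (use meas in simp_all)
  also have "\<dots> = (\<integral>\<^sup>+x. f x \<partial>lborel)"
    by (simp add: nn_integral_cmult one)
  finally show ?thesis .
qed

section \<open>Trigonometric polynomials\<close>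

text \<open>Finite combinations of the characters, generated inductively so that closure under products and
  conjugation follows by induction.\<close>

inductive trig_poly :: "(real ^ 'd \<Rightarrow> complex) \<Rightarrow> bool" where
  trig_poly_wave: "trig_poly (\<lambda>\<omega>. c * wave \<omega> (int_vec k))"
| trig_poly_add: "trig_poly p \<Longrightarrow> trig_poly q \<Longrightarrow> trig_poly (\<lambda>\<omega>. p \<omega> + q \<omega>)"

lemma int_vec_add: "int_vec (k + l) = int_vec k + int_vec l"
  by (simp add: int_vec_def vec_eq_iff)

lemma int_vec_diff: "int_vec (k - l) = int_vec k - int_vec l"
  by (simp add: int_vec_def vec_eq_iff)

lemma int_vec_0 [simp]: "int_vec 0 = 0"
  by (simp add: int_vec_def vec_eq_iff)

lemma wave_zero_right [simp]: "wave \<omega> 0 = 1"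
  by (simp add: wave_def)

lemma trig_poly_const: "trig_poly (\<lambda>\<omega>. c)"
  using trig_poly_wave[of c 0] by simp

lemma trig_poly_mult:
  assumes "trig_poly p" "trig_poly q"
  shows "trig_poly (\<lambda>\<omega>. p \<omega> * q \<omega>)"
  using assms
proof (induction arbitrary: q)
  case (trig_poly_wave c k)
  from trig_poly_wave show ?case
  proof induction
    case (trig_poly_wave c' k')
    have "(\<lambda>\<omega>. c * wave \<omega> (int_vec k) * (c' * wave \<omega> (int_vec k'))) = (\<lambda>\<omega>. (c * c') * wave \<omega> (int_vec (k + k')))"
      by (simp add: int_vec_add wave_add mult_ac)
    then show ?case by (simp only: trig_poly.trig_poly_wave)
  next
    case (trig_poly_add p q)
    then show ?case unfolding distrib_left by (intro trig_poly.trig_poly_add)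
  qed
next
  case (trig_poly_add p p')
  then show ?case unfolding distrib_right by (intro trig_poly.trig_poly_add) auto
qed

lemma trig_poly_sum:
  assumes "finite A" "\<And>i. i \<in> A \<Longrightarrow> trig_poly (p i)"
  shows "trig_poly (\<lambda>\<omega>. \<Sum>i\<in>A. p i \<omega>)"
  using assms
proof (induction A)
  case (insert i A)
  then show ?case by (auto intro: trig_poly_add)
qed (simp add: trig_poly_const)

lemma trig_polyE:
  assumes "trig_poly p"
  obtains F c where "finite F" "p = (\<lambda>\<omega>. \<Sum>k\<in>F. c k * wave \<omega> (int_vec k))"
proof -
  have "\<exists>F c. finite F \<and> p = (\<lambda>\<omega>. \<Sum>k\<in>F. c k * wave \<omega> (int_vec k))"
    using assms
  proof induction
    case (trig_poly_wave c k)
    show ?case by (intro exI[of _ "{k}"] exI[of _ "\<lambda>_. c"]) simp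
  next
    case (trig_poly_add p q)
    then obtain F c G d where F: "finite F" "p = (\<lambda>\<omega>. \<Sum>k\<in>F. c k * wave \<omega> (int_vec k))"
      and G: "finite G" "q = (\<lambda>\<omega>. \<Sum>k\<in>G. d k * wave \<omega> (int_vec k))" by auto
    have 1: "p \<omega> = (\<Sum>k\<in>F \<union> G. (if k \<in> F then c k else 0) * wave \<omega> (int_vec k))" for \<omega>
      unfolding F(2) using F(1) G(1) by (intro sum.mono_neutral_cong_left) auto
    have 2: "q \<omega> = (\<Sum>k\<in>F \<union> G. (if k \<in> G then d k else 0) * wave \<omega> (int_vec k))" for \<omega>
      unfolding G(2) using F(1) G(1) by (intro sum.mono_neutral_cong_left) auto
    show ?case unfolding 1 2
      by (intro exI[of _ "F \<union> G"] exI[of _ "\<lambda>k. (if k \<in> F then c k else 0) + (if k \<in> G then d k else 0)"])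
        (simp add: F(1) G(1) sum.distrib distrib_right)
  qed
  then show ?thesis using that by blast
qed

lemma measurable_torus_measure:
  "g \<in> borel_measurable borel \<Longrightarrow> g \<in> borel_measurable torus_measure"
  by (simp add: measurable_restrict_space1)

lemma trig_poly_measurable:
  assumes "trig_poly p" shows "p \<in> borel_measurable borel"
proof -
  obtain F c where "finite F" "p = (\<lambda>\<omega>. \<Sum>k\<in>F. c k * wave \<omega> (int_vec k))"
    using assms by (rule trig_polyE)
  then show ?thesis by simp
qed

lemma trig_poly_bounded:
  assumes "trig_poly p" shows "\<exists>B. \<forall>\<omega>. cmod (p \<omega>) \<le> B"
proof -
  obtain F c where F: "finite F" "p = (\<lambda>\<omega>. \<Sum>k\<in>F. c k * wave \<omega> (int_vec k))"
    using assms by (rule trig_polyE)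
  have "cmod (p \<omega>) \<le> (\<Sum>k\<in>F. cmod (c k))" for \<omega>
    unfolding F(2) by (rule order.trans[OF norm_sum]) (simp add: norm_mult)
  then show ?thesis by blast
qed

text \<open>The torus as a subset of the Euclidean space \<open>complex ^ 'd\<close>. There trigonometric polynomials are
  restrictions of polynomial functions, and periodicity is built in: every function of
  \<open>torus_embed \<omega>\<close> is periodic in \<open>\<omega>\<close>.\<close>

definition torus_embed :: "real ^ 'd \<Rightarrow> complex ^ 'd" where
  "torus_embed \<omega> = (\<chi> i. cis (2 * pi * (\<omega> $ i)))"

text \<open>The real coordinates of the embedding are the functions cosine and sine of \<open>2 * pi * \<omega> $ i\<close>, half
  the sum and half the difference (over \<open>\<i>\<close>) of two characters.\<close>

lemma torus_embed_trig_poly: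
  assumes "b \<in> Basis"
  shows "trig_poly (\<lambda>\<omega>. complex_of_real (torus_embed \<omega> \<bullet> b))"
proof -
  obtain i u where b: "b = axis i u" "u \<in> Basis" using assms by (auto simp: Basis_vec_def)
  have ax: "int_vec (axis i z) \<bullet> \<omega> = real_of_int z * \<omega> $ i" for z \<omega>
  proof -
    have "int_vec (axis i z) = axis i (real_of_int z)" by (simp add: int_vec_def axis_def vec_eq_iff)
    then show ?thesis by (simp add: inner_axis')
  qed
  have wp: "wave \<omega> (int_vec (axis i (-1))) = cis (2 * pi * (\<omega> $ i))" for \<omega>
    unfolding wave_def ax cis_conv_exp by (simp add: mult_ac)
  have wm: "wave \<omega> (int_vec (axis i 1)) = cnj (cis (2 * pi * (\<omega> $ i)))" for \<omega>
    unfolding wave_def ax cis_conv_exp by (simp add: exp_cnj mult_ac)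
  consider "u = 1" | "u = \<i>" using b(2) by (auto simp: Basis_complex_def)
  then show ?thesis
  proof cases
    case 1
    have "complex_of_real (torus_embed \<omega> \<bullet> b) =
        (1/2) * wave \<omega> (int_vec (axis i (-1))) + (1/2) * wave \<omega> (int_vec (axis i 1))" for \<omega>
      unfolding wp wm b(1) 1
      by (simp add: torus_embed_def inner_axis complex_eq_iff)
    then show ?thesis by (simp only: trig_poly.intros)
  next
    case 2
    have "complex_of_real (torus_embed \<omega> \<bullet> b) =
        (- \<i>/2) * wave \<omega> (int_vec (axis i (-1))) + (\<i>/2) * wave \<omega> (int_vec (axis i 1))" for \<omega>
      unfolding wp wm b(1) 2
      by (simp add: torus_embed_def inner_axis complex_eq_iff)
    then show ?thesis by (simp only: trig_poly.intros)
  qed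
qed

lemma polynomial_torus_embed_trig_poly:
  assumes "real_polynomial_function p"
  shows "trig_poly (\<lambda>\<omega>. complex_of_real (p (torus_embed \<omega>)))"
  using assms
proof induction
  case (linear f)
  have "f z = (\<Sum>b\<in>Basis. (z \<bullet> b) * f b)" for z
  proof -
    interpret bounded_linear f by (rule linear)
    have "f (\<Sum>b\<in>Basis. (z \<bullet> b) *\<^sub>R b) = (\<Sum>b\<in>Basis. (z \<bullet> b) * f b)"
      by (simp add: sum scaleR)
    then show ?thesis by (simp only: euclidean_representation)
  qed
  then have "(\<lambda>\<omega>. complex_of_real (f (torus_embed \<omega>))) =
      (\<lambda>\<omega>. \<Sum>b\<in>Basis. complex_of_real (torus_embed \<omega> \<bullet> b) * complex_of_real (f b))"
    by (metis (no_types, lifting) of_real_mult of_real_sum sum.cong)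
  then show ?case
    by (simp only:) (intro trig_poly_sum trig_poly_mult trig_poly_const torus_embed_trig_poly finite_Basis)
qed (auto intro: trig_poly_const trig_poly_add trig_poly_mult)

lemma continuous_torus_embed: "continuous_on A torus_embed"
  unfolding torus_embed_def by (intro continuous_intros)

lemma inj_torus_embed: "inj_on torus_embed torus"
proof (rule inj_onI)
  fix x y :: "real ^ 'd" assume x: "x \<in> torus" and y: "y \<in> torus" and eq: "torus_embed x = torus_embed y"
  have "x $ i = y $ i" for i
  proof -
    have "cis (2 * pi * (x $ i)) = cis (2 * pi * (y $ i))"
      using eq by (simp add: torus_embed_def vec_eq_iff)
    then have "cis (2 * pi * (x $ i) - 2 * pi * (y $ i)) = 1"
      by (simp add: cis_divide[symmetric])
    then obtain z :: int where "2 * pi * (x $ i) - 2 * pi * (y $ i) = 2 * pi * z"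
      unfolding cis_conv_exp exp_eq_1 by auto
    then have "2 * pi * (x $ i - y $ i) = 2 * pi * z" by (simp add: right_diff_distrib)
    then have z: "x $ i - y $ i = real_of_int z" by simp
    moreover have "\<bar>x $ i - y $ i\<bar> < 1"
      using x y by (simp add: torus_def abs_less_iff) (smt (verit) field_sum_of_halves)
    ultimately have "\<bar>real_of_int z\<bar> < 1" by simp
    then have "z = 0" by linarith
    then show ?thesis using z by simp
  qed
  then show "x = y" by (simp add: vec_eq_iff)
qed

text \<open>The closed cube is used because it is compact and has the same image as the half-open torus.\<close>

definition torus_image :: "(complex ^ 'd) set" where
  "torus_image = torus_embed ` cbox (\<chi> i. - 1 / 2) (\<chi> i. 1 / 2)"

lemma compact_torus_image: "compact torus_image"
  unfolding torus_image_def by (intro compact_continuous_image continuous_torus_embed compact_cbox)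

lemma torus_subset_cbox: "torus \<subseteq> cbox (\<chi> i. - 1 / 2) (\<chi> i. 1 / 2)"
  by (auto simp: torus_def mem_box_cart less_imp_le)

lemma torus_embed_in_image: "\<omega> \<in> torus \<Longrightarrow> torus_embed \<omega> \<in> torus_image"
  unfolding torus_image_def using torus_subset_cbox by blast

lemma bounded_torus: "bounded torus"
  using bounded_subset[OF bounded_cbox torus_subset_cbox] .

lemma measurable_torus_embed [measurable]: "torus_embed \<in> borel_measurable borel"
  by (rule borel_measurable_continuous_onI[OF continuous_torus_embed])

lemma space_torus_measure [simp]: "space torus_measure = torus"
  by (simp add: space_restrict_space)

text \<open>By the Weierstrass theorem the square root of a nonnegative continuous function on the torus
  is a uniform limit of trigonometric polynomials, so the function itself is a limit of squares
  of such.\<close>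

lemma integral_nonneg_continuous:
  fixes g :: "real ^ 'd \<Rightarrow> real"
  assumes g: "integrable torus_measure g"
    and pos: "\<And>p. trig_poly p \<Longrightarrow> 0 \<le> (LINT \<omega>|torus_measure. g \<omega> * (cmod (p \<omega>))\<^sup>2)"
    and u: "continuous_on UNIV u" "\<And>z. 0 \<le> u z"
  shows "0 \<le> (LINT \<omega>|torus_measure. g \<omega> * u (torus_embed \<omega>))"
proof -
  have gm: "g \<in> borel_measurable torus_measure" using g by auto
  have cont: "continuous_on torus_image (\<lambda>z. sqrt (u z))"
    by (intro continuous_on_real_sqrt continuous_on_subset[OF u(1)]) auto
  have "\<exists>p. real_polynomial_function p \<and> (\<forall>z\<in>torus_image. \<bar>sqrt (u z) - p z\<bar> < inverse (real (Suc n)))" for n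
  proof -
    obtain p where "real_polynomial_function p" "\<And>z. z \<in> torus_image \<Longrightarrow> \<bar>sqrt (u z) - p z\<bar> < inverse (real (Suc n))"
      using Stone_Weierstrass_real_polynomial_function[OF compact_torus_image cont, of "inverse (real (Suc n))"]
      by auto
    then show ?thesis by blast
  qed
  then obtain p where p: "\<And>n. real_polynomial_function (p n)"
    "\<And>n z. z \<in> torus_image \<Longrightarrow> \<bar>sqrt (u z) - p n z\<bar> < inverse (real (Suc n))"
    by metis
  obtain B where B: "\<And>z. z \<in> torus_image \<Longrightarrow> \<bar>sqrt (u z)\<bar> \<le> B"
    using compact_imp_bounded[OF compact_continuous_image[OF cont compact_torus_image]]
    by (auto simp: bounded_iff)
  define q where "q n \<omega> = complex_of_real (p n (torus_embed \<omega>))" for n \<omega>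
  have q: "trig_poly (q n)" for n
    unfolding q_def by (rule polynomial_torus_embed_trig_poly[OF p(1)])
  have qm: "q n \<in> borel_measurable torus_measure" for n
    using trig_poly_measurable[OF q[of n]] by (intro measurable_restrict_space1) simp
  have um: "(\<lambda>\<omega>. u (torus_embed \<omega>)) \<in> borel_measurable (borel :: (real ^ 'd) measure)"
    by (rule measurable_compose[OF measurable_torus_embed borel_measurable_continuous_onI[OF u(1)]])
  have "(\<lambda>n. LINT \<omega>|torus_measure. g \<omega> * (cmod (q n \<omega>))\<^sup>2) \<longlonglongrightarrow> (LINT \<omega>|torus_measure. g \<omega> * u (torus_embed \<omega>))"
  proof (rule integral_dominated_convergence[where w = "\<lambda>\<omega>. \<bar>g \<omega>\<bar> * (B + 1)\<^sup>2"])
    show "integrable torus_measure (\<lambda>\<omega>. \<bar>g \<omega>\<bar> * (B + 1)\<^sup>2)" using g by simp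
    show "(\<lambda>\<omega>. g \<omega> * u (torus_embed \<omega>)) \<in> borel_measurable torus_measure"
      using gm measurable_torus_measure[OF um] by (rule borel_measurable_times)
    show "(\<lambda>\<omega>. g \<omega> * (cmod (q n \<omega>))\<^sup>2) \<in> borel_measurable torus_measure" for n
      using gm qm[of n] by measurable
    have "(\<lambda>n. g \<omega> * (cmod (q n \<omega>))\<^sup>2) \<longlonglongrightarrow> g \<omega> * u (torus_embed \<omega>)" if \<omega>: "\<omega> \<in> torus" for \<omega>
    proof -
      have "(\<lambda>n. p n (torus_embed \<omega>) - sqrt (u (torus_embed \<omega>))) \<longlonglongrightarrow> 0"
        by (rule Lim_null_comparison[OF always_eventually[OF allI] LIMSEQ_inverse_real_of_nat])
          (use p(2)[OF torus_embed_in_image[OF \<omega>]] in \<open>auto simp: abs_minus_commute intro: less_imp_le\<close>)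
      then have "(\<lambda>n. p n (torus_embed \<omega>)) \<longlonglongrightarrow> sqrt (u (torus_embed \<omega>))" by (simp only: Lim_null[symmetric])
      then have "(\<lambda>n. g \<omega> * (p n (torus_embed \<omega>))\<^sup>2) \<longlonglongrightarrow> g \<omega> * (sqrt (u (torus_embed \<omega>)))\<^sup>2"
        by (intro tendsto_intros)
      then show ?thesis using u(2) by (simp add: q_def)
    qed
    then show "AE \<omega> in torus_measure. (\<lambda>n. g \<omega> * (cmod (q n \<omega>))\<^sup>2) \<longlonglongrightarrow> g \<omega> * u (torus_embed \<omega>)"
      by (intro AE_I2) simp
    fix n
    have "norm (g \<omega> * (cmod (q n \<omega>))\<^sup>2) \<le> \<bar>g \<omega>\<bar> * (B + 1)\<^sup>2" if \<omega>: "\<omega> \<in> torus" for \<omega>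
    proof -
      have "inverse (real (Suc n)) \<le> 1" by (simp add: field_simps)
      then have "\<bar>p n (torus_embed \<omega>)\<bar> \<le> B + 1"
        using p(2)[OF torus_embed_in_image[OF \<omega>], of n] B[OF torus_embed_in_image[OF \<omega>]] by linarith
      then have "\<bar>p n (torus_embed \<omega>)\<bar>\<^sup>2 \<le> (B + 1)\<^sup>2" by (intro power_mono) auto
      then show ?thesis by (simp add: q_def abs_mult mult_left_mono)
    qed
    then show "AE \<omega> in torus_measure. norm (g \<omega> * (cmod (q n \<omega>))\<^sup>2) \<le> \<bar>g \<omega>\<bar> * (B + 1)\<^sup>2"
      by (intro AE_I2) simp
  qed
  then show ?thesis by (rule LIMSEQ_le_const) (use pos[OF q] in auto)
qed

text \<open>The indicator of the image of \<open>K\<close> is the limit of continuous tent functions of the distance to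
  that image. Injectivity of the embedding on the half-open torus makes it the indicator of \<open>K\<close>
  there.\<close>

lemma integral_nonneg_compact:
  fixes g :: "real ^ 'd \<Rightarrow> real"
  assumes g: "integrable torus_measure g"
    and pos: "\<And>p. trig_poly p \<Longrightarrow> 0 \<le> (LINT \<omega>|torus_measure. g \<omega> * (cmod (p \<omega>))\<^sup>2)"
    and K: "compact K" "K \<subseteq> torus"
  shows "0 \<le> (LINT \<omega>|torus_measure. g \<omega> * indicator K \<omega>)"
proof (cases "K = {}")
  case False
  have gm: "g \<in> borel_measurable torus_measure" using g by auto
  define C where "C = torus_embed ` K"
  have C: "closed C" "C \<noteq> {}"
    unfolding C_def using False K(1)
    by (auto intro!: compact_imp_closed compact_continuous_image continuous_torus_embed)
  define u where "u n z = max 0 (1 - real n * infdist z C)" for n z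
  have ucont: "continuous_on UNIV (u n)" for n
    unfolding u_def by (intro continuous_intros)
  have upos: "0 \<le> u n z" for n z by (simp add: u_def)
  have um: "(\<lambda>\<omega>. u n (torus_embed \<omega>)) \<in> borel_measurable (borel :: (real ^ 'd) measure)" for n
    by (rule measurable_compose[OF measurable_torus_embed borel_measurable_continuous_onI[OF ucont]])
  have "(\<lambda>n. LINT \<omega>|torus_measure. g \<omega> * u n (torus_embed \<omega>)) \<longlonglongrightarrow> (LINT \<omega>|torus_measure. g \<omega> * indicator K \<omega>)"
  proof (rule integral_dominated_convergence[where w = "\<lambda>\<omega>. \<bar>g \<omega>\<bar>"])
    show "integrable torus_measure (\<lambda>\<omega>. \<bar>g \<omega>\<bar>)" using g by simp
    have "indicator K \<in> borel_measurable (borel :: (real ^ 'd) measure)"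
      using borel_compact[OF K(1)] by (rule borel_measurable_indicator)
    from gm measurable_torus_measure[OF this]
    show "(\<lambda>\<omega>. g \<omega> * indicator K \<omega>) \<in> borel_measurable torus_measure"
      by (rule borel_measurable_times)
    show "(\<lambda>\<omega>. g \<omega> * u n (torus_embed \<omega>)) \<in> borel_measurable torus_measure" for n
      using gm measurable_torus_measure[OF um] by (rule borel_measurable_times)
    have "(\<lambda>n. g \<omega> * u n (torus_embed \<omega>)) \<longlonglongrightarrow> g \<omega> * indicator K \<omega>" if \<omega>: "\<omega> \<in> torus" for \<omega>
    proof (cases "\<omega> \<in> K")
      case True
      then have "infdist (torus_embed \<omega>) C = 0" by (simp add: C_def)
      then show ?thesis using True by (simp add: u_def)
    next
      case False
      have "torus_embed \<omega> \<notin> C"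
        using inj_torus_embed K(2) \<omega> False unfolding C_def inj_on_def by blast
      then have pos: "0 < infdist (torus_embed \<omega>) C"
        using C in_closed_iff_infdist_zero[of C] infdist_nonneg[of "torus_embed \<omega>" C] by (auto simp: less_le)
      obtain N where N: "1 < real N * infdist (torus_embed \<omega>) C"
        using reals_Archimedean3[OF pos] by blast
      have "u n (torus_embed \<omega>) = 0" if "N \<le> n" for n
      proof -
        have "real N * infdist (torus_embed \<omega>) C \<le> real n * infdist (torus_embed \<omega>) C"
          using that pos by (intro mult_right_mono) auto
        then show ?thesis using N by (simp add: u_def)
      qed
      then have "\<forall>\<^sub>F n in sequentially. g \<omega> * u n (torus_embed \<omega>) = g \<omega> * indicator K \<omega>"
        using False unfolding eventually_sequentially by (intro exI[of _ N]) simp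
      then show ?thesis by (rule tendsto_eventually)
    qed
    then show "AE \<omega> in torus_measure. (\<lambda>n. g \<omega> * u n (torus_embed \<omega>)) \<longlonglongrightarrow> g \<omega> * indicator K \<omega>"
      by (intro AE_I2) simp
    fix n
    have "\<bar>u n z\<bar> \<le> 1" for z by (simp add: u_def infdist_nonneg)
    then show "AE \<omega> in torus_measure. norm (g \<omega> * u n (torus_embed \<omega>)) \<le> \<bar>g \<omega>\<bar>"
      by (intro AE_I2) (simp add: abs_mult mult_left_le)
  qed
  then show ?thesis
    by (rule LIMSEQ_le_const) (use integral_nonneg_continuous[OF g pos ucont upos] in auto)
qed simp

text \<open>If \<open>g\<close> were negative on a set of positive measure, it would be so on a compact subset of positive
  measure, over which its integral would be negative.\<close>

lemma AE_nonneg_of_trig_poly: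
  fixes g :: "real ^ 'd \<Rightarrow> real"
  assumes g: "integrable torus_measure g"
    and pos: "\<And>p. trig_poly p \<Longrightarrow> 0 \<le> (LINT \<omega>|torus_measure. g \<omega> * (cmod (p \<omega>))\<^sup>2)"
  shows "AE \<omega> in torus_measure. 0 \<le> g \<omega>"
proof (rule ccontr)
  assume not: "\<not> (AE \<omega> in torus_measure. 0 \<le> g \<omega>)"
  have gm: "g \<in> borel_measurable torus_measure" using g by auto
  define N where "N = {\<omega> \<in> space torus_measure. g \<omega> < 0}"
  have N: "N \<in> sets torus_measure" unfolding N_def using gm by measurable
  then have Nb: "N \<in> sets borel" "N \<subseteq> torus"
    by (auto simp: sets_restrict_space N_def)
  have Neq: "emeasure torus_measure A = emeasure lborel A" if "A \<subseteq> torus" "A \<in> sets borel" for A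
    using that by (intro emeasure_restrict_space) auto
  have "emeasure torus_measure N \<noteq> 0"
  proof
    assume "emeasure torus_measure N = 0"
    then have "AE \<omega> in torus_measure. \<omega> \<notin> N" using N by (intro AE_not_in) auto
    then have "AE \<omega> in torus_measure. 0 \<le> g \<omega>"
      using AE_space[of torus_measure] by eventually_elim (auto simp: N_def)
    with not show False by simp
  qed
  then have N0: "emeasure lborel N \<noteq> 0" using Neq[OF Nb(2,1)] by simp
  have Nfin: "emeasure lborel N < \<infinity>"
    using emeasure_bounded_finite[OF bounded_subset[OF bounded_torus Nb(2)]] .
  define e where "e = measure lborel N"
  have e: "emeasure lborel N = ennreal e"
    using Nfin unfolding e_def by (intro emeasure_eq_ennreal_measure) simp
  moreover have "e \<noteq> 0" using N0 e by auto
  ultimately have e: "emeasure lborel N = ennreal e" "0 < e"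
    by (simp_all add: e_def less_le)
  have "N \<in> sets lebesgue" using Nb(1) by (simp add: sets_completionI_sets)
  then obtain K where K: "closed K" "K \<subseteq> N" "emeasure lebesgue (N - K) < ennreal e"
    using e(2) by (rule sets_lebesgue_inner_closed)
  have cK: "compact K" 
    using K(1) bounded_subset[OF bounded_torus order.trans[OF K(2) Nb(2)]] by (simp add: compact_eq_bounded_closed)
  then have Kb: "K \<in> sets borel" by (rule borel_compact)
  have K0: "emeasure lborel K \<noteq> 0"
  proof
    assume "emeasure lborel K = 0"
    then have "emeasure lborel (N - K) = emeasure lborel N"
      using Nb(1) Kb by (intro emeasure_Diff_null_set) auto
    then show False using K(3) e Nb(1) Kb by simp
  qed
  have "0 \<le> (LINT \<omega>|torus_measure. g \<omega> * indicator K \<omega>)"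
    by (rule integral_nonneg_compact[OF g pos cK]) (use K(2) Nb(2) in auto)
  moreover have int: "integrable torus_measure (\<lambda>\<omega>. - (g \<omega> * indicator K \<omega>))"
    by (intro integrable_minus integrable_real_mult_indicator g)
      (use K(2) Nb(2) Kb in \<open>auto simp: sets_restrict_space\<close>)
  have nn: "AE \<omega> in torus_measure. 0 \<le> - (g \<omega> * indicator K \<omega>)"
    by (rule AE_I2) (use K(2) in \<open>auto simp: N_def split: split_indicator intro: less_imp_le\<close>)
  from integral_nonneg_AE[OF nn] have "0 \<le> (LINT \<omega>|torus_measure. - (g \<omega> * indicator K \<omega>))" .
  ultimately have "(LINT \<omega>|torus_measure. - (g \<omega> * indicator K \<omega>)) = 0" by simp
  then have "AE \<omega> in torus_measure. - (g \<omega> * indicator K \<omega>) = 0"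
    using integral_nonneg_eq_0_iff_AE[OF int nn] by simp
  then have "AE \<omega> in torus_measure. \<omega> \<notin> K"
    by eventually_elim (use K(2) in \<open>auto simp: N_def\<close>)
  then have "emeasure torus_measure K = 0"
    using K(2) Nb(2) Kb by (subst (asm) AE_iff_measurable[of K]) (auto simp: sets_restrict_space)
  then show False using K0 Neq[of K] K(2) Nb(2) Kb by auto
qed

lemma exp_period_integral:
  fixes m :: int
  shows "integrable lborel (\<lambda>x. complex_of_real (indicator {-1/2..<1/2} x) * exp (- 2 * complex_of_real pi * \<i> * complex_of_real (real_of_int m * x)))"
    and "(LINT x|lborel. complex_of_real (indicator {-1/2..<1/2} x) * exp (- 2 * complex_of_real pi * \<i> * complex_of_real (real_of_int m * x)))
      = (if m = 0 then 1 else 0)"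
proof -
  let ?e = "\<lambda>x. exp (- 2 * complex_of_real pi * \<i> * complex_of_real (real_of_int m * x))"
  show "integrable lborel (\<lambda>x. complex_of_real (indicator {-1/2..<1/2} x) * ?e x)"
  proof (rule Bochner_Integration.integrable_bound)
    show "integrable lborel (indicator {-1/2..<1/2} :: real \<Rightarrow> real)" by simp
  qed (auto simp: norm_mult split: split_indicator)
  have "(LINT x|lborel. complex_of_real (indicator {-1/2..<1/2} x) * ?e x) =
      (LINT x|lborel. indicator {-1/2..1/2} x *\<^sub>R ?e x)"
  proof (rule integral_cong_AE)
    show "AE x in lborel. complex_of_real (indicator {-1/2..<1/2} x) * ?e x = indicator {-1/2..1/2} x *\<^sub>R ?e x"
      using AE_lborel_singleton[of "1/2::real"]
      by eventually_elim (auto simp: scaleR_conv_of_real split: split_indicator)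
  qed measurable
  also have "\<dots> = (if m = 0 then 1 else 0)"
  proof (cases "m = 0")
    case True
    then show ?thesis by simp
  next
    case False
    define a where "a = - 2 * complex_of_real pi * \<i> * complex_of_real (real_of_int m)"
    have a: "a \<noteq> 0" using False by (simp add: a_def)
    have ea: "?e x = exp (a * complex_of_real x)" for x by (simp add: a_def mult_ac)
    have "(LINT x|lborel. indicator {-1/2..1/2} x *\<^sub>R exp (a * complex_of_real x)) =
        exp (a * complex_of_real (1/2)) / a - exp (a * complex_of_real (-1/2)) / a"
    proof (rule integral_FTC_Icc)
      fix x :: real
      have "((\<lambda>z. exp (a * z) / a) has_field_derivative exp (a * complex_of_real x)) (at (complex_of_real x))"
        using a by (auto intro!: derivative_eq_intros)
      from has_vector_derivative_real_field[OF this]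
      show "((\<lambda>x. exp (a * complex_of_real x) / a) has_vector_derivative exp (a * complex_of_real x)) (at x within {-1/2..1/2})"
        by (rule has_vector_derivative_at_within)
    qed (auto intro!: continuous_intros)
    also have "exp (a * complex_of_real (1/2)) = exp (a * complex_of_real (-1/2)) * exp a"
      by (simp add: exp_add[symmetric] field_simps)
    also have "exp a = 1"
    proof -
      have "a = (2 * of_int (- m) * pi) * \<i>" by (simp add: a_def mult_ac)
      then show ?thesis by (simp only: exp_integer_2pi Ints_of_int)
    qed
    finally show ?thesis using False by (simp only: ea if_False) simp
  qed
  finally show "(LINT x|lborel. complex_of_real (indicator {-1/2..<1/2} x) * ?e x) = (if m = 0 then 1 else 0)" .
qed

text \<open>The integrand is a product over the coordinates; a nonzero frequency has a nonzero coordinate,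
  whose factor integrates to \<open>0\<close> over a full period.\<close>

lemma integral_wave_torus:
  "(LINT \<omega>|torus_measure. wave \<omega> (int_vec (m :: int ^ 'd))) = (if m = 0 then 1 else 0)"
proof -
  let ?f = "\<lambda>b x. complex_of_real (indicator {-1/2..<1/2} x) *
    exp (- 2 * complex_of_real pi * \<i> * complex_of_real ((int_vec m \<bullet> b) * x))"
  have Bs: "(Basis :: (real ^ 'd) set) = (\<lambda>i. axis i 1) ` UNIV" by (auto simp: Basis_vec_def)
  have inj: "inj (\<lambda>i. axis i 1 :: real ^ 'd)" by (rule injI) (simp add: axis_eq_axis)
  have mb: "int_vec m \<bullet> axis i 1 = real_of_int (m $ i)" for i by (simp add: inner_axis int_vec_def)
  have eq: "indicator torus \<omega> *\<^sub>R wave \<omega> (int_vec m) = (\<Prod>b\<in>Basis. ?f b (\<omega> \<bullet> b))" for \<omega> :: "real ^ 'd"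
  proof -
    have "indicator torus \<omega> = (\<Prod>b\<in>Basis. indicator {-1/2..<1/2} (\<omega> \<bullet> b) :: real)"
    proof -
      have "indicator torus \<omega> = (if \<forall>i. \<omega> $ i \<in> {-1/2..<1/2} then 1 else 0 :: real)"
        by (auto simp: torus_def indicator_def)
      also have "\<dots> = (\<Prod>i\<in>UNIV. indicator {-1/2..<1/2} (\<omega> $ i))"
        by (auto simp: prod_zero_iff indicator_def)
      also have "\<dots> = (\<Prod>b\<in>Basis. indicator {-1/2..<1/2} (\<omega> \<bullet> b))"
        unfolding Bs by (subst prod.reindex[OF inj]) (simp add: inner_axis)
      finally show ?thesis .
    qed
    moreover have "wave \<omega> (int_vec m) =
        (\<Prod>b\<in>Basis. exp (- 2 * complex_of_real pi * \<i> * complex_of_real ((int_vec m \<bullet> b) * (\<omega> \<bullet> b))))"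
      unfolding wave_def euclidean_inner[of "int_vec m" \<omega>]
      by (simp add: exp_sum[symmetric] sum_distrib_left sum_negf)
    ultimately show ?thesis by (simp add: prod.distrib scaleR_conv_of_real)
  qed
  have int1: "integrable lborel (?f b)" if "b \<in> Basis" for b
    using that exp_period_integral(1) unfolding Bs by (auto simp: mb)
  have "(LINT \<omega>|torus_measure. wave \<omega> (int_vec m)) = (LINT \<omega>|lborel. indicator torus \<omega> *\<^sub>R wave \<omega> (int_vec m))"
    by (rule integral_restrict_space) auto
  also have "\<dots> = (\<Prod>b\<in>Basis. LINT x|lborel. ?f b x)"
    unfolding eq by (rule lborel_integral_prod(2)[OF int1])
  also have "\<dots> = (\<Prod>i\<in>UNIV. if m $ i = 0 then 1 else 0)"
    unfolding Bs by (subst prod.reindex[OF inj]) (simp only: o_def mb exp_period_integral(2))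
  also have "\<dots> = (if m = 0 then 1 else 0)"
    by (auto simp: vec_eq_iff prod_zero_iff)
  finally show ?thesis .
qed

lemma finite_measure_torus: "finite_measure torus_measure"
proof (rule finite_measureI)
  have "emeasure lborel torus < \<infinity>" by (rule emeasure_bounded_finite[OF bounded_torus])
  then show "emeasure torus_measure (space torus_measure) \<noteq> \<infinity>"
    by (simp add: emeasure_restrict_space less_top)
qed

lemma integrable_torus_bounded:
  fixes f :: "real ^ 'd \<Rightarrow> 'b :: {banach, second_countable_topology}"
  assumes "f \<in> borel_measurable borel" "\<And>\<omega>. norm (f \<omega>) \<le> B"
  shows "integrable torus_measure f"
proof -
  interpret finite_measure torus_measure by (rule finite_measure_torus)
  show ?thesis using assms by (intro integrable_const_bound[of _ B]) (auto simp: measurable_restrict_space1)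
qed

lemma integral_trig_square:
  assumes "finite F"
  shows "(LINT \<omega>|torus_measure. (cmod (\<Sum>k\<in>F. c k * wave \<omega> (int_vec k)))\<^sup>2) = (\<Sum>k\<in>F. (cmod (c k))\<^sup>2)"
proof -
  have int: "integrable torus_measure (\<lambda>\<omega>. c k * cnj (c l) * wave \<omega> (int_vec (k - l)))" for k l
    by (rule integrable_torus_bounded[where B = "cmod (c k * cnj (c l))"]) (simp_all add: norm_mult)
  have eq: "complex_of_real ((cmod (\<Sum>k\<in>F. c k * wave \<omega> (int_vec k)))\<^sup>2) =
      (\<Sum>k\<in>F. \<Sum>l\<in>F. c k * cnj (c l) * wave \<omega> (int_vec (k - l)))" for \<omega>
    unfolding complex_norm_square cnj_sum sum_product
    by (intro sum.cong refl) (simp add: int_vec_diff wave_diff mult_ac)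
  have "complex_of_real (LINT \<omega>|torus_measure. (cmod (\<Sum>k\<in>F. c k * wave \<omega> (int_vec k)))\<^sup>2) =
      (\<Sum>k\<in>F. \<Sum>l\<in>F. c k * cnj (c l) * (LINT \<omega>|torus_measure. wave \<omega> (int_vec (k - l))))"
    unfolding integral_complex_of_real[symmetric] eq
    by (simp add: int Bochner_Integration.integral_sum)
  also have "\<dots> = (\<Sum>k\<in>F. \<Sum>l\<in>F. if k = l then c k * cnj (c l) else 0)"
    unfolding integral_wave_torus by (intro sum.cong) auto
  also have "\<dots> = complex_of_real (\<Sum>k\<in>F. (cmod (c k))\<^sup>2)"
    using assms by (simp add: complex_norm_square del: of_real_power)
  finally show ?thesis by (simp only: of_real_eq_iff)
qed

section \<open>Fibers\<close>

lemma measurable_lattice_sum_arg: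
  assumes [measurable]: "g \<in> borel_measurable borel"
  shows "(\<lambda>(\<omega>, k). g (\<omega> + int_vec k)) \<in> borel_measurable (borel \<Otimes>\<^sub>M count_space (UNIV :: (int ^ 'd) set))"
  unfolding case_prod_beta
  by (rule measurable_compose_countable'[where f = "\<lambda>k p. g (fst p + int_vec k)" and g = snd and I = UNIV]) auto

lemma sigma_finite_count_space_int_vec: "sigma_finite_measure (count_space (UNIV :: (int ^ 'd) set))"
  by (rule sigma_finite_measure_count_space_countable) simp

text \<open>The squared norm of the fiber, with the value \<open>\<infinity>\<close> where the fiber is not square summable.\<close>

definition fiber_energy :: "(real ^ 'd) L2 \<Rightarrow> real ^ 'd \<Rightarrow> ennreal" where
  "fiber_energy f \<omega> = (\<integral>\<^sup>+k. ennreal ((cmod (rep_L2 (fourier f) (\<omega> + int_vec k)))\<^sup>2) \<partial>count_space UNIV)"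

lemma measurable_fiber_energy [measurable]: "fiber_energy f \<in> borel_measurable borel"
proof -
  interpret sigma_finite_measure "count_space (UNIV :: (int ^ 'a) set)"
    by (rule sigma_finite_count_space_int_vec)
  have "(\<lambda>(\<omega>, k). ennreal ((cmod (rep_L2 (fourier f) (\<omega> + int_vec k)))\<^sup>2))
      \<in> borel_measurable (borel \<Otimes>\<^sub>M count_space UNIV)"
    by (rule measurable_lattice_sum_arg[where g = "\<lambda>x. ennreal ((cmod (rep_L2 (fourier f) x))\<^sup>2)"]) measurable
  from borel_measurable_nn_integral[OF this] show ?thesis
    by (simp add: fiber_energy_def[abs_def])
qed

lemma nn_integral_fiber_energy: "(\<integral>\<^sup>+\<omega>. fiber_energy f \<omega> \<partial>torus_measure) = ennreal ((norm f)\<^sup>2)"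
  unfolding fiber_energy_def
  by (subst nn_integral_torus_tiling[where f = "\<lambda>x. ennreal ((cmod (rep_L2 (fourier f) x))\<^sup>2)"])
    (simp_all add: ennreal_norm_L2[symmetric] norm_fourier)

lemma summable_on_iff_nn_integral_finite:
  fixes r :: "'i \<Rightarrow> real"
  assumes nn: "\<And>k. 0 \<le> r k"
  shows "r summable_on UNIV \<longleftrightarrow> (\<integral>\<^sup>+k. ennreal (r k) \<partial>count_space UNIV) < \<infinity>"
    and "r summable_on UNIV \<Longrightarrow> (\<integral>\<^sup>+k. ennreal (r k) \<partial>count_space UNIV) = ennreal (infsum r UNIV)"
proof -
  have abs: "r summable_on UNIV \<longleftrightarrow> Infinite_Set_Sum.abs_summable_on r UNIV"
    using summable_on_iff_abs_summable_on_real[of r UNIV] abs_summable_equivalent[of r UNIV] by simp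
  show "r summable_on UNIV \<longleftrightarrow> (\<integral>\<^sup>+k. ennreal (r k) \<partial>count_space UNIV) < \<infinity>"
    unfolding abs abs_summable_on_def integrable_iff_bounded using nn by simp
  assume "r summable_on UNIV"
  then show "(\<integral>\<^sup>+k. ennreal (r k) \<partial>count_space UNIV) = ennreal (infsum r UNIV)"
    using nn_integral_conv_infsetsum[of r UNIV] nn abs infsetsum_infsum[of r UNIV] by simp
qed

lemma square_summable_fiber_iff:
  "square_summable (\<lambda>k. rep_L2 (fourier f) (\<omega> + int_vec k)) \<longleftrightarrow> fiber_energy f \<omega> < \<infinity>"
  unfolding square_summable_def fiber_energy_def
  by (rule summable_on_iff_nn_integral_finite(1)) simp

lemma Rep_fiber:
  "Rep_ell2 (fiber f \<omega>) k = (if fiber_energy f \<omega> < \<infinity> then rep_L2 (fourier f) (\<omega> + int_vec k) else 0)"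
  by (simp add: fiber_def Let_def square_summable_fiber_iff zero_ell2.rep_eq Abs_ell2_inverse)

lemma measurable_Rep_fiber [measurable]: "(\<lambda>\<omega>. Rep_ell2 (fiber f \<omega>) k) \<in> borel_measurable borel"
  unfolding Rep_fiber by measurable

lemma norm_ell2_square: "(norm x)\<^sup>2 = (\<Sum>\<^sub>\<infinity>k. (cmod (Rep_ell2 x k))\<^sup>2)"
proof -
  have sq: "square_summable (Rep_ell2 x)" using Rep_ell2[of x] by simp
  have "(norm x)\<^sup>2 = Re (\<Sum>\<^sub>\<infinity>k. Rep_ell2 x k * cnj (Rep_ell2 x k))"
    by (simp add: power2_norm_eq_inner inner_ell2_def cinner_ell2.rep_eq)
  also have "\<dots> = (\<Sum>\<^sub>\<infinity>k. Re (Rep_ell2 x k * cnj (Rep_ell2 x k)))"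
    by (rule infsum_Re[OF summable_on_mult_cnj[OF sq sq], symmetric])
  also have "\<dots> = (\<Sum>\<^sub>\<infinity>k. (cmod (Rep_ell2 x k))\<^sup>2)"
    by (simp only: complex_norm_square[symmetric] Re_complex_of_real)
  finally show ?thesis .
qed

lemma ennreal_norm_fiber:
  assumes "fiber_energy f \<omega> < \<infinity>"
  shows "ennreal ((norm (fiber f \<omega>))\<^sup>2) = fiber_energy f \<omega>"
proof -
  have "(\<lambda>k. (cmod (rep_L2 (fourier f) (\<omega> + int_vec k)))\<^sup>2) summable_on UNIV"
    using assms unfolding square_summable_fiber_iff[symmetric] square_summable_def .
  from summable_on_iff_nn_integral_finite(2)[OF _ this] show ?thesis
    using assms unfolding norm_ell2_square fiber_energy_def Rep_fiber by simp
qed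

lemma AE_fiber_energy_finite: "AE \<omega> in torus_measure. fiber_energy f \<omega> < \<infinity>"
proof -
  have "AE \<omega> in torus_measure. fiber_energy f \<omega> \<noteq> \<infinity>"
    by (rule nn_integral_PInf_AE) (auto simp: nn_integral_fiber_energy intro: measurable_restrict_space1)
  then show ?thesis by (simp add: less_top)
qed

lemma AE_Rep_fiber:
  "AE \<omega> in torus_measure. \<forall>k. Rep_ell2 (fiber f \<omega>) k = rep_L2 (fourier f) (\<omega> + int_vec k)"
  using AE_fiber_energy_finite[of f] by eventually_elim (simp add: Rep_fiber)

lemma ell2_eqI: "(\<And>k. Rep_ell2 x k = Rep_ell2 y k) \<Longrightarrow> x = y"
  by (auto simp: Rep_ell2_inject[symmetric])

lemma fiber_add: "AE \<omega> in torus_measure. fiber (f + g) \<omega> = fiber f \<omega> + fiber g \<omega>"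
  using AE_Rep_fiber[of f] AE_Rep_fiber[of g] AE_Rep_fiber[of "f + g"]
    AE_torus_shifts[OF rep_L2_add[of "fourier f" "fourier g"]]
  by eventually_elim (auto intro!: ell2_eqI simp: plus_ell2.rep_eq fourier_add)

lemma fiber_scaleC: "AE \<omega> in torus_measure. fiber (c *\<^sub>C f) \<omega> = c *\<^sub>C fiber f \<omega>"
  using AE_Rep_fiber[of f] AE_Rep_fiber[of "c *\<^sub>C f"]
    AE_torus_shifts[OF rep_L2_scaleC[of c "fourier f"]]
  by eventually_elim (auto intro!: ell2_eqI simp: scaleC_ell2.rep_eq fourier_scaleC)

text \<open>The integer frequencies are invisible to integer translations.\<close>

lemma wave_int_vec: "wave (int_vec l) (int_vec k) = 1"
proof -
  have "int_vec k \<bullet> int_vec l = real_of_int (\<Sum>i\<in>UNIV. k $ i * l $ i)"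
    by (simp add: int_vec_def inner_vec_def)
  then have "wave (int_vec l) (int_vec k) = exp (2 * of_int (- (\<Sum>i\<in>UNIV. k $ i * l $ i)) * pi * \<i>)"
    by (simp add: wave_def mult_ac)
  then show ?thesis by (simp only: exp_integer_2pi Ints_of_int)
qed

lemma fiber_translate:
  "AE \<omega> in torus_measure. fiber (translate k f) \<omega> = wave \<omega> (int_vec k) *\<^sub>C fiber f \<omega>"
  using AE_Rep_fiber[of f] AE_Rep_fiber[of "translate k f"]
    AE_torus_shifts[OF fourier_shift[of "int_vec k" f]]
  by eventually_elim
    (auto intro!: ell2_eqI simp: scaleC_ell2.rep_eq translate_eq_shift wave_add_left wave_int_vec)

lemma fiber_zero: "AE \<omega> in torus_measure. fiber 0 \<omega> = 0"
  using fiber_scaleC[of 0 0] by simp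

lemma fiber_sum_scaleC:
  assumes "finite F"
  shows "AE \<omega> in torus_measure. fiber (\<Sum>i\<in>F. c i *\<^sub>C f i) \<omega> = (\<Sum>i\<in>F. c i *\<^sub>C fiber (f i) \<omega>)"
  using assms
proof (induction F)
  case empty
  then show ?case using fiber_zero by simp
next
  case (insert i F)
  show ?case
    using insert.IH fiber_add[of "c i *\<^sub>C f i" "\<Sum>i\<in>F. c i *\<^sub>C f i"] fiber_scaleC[of "c i" "f i"]
    by eventually_elim (simp add: insert.hyps)
qed

text \<open>The series of the inner product is an integral for the counting measure, and integrals of
  jointly measurable functions depend measurably on parameters.\<close>

lemma measurable_cinner_fiber [measurable]:
  "(\<lambda>\<omega>. cinner (fiber f \<omega>) (fiber g \<omega>)) \<in> borel_measurable borel"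
proof -
  interpret sigma_finite_measure "count_space (UNIV :: (int ^ 'a) set)"
    by (rule sigma_finite_count_space_int_vec)
  have "cinner x y = (LINT k|count_space UNIV. Rep_ell2 x k * cnj (Rep_ell2 y k))" for x y :: "(int ^ 'a) ell2"
  proof -
    have "square_summable (Rep_ell2 x)" "square_summable (Rep_ell2 y)"
      using Rep_ell2[of x] Rep_ell2[of y] by auto
    then have "(\<lambda>k. (cmod (Rep_ell2 x k))\<^sup>2 + (cmod (Rep_ell2 y k))\<^sup>2) summable_on UNIV"
      unfolding square_summable_def by (rule summable_on_add)
    then have "(\<lambda>k. cmod (Rep_ell2 x k * cnj (Rep_ell2 y k))) summable_on UNIV"
      by (rule summable_on_comparison_test) (use cmod_mult_cnj_le in auto)
    then have "Infinite_Set_Sum.abs_summable_on (\<lambda>k. Rep_ell2 x k * cnj (Rep_ell2 y k)) UNIV"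
      by (simp only: abs_summable_equivalent)
    from infsetsum_infsum[OF this] show ?thesis
      by (simp add: cinner_ell2.rep_eq infsetsum_def)
  qed
  moreover have "(\<lambda>(\<omega>, k). Rep_ell2 (fiber f \<omega>) k * cnj (Rep_ell2 (fiber g \<omega>) k))
      \<in> borel_measurable (borel \<Otimes>\<^sub>M count_space UNIV)"
    unfolding case_prod_beta
    by (rule measurable_compose_countable'[where
          f = "\<lambda>k p. Rep_ell2 (fiber f (fst p)) k * cnj (Rep_ell2 (fiber g (fst p)) k)" and g = snd and I = UNIV])
      auto
  from borel_measurable_lebesgue_integral[OF this]
  have "(\<lambda>\<omega>. LINT k|count_space UNIV. Rep_ell2 (fiber f \<omega>) k * cnj (Rep_ell2 (fiber g \<omega>) k)) \<in> borel_measurable borel"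
    by simp
  ultimately show ?thesis by simp
qed

lemma measurable_inner_fiber [measurable]:
  "(\<lambda>\<omega>. inner (fiber f \<omega>) (fiber g \<omega>)) \<in> borel_measurable borel"
  unfolding inner_eq_Re_cinner by measurable

lemma measurable_norm_fiber [measurable]: "(\<lambda>\<omega>. norm (fiber f \<omega>)) \<in> borel_measurable borel"
  unfolding norm_eq_sqrt_inner by measurable

text \<open>The integer translates of the torus tile the space and the Fourier transform is isometric, so
  fiberization is isometric.\<close>

lemma nn_integral_norm_fiber:
  "(\<integral>\<^sup>+\<omega>. ennreal ((norm (fiber f \<omega>))\<^sup>2) \<partial>torus_measure) = ennreal ((norm f)\<^sup>2)"
  unfolding nn_integral_fiber_energy[symmetric]
  by (rule nn_integral_cong_AE)
    (use AE_fiber_energy_finite[of f] in eventually_elim, rule ennreal_norm_fiber)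

lemma integral_norm_fiber:
  shows "integrable torus_measure (\<lambda>\<omega>. (norm (fiber f \<omega>))\<^sup>2)"
    and "(LINT \<omega>|torus_measure. (norm (fiber f \<omega>))\<^sup>2) = (norm f)\<^sup>2"
proof -
  have m: "(\<lambda>\<omega>. (norm (fiber f \<omega>))\<^sup>2) \<in> borel_measurable torus_measure"
    by (rule measurable_torus_measure) measurable
  show int: "integrable torus_measure (\<lambda>\<omega>. (norm (fiber f \<omega>))\<^sup>2)"
    by (rule integrableI_bounded[OF m]) (simp add: nn_integral_norm_fiber)
  show "(LINT \<omega>|torus_measure. (norm (fiber f \<omega>))\<^sup>2) = (norm f)\<^sup>2"
    using nn_integral_eq_integral[OF int] by (simp add: nn_integral_norm_fiber)
qed

text \<open>Polarization of the isometry.\<close>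

lemma integral_inner_fiber:
  shows "integrable torus_measure (\<lambda>\<omega>. inner (fiber f \<omega>) (fiber g \<omega>))"
    and "(LINT \<omega>|torus_measure. inner (fiber f \<omega>) (fiber g \<omega>)) = inner f g"
proof -
  have i: "inner x y = ((norm (x + y))\<^sup>2 - (norm x)\<^sup>2 - (norm y)\<^sup>2) / 2" for x y :: "'b::real_inner"
    by (simp add: power2_norm_eq_inner inner_add_left inner_add_right inner_commute)
  let ?N = "\<lambda>\<omega>. ((norm (fiber (f + g) \<omega>))\<^sup>2 - (norm (fiber f \<omega>))\<^sup>2 - (norm (fiber g \<omega>))\<^sup>2) / 2"
  have N: "integrable torus_measure ?N" "(LINT \<omega>|torus_measure. ?N \<omega>) = inner f g"
    by (simp_all only: i[of f g] integral_divide_zero Bochner_Integration.integral_diff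
        Bochner_Integration.integrable_diff integral_norm_fiber integrable_divide)
  have m: "(\<lambda>\<omega>. inner (fiber f \<omega>) (fiber g \<omega>)) \<in> borel_measurable torus_measure"
    by (rule measurable_torus_measure) measurable
  have ae: "AE \<omega> in torus_measure. ?N \<omega> = inner (fiber f \<omega>) (fiber g \<omega>)"
    using fiber_add[of f g] by eventually_elim (simp only: i)
  show "integrable torus_measure (\<lambda>\<omega>. inner (fiber f \<omega>) (fiber g \<omega>))"
    using integrable_cong_AE[OF borel_measurable_integrable[OF N(1)] m ae] N(1) by simp
  show "(LINT \<omega>|torus_measure. inner (fiber f \<omega>) (fiber g \<omega>)) = inner f g"
    using integral_cong_AE[OF borel_measurable_integrable[OF N(1)] m ae] N(2) by simp
qed

lemma L2_eq_0_if_fiber_0: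
  fixes f :: "(real ^ 'd) L2"
  assumes "AE \<omega> in torus_measure. fiber f \<omega> = 0"
  shows "f = 0"
proof -
  have "(norm f)\<^sup>2 = (LINT \<omega>|(torus_measure :: (real ^ 'd) measure). 0)"
    unfolding integral_norm_fiber(2)[symmetric]
  proof (rule integral_cong_AE)
    show "(\<lambda>\<omega>. (norm (fiber f \<omega>))\<^sup>2) \<in> borel_measurable torus_measure"
      by (rule measurable_torus_measure) measurable
    show "AE \<omega> in torus_measure. (norm (fiber f \<omega>))\<^sup>2 = 0"
      using assms by eventually_elim simp
  qed simp
  then show ?thesis by simp
qed

text \<open>Fibers of an \<open>L\<^sup>2\<close>-convergent sequence converge almost everywhere along a
  subsequence, so the fibers of the limit lie in the closed span of the fibers of the generators.\<close>

lemma fiber_in_closure_cspan: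
  assumes f: "f \<in> closure (cspan {translate k \<phi> | k \<phi>. \<phi> \<in> \<Phi>})" and cnt: "countable \<Phi>"
  shows "AE \<omega> in torus_measure. fiber f \<omega> \<in> closure (cspan ((\<lambda>\<phi>. fiber \<phi> \<omega>) ` \<Phi>))"
proof -
  let ?G = "{translate k \<phi> | k \<phi>. \<phi> \<in> \<Phi>}"
  have G: "?G = (\<lambda>(k, \<phi>). translate k \<phi>) ` (UNIV \<times> \<Phi>)" by auto
  \<comment> \<open>Translating a generator multiplies its fiber by a number and does not leave the span.\<close>
  have in_span: "AE \<omega> in torus_measure. fiber g \<omega> \<in> cspan ((\<lambda>\<phi>. fiber \<phi> \<omega>) ` \<Phi>)" if "g \<in> cspan ?G" for g
    using that unfolding G
  proof (rule cspan_image_sumE)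
    fix F c assume F: "finite F" "F \<subseteq> UNIV \<times> \<Phi>" and g: "g = (\<Sum>i\<in>F. c i *\<^sub>C (case i of (k, \<phi>) \<Rightarrow> translate k \<phi>))"
    have "AE \<omega> in torus_measure. \<forall>i\<in>F. fiber (case i of (k, \<phi>) \<Rightarrow> translate k \<phi>) \<omega> =
        wave \<omega> (int_vec (fst i)) *\<^sub>C fiber (snd i) \<omega>"
      using F(1) fiber_translate by (subst AE_finite_all) (auto simp: case_prod_beta)
    with fiber_sum_scaleC[OF F(1), of c "\<lambda>i. case i of (k, \<phi>) \<Rightarrow> translate k \<phi>"]
    show ?thesis
    proof eventually_elim
      case (elim \<omega>)
      have "(\<Sum>i\<in>F. c i *\<^sub>C fiber (case i of (k, \<phi>) \<Rightarrow> translate k \<phi>) \<omega>) \<in> cspan ((\<lambda>\<phi>. fiber \<phi> \<omega>) ` \<Phi>)"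
      proof (rule complex_vector.span_sum)
        fix i assume i: "i \<in> F"
        then have "fiber (snd i) \<omega> \<in> (\<lambda>\<phi>. fiber \<phi> \<omega>) ` \<Phi>" using F(2) by auto
        then show "c i *\<^sub>C fiber (case i of (k, \<phi>) \<Rightarrow> translate k \<phi>) \<omega> \<in> cspan ((\<lambda>\<phi>. fiber \<phi> \<omega>) ` \<Phi>)"
          unfolding bspec[OF elim(2) i]
          by (intro complex_vector.span_scale complex_vector.span_base)
      qed
      then show ?case using elim(1) by (simp only: g)
    qed
  qed
  \<comment> \<open>The rate makes the squared distances summable, so the fibers converge without a further choice of a
    subsequence.\<close>
  have "\<exists>g. g \<in> cspan ?G \<and> norm (f - g) < (1/2)^n" for n :: nat
    using iffD1[OF closure_approachable f, rule_format, of "(1/2)^n"]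
    by (auto simp: dist_norm norm_minus_commute Bex_def)
  then obtain g where g: "\<And>n. g n \<in> cspan ?G" "\<And>n. norm (f - g n) < (1/2)^n"
    using choice[of "\<lambda>n g. g \<in> cspan ?G \<and> norm (f - g) < (1/2)^n"] by blast
  have m: "(\<lambda>\<omega>. ennreal ((norm (fiber (f - g n) \<omega>))\<^sup>2)) \<in> borel_measurable torus_measure" for n
    by (rule measurable_torus_measure) measurable
  have "(\<integral>\<^sup>+\<omega>. (\<Sum>n. ennreal ((norm (fiber (f - g n) \<omega>))\<^sup>2)) \<partial>torus_measure) = (\<Sum>n. ennreal ((norm (f - g n))\<^sup>2))"
    by (subst nn_integral_suminf[OF m]) (simp add: nn_integral_norm_fiber)
  also have "\<dots> \<le> (\<Sum>n. ennreal ((1/4)^n))"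
  proof (intro suminf_le ennreal_leI)
    fix n
    have "(norm (f - g n))\<^sup>2 \<le> ((1/2)^n)\<^sup>2" using g(2)[of n] by (intro power_mono) auto
    also have "\<dots> = (1/4)^n" by (simp add: power2_eq_square power_divide flip: power_mult_distrib)
    finally show "(norm (f - g n))\<^sup>2 \<le> (1/4)^n" .
  qed auto
  also have "\<dots> < \<infinity>"
    by (subst suminf_ennreal2) (auto intro!: summable_geometric)
  finally have "AE \<omega> in torus_measure. (\<Sum>n. ennreal ((norm (fiber (f - g n) \<omega>))\<^sup>2)) \<noteq> \<infinity>"
    using m by (intro nn_integral_PInf_AE) auto
  moreover have "AE \<omega> in torus_measure. \<forall>n. fiber (f - g n) \<omega> = fiber f \<omega> - fiber (g n) \<omega>"
  proof (subst AE_all_countable, intro allI)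
    fix n
    show "AE \<omega> in torus_measure. fiber (f - g n) \<omega> = fiber f \<omega> - fiber (g n) \<omega>"
      using fiber_add[of "f - g n" "g n"] by eventually_elim simp
  qed
  moreover have "AE \<omega> in torus_measure. \<forall>n. fiber (g n) \<omega> \<in> cspan ((\<lambda>\<phi>. fiber \<phi> \<omega>) ` \<Phi>)"
    using in_span[OF g(1)] by (subst AE_all_countable) auto
  ultimately show ?thesis
  proof eventually_elim
    case (elim \<omega>)
    have "summable (\<lambda>n. (norm (fiber (f - g n) \<omega>))\<^sup>2)"
      by (rule summable_suminf_not_top) (use elim(1) in auto)
    then have "(\<lambda>n. sqrt ((norm (fiber (f - g n) \<omega>))\<^sup>2)) \<longlonglongrightarrow> sqrt 0"
      by (intro tendsto_real_sqrt summable_LIMSEQ_zero)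
    then have "(\<lambda>n. norm (fiber (g n) \<omega> - fiber f \<omega>)) \<longlonglongrightarrow> 0"
      using elim(2) by (simp add: norm_minus_commute)
    then have "(\<lambda>n. fiber (g n) \<omega>) \<longlonglongrightarrow> fiber f \<omega>"
      by (simp only: tendsto_norm_zero_iff Lim_null[symmetric])
    then show ?case unfolding closure_sequential using elim(3)
      by (intro exI[of _ "\<lambda>n. fiber (g n) \<omega>"] conjI)
  qed
qed

text \<open>Each of two countable generators lies in \<open>V\<close>, so its fibers lie in the closed span of the fibers
  of the other. Countability gives a common null set.\<close>

lemma range_function_eq:
  assumes gen: "countable_generator V \<Phi>"
  shows "AE \<omega> in torus_measure. range_function V \<omega> = closure (cspan ((\<lambda>\<phi>. fiber \<phi> \<omega>) ` \<Phi>))"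
proof -
  have sub: "AE \<omega> in torus_measure. closure (cspan ((\<lambda>\<phi>. fiber \<phi> \<omega>) ` A)) \<subseteq> closure (cspan ((\<lambda>\<phi>. fiber \<phi> \<omega>) ` B))"
    if A: "countable_generator V A" and B: "countable_generator V B" for A B
  proof -
    have "A \<subseteq> V"
    proof
      fix \<phi> assume "\<phi> \<in> A"
      moreover have "translate 0 \<phi> = \<phi>"
      proof -
        have "translate 0 (abs_L2 (rep_L2 \<phi>)) = abs_L2 (rep_L2 \<phi>)"
          by (simp add: translate.abs_eq L2_rel_rep int_vec_def zero_vec_def[symmetric])
        then show ?thesis by (simp only: abs_rep_L2)
      qed
      moreover have "translate 0 \<phi> \<in> {translate k \<phi> |k \<phi>. \<phi> \<in> A}" using \<open>\<phi> \<in> A\<close> by blast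
      ultimately have "\<phi> \<in> {translate k \<phi> |k \<phi>. \<phi> \<in> A}" by (simp only:)
      then show "\<phi> \<in> V"
        unfolding A[unfolded countable_generator_def, THEN conjunct2]
        by (intro closure_subset[THEN subsetD] complex_vector.span_base)
    qed
    then have "AE \<omega> in torus_measure. \<forall>\<phi>\<in>A. fiber \<phi> \<omega> \<in> closure (cspan ((\<lambda>\<phi>. fiber \<phi> \<omega>) ` B))"
      using A B fiber_in_closure_cspan[of _ B]
      by (subst AE_ball_countable) (auto simp: countable_generator_def)
    then show ?thesis
      by eventually_elim (intro closure_cspan_minimal csubspace_closure, auto)
  qed
  have "countable_generator V (SOME \<Phi>. countable_generator V \<Phi>)"
    using gen by (rule someI)
  from sub[OF this gen] sub[OF gen this] show ?thesis
    by eventually_elim (auto simp: range_function_def)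
qed

section \<open>Riesz sequences of translates and Riesz bounds of fibers\<close>

text \<open>Combinations of translates become, fiber by fiber, combinations of finitely many vectors whose
  coefficients are trigonometric polynomials.\<close>

lemma fiber_sum_translates:
  assumes "finite \<Theta>" "finite F"
  shows "AE \<omega> in torus_measure.
    fiber (\<Sum>i\<in>\<Theta> \<times> F. c i *\<^sub>C (case i of (\<theta>, k) \<Rightarrow> translate k \<theta>)) \<omega> =
    (\<Sum>\<theta>\<in>\<Theta>. (\<Sum>k\<in>F. c (\<theta>, k) * wave \<omega> (int_vec k)) *\<^sub>C fiber \<theta> \<omega>)"
proof -
  have fin: "finite (\<Theta> \<times> F)" using assms by simp
  have "AE \<omega> in torus_measure. \<forall>i\<in>\<Theta> \<times> F. fiber (case i of (\<theta>, k) \<Rightarrow> translate k \<theta>) \<omega> =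
      wave \<omega> (int_vec (snd i)) *\<^sub>C fiber (fst i) \<omega>"
    using fin fiber_translate by (subst AE_finite_all) (auto simp: case_prod_beta)
  with fiber_sum_scaleC[OF fin, of c "\<lambda>i. case i of (\<theta>, k) \<Rightarrow> translate k \<theta>"]
  show ?thesis
  proof eventually_elim
    case (elim \<omega>)
    have "(\<Sum>i\<in>\<Theta> \<times> F. c i *\<^sub>C fiber (case i of (\<theta>, k) \<Rightarrow> translate k \<theta>) \<omega>) =
        (\<Sum>i\<in>\<Theta> \<times> F. (c i * wave \<omega> (int_vec (snd i))) *\<^sub>C fiber (fst i) \<omega>)"
      by (intro sum.cong refl) (simp only: bspec[OF elim(2)] complex_vector.scale_scale)
    also have "\<dots> = (\<Sum>\<theta>\<in>\<Theta>. \<Sum>k\<in>F. (c (\<theta>, k) * wave \<omega> (int_vec k)) *\<^sub>C fiber \<theta> \<omega>)"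
      unfolding sum.cartesian_product by (intro sum.cong refl) auto
    also have "\<dots> = (\<Sum>\<theta>\<in>\<Theta>. (\<Sum>k\<in>F. c (\<theta>, k) * wave \<omega> (int_vec k)) *\<^sub>C fiber \<theta> \<omega>)"
      by (simp only: complex_vector.scale_sum_left)
    finally show ?case using elim(1) by simp
  qed
qed

lemma norm_sum_translates_square:
  assumes "finite \<Theta>" "finite F"
  shows "integrable torus_measure (\<lambda>\<omega>. (norm (\<Sum>\<theta>\<in>\<Theta>. (\<Sum>k\<in>F. c (\<theta>, k) * wave \<omega> (int_vec k)) *\<^sub>C fiber \<theta> \<omega>))\<^sup>2)" (is "integrable _ ?g")
    and "(LINT \<omega>|torus_measure. (norm (\<Sum>\<theta>\<in>\<Theta>. (\<Sum>k\<in>F. c (\<theta>, k) * wave \<omega> (int_vec k)) *\<^sub>C fiber \<theta> \<omega>))\<^sup>2) =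
      (norm (\<Sum>i\<in>\<Theta> \<times> F. c i *\<^sub>C (case i of (\<theta>, k) \<Rightarrow> translate k \<theta>)))\<^sup>2"
proof -
  define h where "h = (\<Sum>i\<in>\<Theta> \<times> F. c i *\<^sub>C (case i of (\<theta>, k) \<Rightarrow> translate k \<theta>))"
  have ae: "AE \<omega> in torus_measure. (norm (fiber h \<omega>))\<^sup>2 = ?g \<omega>"
    using fiber_sum_translates[OF assms, of c] unfolding h_def by eventually_elim simp
  have gm: "?g \<in> borel_measurable torus_measure"
  proof -
    have eq: "?g \<omega> = Re (\<Sum>\<theta>\<in>\<Theta>. \<Sum>\<theta>'\<in>\<Theta>. cnj (\<Sum>k\<in>F. c (\<theta>, k) * wave \<omega> (int_vec k)) *
        ((\<Sum>k\<in>F. c (\<theta>', k) * wave \<omega> (int_vec k)) * cinner (fiber \<theta>' \<omega>) (fiber \<theta> \<omega>)))" for \<omega>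
      unfolding power2_norm_eq_inner inner_eq_Re_cinner cinner_sum_left cinner_scaleC_left
        cinner_sum_right cinner_scaleC_right sum_distrib_left ..
    have "?g \<in> borel_measurable borel" unfolding eq by measurable
    then show ?thesis by (rule measurable_torus_measure)
  qed
  have hm: "(\<lambda>\<omega>. (norm (fiber h \<omega>))\<^sup>2) \<in> borel_measurable torus_measure"
    by (rule measurable_torus_measure) measurable
  show "integrable torus_measure ?g"
    using integrable_cong_AE[OF hm gm ae] integral_norm_fiber(1)[of h] by simp
  show "(LINT \<omega>|torus_measure. ?g \<omega>) = (norm (\<Sum>i\<in>\<Theta> \<times> F. c i *\<^sub>C (case i of (\<theta>, k) \<Rightarrow> translate k \<theta>)))\<^sup>2"
    using integral_cong_AE[OF hm gm ae] integral_norm_fiber(2)[of h] by (simp add: h_def)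
qed

lemma riesz_bounds_square:
  assumes "riesz_bounds a b I x" "finite F" "F \<subseteq> I"
  shows "a\<^sup>2 * (\<Sum>i\<in>F. (cmod (c i))\<^sup>2) \<le> (norm (\<Sum>i\<in>F. c i *\<^sub>C x i))\<^sup>2"
    and "(norm (\<Sum>i\<in>F. c i *\<^sub>C x i))\<^sup>2 \<le> b\<^sup>2 * (\<Sum>i\<in>F. (cmod (c i))\<^sup>2)"
proof -
  have ab: "0 < a" "0 < b" using assms(1) by (simp_all add: riesz_bounds_def)
  have nn: "0 \<le> (\<Sum>i\<in>F. (cmod (c i))\<^sup>2)" by (simp add: sum_nonneg)
  have "a * sqrt (\<Sum>i\<in>F. (cmod (c i))\<^sup>2) \<le> norm (\<Sum>i\<in>F. c i *\<^sub>C x i)"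
    "norm (\<Sum>i\<in>F. c i *\<^sub>C x i) \<le> b * sqrt (\<Sum>i\<in>F. (cmod (c i))\<^sup>2)"
    using assms by (simp_all add: riesz_bounds_def)
  from power_mono[OF this(1), of 2] power_mono[OF this(2), of 2]
  show "a\<^sup>2 * (\<Sum>i\<in>F. (cmod (c i))\<^sup>2) \<le> (norm (\<Sum>i\<in>F. c i *\<^sub>C x i))\<^sup>2"
    "(norm (\<Sum>i\<in>F. c i *\<^sub>C x i))\<^sup>2 \<le> b\<^sup>2 * (\<Sum>i\<in>F. (cmod (c i))\<^sup>2)"
    using ab nn by (simp_all add: power_mult_distrib)
qed

lemma sqrt_bounds_of_squares:
  assumes "a\<^sup>2 * s \<le> (t::real)\<^sup>2" "t\<^sup>2 \<le> b\<^sup>2 * s" "0 < a" "0 < b" "0 \<le> s" "0 \<le> t"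
  shows "a * sqrt s \<le> t" "t \<le> b * sqrt s"
  using assms real_sqrt_le_mono[OF assms(1)] real_sqrt_le_mono[OF assms(2)]
  by (simp_all add: real_sqrt_mult)

text \<open>A coefficient vector multiplied by a trigonometric polynomial gives a combination of
  translates whose fiber is that polynomial times a fixed combination of fibers. Since the
  polynomial is arbitrary, the integrated Riesz inequalities localize.\<close>

lemma AE_fiber_bounds_single:
  fixes c :: "(real ^ 'd) L2 \<Rightarrow> complex"
  assumes rb: "riesz_bounds a b (\<Theta> \<times> UNIV) (\<lambda>(\<theta>, k). translate k \<theta>)" and fin: "finite \<Theta>"
  shows "AE \<omega> in torus_measure.
    a * sqrt (\<Sum>\<theta>\<in>\<Theta>. (cmod (c \<theta>))\<^sup>2) \<le> norm (\<Sum>\<theta>\<in>\<Theta>. c \<theta> *\<^sub>C fiber \<theta> \<omega>) \<and>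
    norm (\<Sum>\<theta>\<in>\<Theta>. c \<theta> *\<^sub>C fiber \<theta> \<omega>) \<le> b * sqrt (\<Sum>\<theta>\<in>\<Theta>. (cmod (c \<theta>))\<^sup>2)"
proof -
  have ab: "0 < a" "0 < b" using rb by (simp_all add: riesz_bounds_def)
  define S where "S = (\<Sum>\<theta>\<in>\<Theta>. (cmod (c \<theta>))\<^sup>2)"
  have S: "0 \<le> S" by (simp add: S_def sum_nonneg)
  define g where "g \<omega> = (norm (\<Sum>\<theta>\<in>\<Theta>. c \<theta> *\<^sub>C fiber \<theta> \<omega>))\<^sup>2" for \<omega>
  have gint: "integrable torus_measure g"
    using norm_sum_translates_square(1)[OF fin, of "{0}" "\<lambda>(\<theta>, k). c \<theta>"]
    by (simp add: g_def[abs_def])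
  have key: "integrable torus_measure (\<lambda>\<omega>. g \<omega> * (cmod (p \<omega>))\<^sup>2) \<and> integrable torus_measure (\<lambda>\<omega>. (cmod (p \<omega>))\<^sup>2) \<and>
      a\<^sup>2 * S * (LINT \<omega>|torus_measure. (cmod (p \<omega>))\<^sup>2) \<le> (LINT \<omega>|torus_measure. g \<omega> * (cmod (p \<omega>))\<^sup>2) \<and>
      (LINT \<omega>|torus_measure. g \<omega> * (cmod (p \<omega>))\<^sup>2) \<le> b\<^sup>2 * S * (LINT \<omega>|torus_measure. (cmod (p \<omega>))\<^sup>2)"
    if p: "trig_poly p" for p
  proof -
    obtain F q where F: "finite F" "p = (\<lambda>\<omega>. \<Sum>k\<in>F. q k * wave \<omega> (int_vec k))"
      using p by (rule trig_polyE)
    define d where "d = (\<lambda>(\<theta>, k). c \<theta> * q k)"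
    have gp: "(norm (\<Sum>\<theta>\<in>\<Theta>. (\<Sum>k\<in>F. d (\<theta>, k) * wave \<omega> (int_vec k)) *\<^sub>C fiber \<theta> \<omega>))\<^sup>2 = g \<omega> * (cmod (p \<omega>))\<^sup>2" for \<omega>
    proof -
      have "(\<Sum>\<theta>\<in>\<Theta>. (\<Sum>k\<in>F. d (\<theta>, k) * wave \<omega> (int_vec k)) *\<^sub>C fiber \<theta> \<omega>) = p \<omega> *\<^sub>C (\<Sum>\<theta>\<in>\<Theta>. c \<theta> *\<^sub>C fiber \<theta> \<omega>)"
        unfolding complex_vector.scale_sum_right complex_vector.scale_scale
        by (intro sum.cong refl arg_cong2[of _ _ _ _ scaleC])
          (simp add: F(2) d_def sum_distrib_left sum_distrib_right mult_ac)
      then show ?thesis by (simp add: norm_scaleC power_mult_distrib g_def)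
    qed
    have Sd: "(\<Sum>i\<in>\<Theta> \<times> F. (cmod (d i))\<^sup>2) = S * (LINT \<omega>|torus_measure. (cmod (p \<omega>))\<^sup>2)"
    proof -
      have "(\<Sum>i\<in>\<Theta> \<times> F. (cmod (d i))\<^sup>2) = (\<Sum>\<theta>\<in>\<Theta>. \<Sum>k\<in>F. (cmod (c \<theta>))\<^sup>2 * (cmod (q k))\<^sup>2)"
        unfolding sum.cartesian_product
        by (intro sum.cong refl) (auto simp: d_def norm_mult power_mult_distrib)
      also have "\<dots> = S * (\<Sum>k\<in>F. (cmod (q k))\<^sup>2)"
        unfolding S_def by (simp only: sum_product)
      finally show ?thesis by (simp only: F(2) integral_trig_square[OF F(1)])
    qed
    have "finite (\<Theta> \<times> F)" "\<Theta> \<times> F \<subseteq> \<Theta> \<times> UNIV" using fin F(1) by auto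
    note R = riesz_bounds_square[OF rb this, of d]
    note N = norm_sum_translates_square[OF fin F(1), of d, unfolded gp]
    obtain B where B: "\<And>\<omega>. cmod (p \<omega>) \<le> B" using trig_poly_bounded[OF p] by blast
    have "integrable torus_measure (\<lambda>\<omega>. (cmod (p \<omega>))\<^sup>2)"
      using trig_poly_measurable[OF p] B
      by (intro integrable_torus_bounded[where B = "B\<^sup>2"]) (auto intro!: power_mono)
    then show ?thesis using R N unfolding Sd by (simp only: mult.assoc simp_thms)
  qed
  interpret finite_measure "torus_measure :: (real ^ 'd) measure" by (rule finite_measure_torus)
  have lower: "AE \<omega> in torus_measure. 0 \<le> g \<omega> - a\<^sup>2 * S"
  proof (rule AE_nonneg_of_trig_poly)
    show "integrable torus_measure (\<lambda>\<omega>. g \<omega> - a\<^sup>2 * S)" using gint by simp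
    fix p :: "real ^ 'd \<Rightarrow> complex" assume "trig_poly p"
    from key[OF this] show "0 \<le> (LINT \<omega>|torus_measure. (g \<omega> - a\<^sup>2 * S) * (cmod (p \<omega>))\<^sup>2)"
      by (simp add: left_diff_distrib)
  qed
  have upper: "AE \<omega> in torus_measure. 0 \<le> b\<^sup>2 * S - g \<omega>"
  proof (rule AE_nonneg_of_trig_poly)
    show "integrable torus_measure (\<lambda>\<omega>. b\<^sup>2 * S - g \<omega>)" using gint by simp
    fix p :: "real ^ 'd \<Rightarrow> complex" assume "trig_poly p"
    from key[OF this] show "0 \<le> (LINT \<omega>|torus_measure. (b\<^sup>2 * S - g \<omega>) * (cmod (p \<omega>))\<^sup>2)"
      by (simp add: left_diff_distrib)
  qed
  from lower upper show ?thesis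
  proof eventually_elim
    case (elim \<omega>)
    then show ?case
      using sqrt_bounds_of_squares[of a S "norm (\<Sum>\<theta>\<in>\<Theta>. c \<theta> *\<^sub>C fiber \<theta> \<omega>)" b] ab S
      unfolding S_def[symmetric] g_def by auto
  qed
qed

text \<open>The exceptional null set depends on the coefficients; a countable dense set of coefficients
  suffices because both sides are continuous in them.\<close>

lemma AE_riesz_bounds_fiber:
  fixes \<Theta> :: "(real ^ 'd) L2 set"
  assumes rb: "riesz_bounds a b (\<Theta> \<times> UNIV) (\<lambda>(\<theta>, k). translate k \<theta>)" and fin: "finite \<Theta>"
  shows "AE \<omega> in torus_measure. riesz_bounds a b \<Theta> (\<lambda>\<theta>. fiber \<theta> \<omega>)"
proof -
  have ab: "0 < a" "0 < b" using rb by (simp_all add: riesz_bounds_def)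
  obtain D :: "complex set" where D: "countable D" "\<And>X. open X \<Longrightarrow> X \<noteq> {} \<Longrightarrow> \<exists>d\<in>D. d \<in> X"
    using countable_dense_setE by (metis (mono_tags, lifting))
  have "countable (Pi\<^sub>E \<Theta> (\<lambda>_. D))" using fin D(1) by (intro countable_PiE) auto
  then have "AE \<omega> in torus_measure. \<forall>c\<in>Pi\<^sub>E \<Theta> (\<lambda>_. D).
      a * sqrt (\<Sum>\<theta>\<in>\<Theta>. (cmod (c \<theta>))\<^sup>2) \<le> norm (\<Sum>\<theta>\<in>\<Theta>. c \<theta> *\<^sub>C fiber \<theta> \<omega>) \<and>
      norm (\<Sum>\<theta>\<in>\<Theta>. c \<theta> *\<^sub>C fiber \<theta> \<omega>) \<le> b * sqrt (\<Sum>\<theta>\<in>\<Theta>. (cmod (c \<theta>))\<^sup>2)"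
    using AE_fiber_bounds_single[OF rb fin] by (subst AE_ball_countable) auto
  then show ?thesis
  proof eventually_elim
    case (elim \<omega>)
    have both: "a * sqrt (\<Sum>\<theta>\<in>\<Theta>. (cmod (c \<theta>))\<^sup>2) \<le> norm (\<Sum>\<theta>\<in>\<Theta>. c \<theta> *\<^sub>C fiber \<theta> \<omega>) \<and>
        norm (\<Sum>\<theta>\<in>\<Theta>. c \<theta> *\<^sub>C fiber \<theta> \<omega>) \<le> b * sqrt (\<Sum>\<theta>\<in>\<Theta>. (cmod (c \<theta>))\<^sup>2)" for c :: "(real ^ 'd) L2 \<Rightarrow> complex"
    proof -
      have "\<exists>d. d \<in> D \<and> dist d z < inverse (real (Suc n))" for z n
        using D(2)[of "ball z (inverse (real (Suc n)))"] by (auto simp: dist_commute)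
      then obtain e where e: "\<And>z n. e z n \<in> D" "\<And>z n. dist (e z n) z < inverse (real (Suc n))"
        by metis
      have lim: "(\<lambda>n. e z n) \<longlonglongrightarrow> z" for z
      proof (rule tendsto_dist_iff[THEN iffD2], rule tendsto_sandwich[OF _ _ tendsto_const LIMSEQ_inverse_real_of_nat])
        show "\<forall>\<^sub>F n in sequentially. 0 \<le> dist (e z n) z" by simp
        show "\<forall>\<^sub>F n in sequentially. dist (e z n) z \<le> inverse (real (Suc n))"
          by (intro always_eventually allI less_imp_le e(2))
      qed
      define r where "r n = restrict (\<lambda>\<theta>. e (c \<theta>) n) \<Theta>" for n
      have r: "r n \<in> Pi\<^sub>E \<Theta> (\<lambda>_. D)" for n by (auto simp: r_def e(1))
      have sq: "(\<Sum>\<theta>\<in>\<Theta>. (cmod (r n \<theta>))\<^sup>2) = (\<Sum>\<theta>\<in>\<Theta>. (cmod (e (c \<theta>) n))\<^sup>2)" for n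
        by (intro sum.cong) (auto simp: r_def)
      have no: "(\<Sum>\<theta>\<in>\<Theta>. r n \<theta> *\<^sub>C fiber \<theta> \<omega>) = (\<Sum>\<theta>\<in>\<Theta>. e (c \<theta>) n *\<^sub>C fiber \<theta> \<omega>)" for n
        by (intro sum.cong) (auto simp: r_def)
      have ln: "(\<lambda>n. norm (\<Sum>\<theta>\<in>\<Theta>. e (c \<theta>) n *\<^sub>C fiber \<theta> \<omega>)) \<longlonglongrightarrow> norm (\<Sum>\<theta>\<in>\<Theta>. c \<theta> *\<^sub>C fiber \<theta> \<omega>)"
        by (intro tendsto_norm tendsto_sum tendsto_scaleC lim tendsto_const)
      have ls: "(\<lambda>n. z * sqrt (\<Sum>\<theta>\<in>\<Theta>. (cmod (e (c \<theta>) n))\<^sup>2)) \<longlonglongrightarrow> z * sqrt (\<Sum>\<theta>\<in>\<Theta>. (cmod (c \<theta>))\<^sup>2)" for z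
        by (intro tendsto_mult tendsto_real_sqrt tendsto_sum tendsto_power tendsto_norm lim tendsto_const)
      have bd: "a * sqrt (\<Sum>\<theta>\<in>\<Theta>. (cmod (e (c \<theta>) n))\<^sup>2) \<le> norm (\<Sum>\<theta>\<in>\<Theta>. e (c \<theta>) n *\<^sub>C fiber \<theta> \<omega>) \<and>
          norm (\<Sum>\<theta>\<in>\<Theta>. e (c \<theta>) n *\<^sub>C fiber \<theta> \<omega>) \<le> b * sqrt (\<Sum>\<theta>\<in>\<Theta>. (cmod (e (c \<theta>) n))\<^sup>2)" for n
        using bspec[OF elim r[of n]] unfolding sq no .
      show ?thesis
        using LIMSEQ_le[OF ls[of a] ln] LIMSEQ_le[OF ln ls[of b]] bd by blast
    qed
    show ?case by (rule riesz_bounds_finiteI[OF fin ab]) (use both in blast)+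
  qed
qed

text \<open>The pointwise inequalities are integrated over the torus. By orthonormality of the characters,
  the integral of the squared moduli of the trigonometric coefficients is the sum of the squared
  coefficients of the combination of translates.\<close>

lemma riesz_bounds_translates:
  fixes \<Theta> :: "(real ^ 'd) L2 set"
  assumes rb: "AE \<omega> in torus_measure. riesz_bounds a b \<Theta> (\<lambda>\<theta>. fiber \<theta> \<omega>)"
    and fin: "finite \<Theta>" and ab: "0 < a" "0 < b"
  shows "riesz_bounds a b (\<Theta> \<times> UNIV) (\<lambda>(\<theta>, k). translate k \<theta>)"
  unfolding riesz_bounds_def
proof (intro conjI allI impI; (elim conjE)?)
  fix G :: "((real ^ 'd) L2 \<times> (int ^ 'd)) set" and c :: "(real ^ 'd) L2 \<times> (int ^ 'd) \<Rightarrow> complex" assume G: "finite G" "G \<subseteq> \<Theta> \<times> UNIV"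
  \<comment> \<open>A finite set of indices is enlarged to a product by zero coefficients.\<close>
  define F where "F = snd ` G"
  define d where "d i = (if i \<in> G then c i else 0)" for i
  let ?x = "\<lambda>(\<theta>, k). translate k \<theta> :: (real ^ 'd) L2"
  have F: "finite F" using G(1) by (simp add: F_def)
  have GF: "G \<subseteq> \<Theta> \<times> F" using G(2) by (force simp: F_def)
  have fTF: "finite (\<Theta> \<times> F)" using fin F by simp
  have s1: "(\<Sum>i\<in>\<Theta> \<times> F. (cmod (d i))\<^sup>2) = (\<Sum>i\<in>G. (cmod (c i))\<^sup>2)"
    using GF fTF by (intro sum.mono_neutral_cong_right) (auto simp: d_def)
  have s2: "(\<Sum>i\<in>\<Theta> \<times> F. d i *\<^sub>C ?x i) = (\<Sum>i\<in>G. c i *\<^sub>C ?x i)"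
    using GF fTF by (intro sum.mono_neutral_cong_right) (auto simp: d_def)
  define p where "p \<theta> \<omega> = (\<Sum>k\<in>F. d (\<theta>, k) * wave \<omega> (int_vec k))" for \<theta> and \<omega> :: "real ^ 'd"
  have pint: "integrable torus_measure (\<lambda>\<omega>. (cmod (p \<theta> \<omega>))\<^sup>2)" for \<theta>
  proof (rule integrable_torus_bounded)
    show "norm ((cmod (p \<theta> \<omega>))\<^sup>2) \<le> (\<Sum>k\<in>F. cmod (d (\<theta>, k)))\<^sup>2" for \<omega>
    proof -
      have "cmod (p \<theta> \<omega>) \<le> (\<Sum>k\<in>F. cmod (d (\<theta>, k)))"
        unfolding p_def by (rule order.trans[OF norm_sum]) (simp add: norm_mult)
      then show ?thesis by (auto intro: power_mono)
    qed
    show "(\<lambda>\<omega>. (cmod (p \<theta> \<omega>))\<^sup>2) \<in> borel_measurable borel" unfolding p_def by measurable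
  qed
  have pS: "(LINT \<omega>|torus_measure. (\<Sum>\<theta>\<in>\<Theta>. (cmod (p \<theta> \<omega>))\<^sup>2)) = (\<Sum>i\<in>G. (cmod (c i))\<^sup>2)"
  proof -
    have "(LINT \<omega>|torus_measure. (\<Sum>\<theta>\<in>\<Theta>. (cmod (p \<theta> \<omega>))\<^sup>2)) = (\<Sum>\<theta>\<in>\<Theta>. LINT \<omega>|torus_measure. (cmod (p \<theta> \<omega>))\<^sup>2)"
      by (intro Bochner_Integration.integral_sum pint)
    also have "\<dots> = (\<Sum>\<theta>\<in>\<Theta>. \<Sum>k\<in>F. (cmod (d (\<theta>, k)))\<^sup>2)"
      unfolding p_def integral_trig_square[OF F] ..
    finally show ?thesis by (simp only: sum.cartesian_product s1[symmetric]) (simp add: case_prod_beta)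
  qed
  have sint: "integrable torus_measure (\<lambda>\<omega>. \<Sum>\<theta>\<in>\<Theta>. (cmod (p \<theta> \<omega>))\<^sup>2)"
    by (intro Bochner_Integration.integrable_sum pint)
  note N = norm_sum_translates_square[OF fin F, of d, folded p_def, unfolded s2]
  have "a\<^sup>2 * (\<Sum>i\<in>G. (cmod (c i))\<^sup>2) \<le> (norm (\<Sum>i\<in>G. c i *\<^sub>C ?x i))\<^sup>2"
    unfolding pS[symmetric] N(2)[symmetric] integral_mult_right_zero[symmetric]
  proof (rule integral_mono_AE[OF integrable_mult_right[OF sint] N(1)])
    show "AE \<omega> in torus_measure. a\<^sup>2 * (\<Sum>\<theta>\<in>\<Theta>. (cmod (p \<theta> \<omega>))\<^sup>2) \<le> (norm (\<Sum>\<theta>\<in>\<Theta>. p \<theta> \<omega> *\<^sub>C fiber \<theta> \<omega>))\<^sup>2"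
      using rb by eventually_elim (rule riesz_bounds_square(1)[OF _ fin order_refl])
  qed
  moreover have "(norm (\<Sum>i\<in>G. c i *\<^sub>C ?x i))\<^sup>2 \<le> b\<^sup>2 * (\<Sum>i\<in>G. (cmod (c i))\<^sup>2)"
    unfolding pS[symmetric] N(2)[symmetric] integral_mult_right_zero[symmetric]
  proof (rule integral_mono_AE[OF N(1) integrable_mult_right[OF sint]])
    show "AE \<omega> in torus_measure. (norm (\<Sum>\<theta>\<in>\<Theta>. p \<theta> \<omega> *\<^sub>C fiber \<theta> \<omega>))\<^sup>2 \<le> b\<^sup>2 * (\<Sum>\<theta>\<in>\<Theta>. (cmod (p \<theta> \<omega>))\<^sup>2)"
      using rb by eventually_elim (rule riesz_bounds_square(2)[OF _ fin order_refl])
  qed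
  ultimately show "a * sqrt (\<Sum>i\<in>G. (cmod (c i))\<^sup>2) \<le> norm (\<Sum>i\<in>G. c i *\<^sub>C ?x i)"
    "norm (\<Sum>i\<in>G. c i *\<^sub>C ?x i) \<le> b * sqrt (\<Sum>i\<in>G. (cmod (c i))\<^sup>2)"
    using sqrt_bounds_of_squares ab by (simp_all add: sum_nonneg)
qed (use ab in auto)

section \<open>Riesz generator sets and their fibers\<close>

text \<open>A statement that does not mention the point may be extracted, since the torus has measure
  \<open>1\<close>.\<close>

lemma AE_torus_const: "(AE \<omega> in (torus_measure :: (real ^ 'd) measure). P) \<Longrightarrow> P"
proof (rule ccontr)
  assume "AE \<omega> in (torus_measure :: (real ^ 'd) measure). P" "\<not> P"
  then have "AE \<omega> in (torus_measure :: (real ^ 'd) measure). (1 :: complex) = 0" by simp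
  then have "(LINT \<omega>|(torus_measure :: (real ^ 'd) measure). (1 :: complex)) = (LINT \<omega>|(torus_measure :: (real ^ 'd) measure). 0)"
    by (intro integral_cong_AE) auto
  then show False using integral_wave_torus[of "0 :: int ^ 'd"] by simp
qed

lemma trig_poly_cnj:
  assumes "trig_poly p" shows "trig_poly (\<lambda>\<omega>. cnj (p \<omega>))"
  using assms
proof induction
  case (trig_poly_wave c k)
  have "cnj (wave \<omega> (int_vec k)) = wave \<omega> (int_vec (- k))" for \<omega>
    using wave_diff[of \<omega> 0 "int_vec k"] int_vec_diff[of 0 k] by simp
  then show ?case using trig_poly.trig_poly_wave[of "cnj c" "- k"] by simp
qed (auto intro: trig_poly_add)

text \<open>The function \<open>f\<close> is orthogonal to every combination of translates of \<open>\<theta>\<close>. Choosing the coefficients of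
  the trigonometric polynomial \<open>p * cnj p\<close>, whose values are real, shows that the inner product of
  the fibers has integral \<open>0\<close> against the square of the modulus of \<open>p\<close>.\<close>

lemma AE_inner_fiber_0:
  fixes f \<theta> :: "(real ^ 'd) L2"
  assumes orth: "\<And>k. cinner f (translate k \<theta>) = 0"
  shows "AE \<omega> in torus_measure. inner (fiber f \<omega>) (fiber \<theta> \<omega>) = 0"
proof -
  let ?g = "\<lambda>\<omega>. inner (fiber f \<omega>) (fiber \<theta> \<omega>)"
  have zero: "(LINT \<omega>|torus_measure. ?g \<omega> * (cmod (p \<omega>))\<^sup>2) = 0" if p: "trig_poly p" for p
  proof -
    have pp: "trig_poly (\<lambda>\<omega>. p \<omega> * cnj (p \<omega>))"
      by (intro trig_poly_mult trig_poly_cnj p)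
    then obtain F q where F: "finite F" "(\<lambda>\<omega>. p \<omega> * cnj (p \<omega>)) = (\<lambda>\<omega>. \<Sum>k\<in>F. q k * wave \<omega> (int_vec k))"
      by (rule trig_polyE)
    define h where "h = (\<Sum>i\<in>{\<theta>} \<times> F. q (snd i) *\<^sub>C (case i of (\<theta>, k) \<Rightarrow> translate k \<theta>))"
    have "AE \<omega> in torus_measure. fiber h \<omega> = (\<Sum>k\<in>F. q k * wave \<omega> (int_vec k)) *\<^sub>C fiber \<theta> \<omega>"
      using fiber_sum_translates[of "{\<theta>}" F "\<lambda>i. q (snd i)"] F(1) unfolding h_def by simp
    then have ae: "AE \<omega> in torus_measure. ?g \<omega> * (cmod (p \<omega>))\<^sup>2 = inner (fiber f \<omega>) (fiber h \<omega>)"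
    proof eventually_elim
      case (elim \<omega>)
      then have "fiber h \<omega> = ((cmod (p \<omega>))\<^sup>2) *\<^sub>R fiber \<theta> \<omega>"
        by (simp only: fun_cong[OF F(2), symmetric] complex_norm_square[symmetric] scaleR_eq_scaleC)
      then show ?case by simp
    qed
    have "(LINT \<omega>|torus_measure. ?g \<omega> * (cmod (p \<omega>))\<^sup>2) = inner f h"
      unfolding integral_inner_fiber(2)[symmetric]
    proof (rule integral_cong_AE[OF _ _ ae])
      have [measurable]: "p \<in> borel_measurable borel" by (rule trig_poly_measurable[OF p])
      show "(\<lambda>\<omega>. ?g \<omega> * (cmod (p \<omega>))\<^sup>2) \<in> borel_measurable torus_measure"
        by (rule measurable_torus_measure) measurable
      show "(\<lambda>\<omega>. inner (fiber f \<omega>) (fiber h \<omega>)) \<in> borel_measurable torus_measure"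
        by (rule measurable_torus_measure) measurable
    qed
    also have "\<dots> = 0"
    proof -
      have "cinner f h = 0"
        unfolding h_def cinner_sum_right cinner_scaleC_right by (intro sum.neutral) (auto simp: orth)
      then show ?thesis by (simp add: inner_eq_Re_cinner)
    qed
    finally show ?thesis .
  qed
  have "AE \<omega> in torus_measure. 0 \<le> ?g \<omega>"
    by (rule AE_nonneg_of_trig_poly[OF integral_inner_fiber(1)]) (simp add: zero)
  moreover have "AE \<omega> in torus_measure. 0 \<le> - ?g \<omega>"
    by (rule AE_nonneg_of_trig_poly[OF Bochner_Integration.integrable_minus[OF integral_inner_fiber(1)]])
      (simp add: zero)
  ultimately show ?thesis by eventually_elim simp
qed

text \<open>The imaginary part of an inner product with \<open>\<theta>\<close> is the real part of the one with a rotated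
  \<open>\<theta>\<close>.\<close>

lemma AE_cinner_fiber_0:
  fixes f \<theta> :: "(real ^ 'd) L2"
  assumes orth: "\<And>k. cinner f (translate k \<theta>) = 0"
  shows "AE \<omega> in torus_measure. cinner (fiber f \<omega>) (fiber \<theta> \<omega>) = 0"
proof -
  have "translate k (\<i> *\<^sub>C \<theta>) = \<i> *\<^sub>C translate k \<theta>" for k
    by (simp only: translate_eq_shift shift_scaleC)
  then have "AE \<omega> in torus_measure. inner (fiber f \<omega>) (fiber (\<i> *\<^sub>C \<theta>) \<omega>) = 0"
    by (intro AE_inner_fiber_0) (simp add: cinner_scaleC_right orth)
  with AE_inner_fiber_0[OF orth] fiber_scaleC[of \<i> \<theta>] show ?thesis
    by eventually_elim (simp add: complex_eq_iff inner_eq_Re_cinner cinner_scaleC_right)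
qed

lemma translates_image: "(\<lambda>(\<theta>, k). translate k \<theta>) ` (\<Theta> \<times> UNIV) = {translate k \<theta> | k \<theta>. \<theta> \<in> \<Theta>}"
  by auto

lemma riesz_generator_set_generates:
  assumes V: "shift_invariant V" and gen: "riesz_generator_set V \<Theta>" and cnt: "countable \<Theta>"
  shows "countable_generator V \<Theta>"
proof -
  obtain A B where fr: "frame_with_bounds V A B (\<Theta> \<times> UNIV) (\<lambda>(\<theta>, k). translate k \<theta>)"
    using gen unfolding riesz_generator_set_def riesz_basis_def by blast
  have "closure (cspan {translate k \<theta> | k \<theta>. \<theta> \<in> \<Theta>}) = V"
  proof (rule closure_cspan_eq_of_total)
    show "csubspace V" "closed V" using V by (simp_all add: shift_invariant_def)
    show "{translate k \<theta> | k \<theta>. \<theta> \<in> \<Theta>} \<subseteq> V"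
      using fr unfolding frame_with_bounds_def translates_image by blast
    fix f assume "f \<in> V" "\<And>s. s \<in> {translate k \<theta> | k \<theta>. \<theta> \<in> \<Theta>} \<Longrightarrow> cinner f s = 0"
    then show "f = 0" by (intro frame_orthogonal_eq_0[OF fr]) auto
  qed
  then show ?thesis using cnt by (simp add: countable_generator_def)
qed

text \<open>The fibers of a finite Riesz generator set are, uniformly in \<open>\<omega>\<close>, a Riesz basis of the range
  function; in particular its dimension is the number of generators.\<close>

lemma riesz_generator_set_fibers:
  assumes V: "shift_invariant V" and gen: "riesz_generator_set V \<Theta>" and fin: "finite \<Theta>"
  obtains a b where "0 < a" "0 < b"
    "AE \<omega> in torus_measure. riesz_bounds a b \<Theta> (\<lambda>\<theta>. fiber \<theta> \<omega>) \<and>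
      range_function V \<omega> = cspan ((\<lambda>\<theta>. fiber \<theta> \<omega>) ` \<Theta>)"
proof -
  obtain a b where rb: "riesz_bounds a b (\<Theta> \<times> UNIV) (\<lambda>(\<theta>, k). translate k \<theta>)"
    using gen unfolding riesz_generator_set_def riesz_basis_def riesz_sequence_iff_riesz_bounds by blast
  have "AE \<omega> in torus_measure. riesz_bounds a b \<Theta> (\<lambda>\<theta>. fiber \<theta> \<omega>) \<and>
      range_function V \<omega> = cspan ((\<lambda>\<theta>. fiber \<theta> \<omega>) ` \<Theta>)"
    using AE_riesz_bounds_fiber[OF rb fin]
      range_function_eq[OF riesz_generator_set_generates[OF V gen countable_finite[OF fin]]]
    by eventually_elim (simp add: closure_cspan_finite fin)
  moreover have "0 < a" "0 < b" using rb by (simp_all add: riesz_bounds_def)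
  ultimately show ?thesis using that by blast
qed

text \<open>A function of \<open>V\<close> orthogonal to all translates has fibers in the range function that are orthogonal
  to the fibers of the generators. They vanish by the last hypothesis, so the translates span a
  dense subspace, and the Riesz bounds turn into frame bounds on its closure.\<close>

lemma riesz_generator_set_of_fibers:
  fixes V :: "(real ^ 'd) L2 set"
  assumes V: "shift_invariant V" and gen: "countable_generator V \<Phi>"
    and fin: "finite \<Theta>" and sub: "\<Theta> \<subseteq> V" and ab: "0 < a" "0 < b"
    and rb: "AE \<omega> in torus_measure. riesz_bounds a b \<Theta> (\<lambda>\<theta>. fiber \<theta> \<omega>)"
    and total: "AE \<omega> in torus_measure. \<forall>x\<in>range_function V \<omega>. (\<forall>\<theta>\<in>\<Theta>. cinner x (fiber \<theta> \<omega>) = 0) \<longrightarrow> x = 0"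
  shows "riesz_generator_set V \<Theta>"
proof -
  have V': "csubspace V" "closed V" "\<And>f k. f \<in> V \<Longrightarrow> translate k f \<in> V"
    using V by (auto simp: shift_invariant_def)
  note RB = riesz_bounds_translates[OF rb fin ab]
  have "closure (cspan {translate k \<theta> | k \<theta>. \<theta> \<in> \<Theta>}) = V"
  proof (rule closure_cspan_eq_of_total[OF V'(1,2)])
    show "{translate k \<theta> | k \<theta>. \<theta> \<in> \<Theta>} \<subseteq> V" using sub V'(3) by auto
    fix f assume f: "f \<in> V" and orth: "\<And>s. s \<in> {translate k \<theta> | k \<theta>. \<theta> \<in> \<Theta>} \<Longrightarrow> cinner f s = 0"
    have "AE \<omega> in torus_measure. \<forall>\<theta>\<in>\<Theta>. cinner (fiber f \<omega>) (fiber \<theta> \<omega>) = 0"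
      using fin AE_cinner_fiber_0[of f] orth by (subst AE_finite_all) blast+
    moreover have "AE \<omega> in torus_measure. fiber f \<omega> \<in> closure (cspan ((\<lambda>\<phi>. fiber \<phi> \<omega>) ` \<Phi>))"
      using fiber_in_closure_cspan[of f \<Phi>] f gen by (simp add: countable_generator_def)
    ultimately have "AE \<omega> in torus_measure. fiber f \<omega> = 0"
      using range_function_eq[OF gen] total by eventually_elim blast
    then show "f = 0" by (rule L2_eq_0_if_fiber_0)
  qed
  with frame_of_riesz_bounds[OF RB]
  have "frame_with_bounds V (a\<^sup>2) (b\<^sup>2) (\<Theta> \<times> UNIV) (\<lambda>(\<theta>, k). translate k \<theta>)"
    by (simp add: translates_image)
  then show ?thesis
    using sub RB unfolding riesz_generator_set_def riesz_basis_def riesz_sequence_iff_riesz_bounds by blast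
qed

lemma frame_with_bounds_mono:
  assumes fr: "frame_with_bounds H A B I x" and le: "0 < A'" "A' \<le> A" "B \<le> B'"
  shows "frame_with_bounds H A' B' I x"
  unfolding frame_with_bounds_def
proof (intro conjI ballI)
  show "0 < A'" "0 < B'" "x ` I \<subseteq> H" using fr le by (auto simp: frame_with_bounds_def)
  fix f assume f: "f \<in> H"
  let ?s = "infsum (\<lambda>i. (cmod (cinner f (x i)))\<^sup>2) I"
  have s: "(\<lambda>i. (cmod (cinner f (x i)))\<^sup>2) summable_on I" "A * (norm f)\<^sup>2 \<le> ?s" "?s \<le> B * (norm f)\<^sup>2"
    using fr f by (auto simp: frame_with_bounds_def)
  show "(\<lambda>i. (cmod (cinner f (x i)))\<^sup>2) summable_on I" by (rule s)
  show "A' * (norm f)\<^sup>2 \<le> ?s" using mult_right_mono[OF le(2), of "(norm f)\<^sup>2"] s(2) by simp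
  show "?s \<le> B' * (norm f)\<^sup>2" using mult_right_mono[OF le(3), of "(norm f)\<^sup>2"] s(3) by simp
qed

lemma csubspace_range_function: "csubspace (range_function V \<omega>)"
  unfolding range_function_def by (intro csubspace_closure complex_vector.subspace_span)

text \<open>A spanning family of as many vectors as an independent set has no repetitions and no
  redundant member.\<close>

lemma spanning_family_independent:
  fixes x :: "'i \<Rightarrow> 'a::complex_inner"
  assumes T: "complex_vector.independent T" "T \<subseteq> cspan (x ` I)" and fin: "finite I" and card: "card T = card I"
  shows "inj_on x I" "complex_vector.independent (x ` I)"
proof -
  have bound: "card T \<le> card S" if "finite S" "T \<subseteq> cspan S" for S
    using complex_vector.independent_span_bound[OF that(1) T(1) that(2)] by blast
  have "card (x ` I) = card I"
    using bound[of "x ` I"] T(2) fin card card_image_le[OF fin, of x] by simp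
  then show "inj_on x I" using fin by (simp add: eq_card_imp_inj_on)
  show "complex_vector.independent (x ` I)"
  proof
    assume "complex_vector.dependent (x ` I)"
    then obtain a where a: "a \<in> x ` I" "a \<in> cspan (x ` I - {a})"
      unfolding complex_vector.dependent_def by blast
    have "cspan (x ` I) = cspan (x ` I - {a})"
      using complex_vector.span_redundant[OF a(2)] a(1) by (simp add: insert_absorb)
    then have "card T \<le> card (x ` I - {a})" using bound[of "x ` I - {a}"] T(2) fin by simp
    also have "\<dots> < card (x ` I)" using a(1) fin by (intro card_Diff1_less) auto
    also have "\<dots> = card T" using \<open>card (x ` I) = card I\<close> card by simp
    finally show False by simp
  qed
qed

theorem proposition4p5:
  fixes V :: "(real ^ 'd) L2 set"
    and \<phi> \<psi> :: "nat \<Rightarrow> (real ^ 'd) L2"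
    and n :: nat
  assumes "shift_invariant V"
    and "inj_on \<phi> {1..n}" and "riesz_generator_set V (\<phi> ` {1..n})"
    and "inj_on \<psi> {1..n}" and "riesz_generator_set V (\<psi> ` {1..n})"
  shows "woven_generator_sets V n \<phi> \<psi> \<longleftrightarrow>
    (\<exists>A>0. \<exists>B>0. AE \<omega> in lebesgue_on torus.
       woven_with_bounds (range_function V \<omega>) A B n
         (\<lambda>i. fiber (\<phi> i) \<omega>) (\<lambda>i. fiber (\<psi> i) \<omega>))"
proof -
  \<comment> \<open>The family that is to be a Riesz generator set for the index set \<open>I\<close>.\<close>
  define mix where "mix I i = (if i \<in> I then \<phi> i else \<psi> i)" for I i
  have mix_image: "\<phi> ` I \<union> \<psi> ` ({1..n} - I) = mix I ` {1..n}" if "I \<subseteq> {1..n}" for I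
    using that by (auto simp: mix_def image_iff)
  have mix_fiber: "(\<lambda>i. if i \<in> I then fiber (\<phi> i) \<omega> else fiber (\<psi> i) \<omega>) = (\<lambda>\<theta>. fiber \<theta> \<omega>) \<circ> mix I" for I \<omega>
    by (auto simp: mix_def fun_eq_iff)
  have mix_V: "mix I ` {1..n} \<subseteq> V" for I
    using assms(3,5) by (auto simp: mix_def riesz_generator_set_def)
  have gen: "countable_generator V (\<phi> ` {1..n})"
    by (rule riesz_generator_set_generates[OF assms(1,3)]) auto
  \<comment> \<open>Almost every range function contains \<open>n\<close> independent vectors, the fibers of the \<open>\<phi> i\<close>.\<close>
  have "AE \<omega> in torus_measure. \<exists>T. complex_vector.independent T \<and> T \<subseteq> range_function V \<omega> \<and> card T = n"
  proof (rule riesz_generator_set_fibers[OF assms(1,3)])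
    fix a b assume "AE \<omega> in torus_measure. riesz_bounds a b (\<phi> ` {1..n}) (\<lambda>\<theta>. fiber \<theta> \<omega>) \<and>
      range_function V \<omega> = cspan ((\<lambda>\<theta>. fiber \<theta> \<omega>) ` \<phi> ` {1..n})"
    then show ?thesis
    proof eventually_elim
      case (elim \<omega>)
      then have "inj_on (\<lambda>\<theta>. fiber \<theta> \<omega>) (\<phi> ` {1..n})"
        "complex_vector.independent ((\<lambda>\<theta>. fiber \<theta> \<omega>) ` \<phi> ` {1..n})"
        using riesz_bounds_independent by blast+
      moreover have "(\<lambda>\<theta>. fiber \<theta> \<omega>) ` \<phi> ` {1..n} \<subseteq> range_function V \<omega>"
        using elim complex_vector.span_superset[of "(\<lambda>\<theta>. fiber \<theta> \<omega>) ` \<phi> ` {1..n}"] by simp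
      ultimately show ?case
        using assms(2) by (intro exI[of _ "(\<lambda>\<theta>. fiber \<theta> \<omega>) ` \<phi> ` {1..n}"]) (simp add: card_image)
    qed
  qed auto
  note dim = this
  show ?thesis
  proof
    assume woven: "woven_generator_sets V n \<phi> \<psi>"
    have "\<exists>p. 0 < fst p \<and> 0 < snd p \<and> (AE \<omega> in torus_measure.
        frame_with_bounds (range_function V \<omega>) (fst p) (snd p) {1..n} (\<lambda>i. if i \<in> I then fiber (\<phi> i) \<omega> else fiber (\<psi> i) \<omega>))"
      if I: "I \<subseteq> {1..n}" for I
    proof -
      have "riesz_generator_set V (mix I ` {1..n})"
        using woven I unfolding woven_generator_sets_def mix_image[OF I, symmetric] by blast
      then obtain a b where ab: "0 < a" "0 < b" and
        ae: "AE \<omega> in torus_measure. riesz_bounds a b (mix I ` {1..n}) (\<lambda>\<theta>. fiber \<theta> \<omega>) \<and>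
          range_function V \<omega> = cspan ((\<lambda>\<theta>. fiber \<theta> \<omega>) ` mix I ` {1..n})"
        by (rule riesz_generator_set_fibers[OF assms(1)]) auto
      \<comment> \<open>As a set, a mixed family could a priori have fewer than \<open>n\<close> members; but its fibers span a space of
        dimension \<open>n\<close>.\<close>
      have "AE \<omega> in (torus_measure :: (real ^ 'd) measure). inj_on (mix I) {1..n}"
        using ae dim
      proof eventually_elim
        case (elim \<omega>)
        then obtain T where T: "complex_vector.independent T"
          "T \<subseteq> cspan (((\<lambda>\<theta>. fiber \<theta> \<omega>) \<circ> mix I) ` {1..n})" "card T = n"
          by (auto simp: image_comp)
        have "inj_on ((\<lambda>\<theta>. fiber \<theta> \<omega>) \<circ> mix I) {1..n}"
          by (rule spanning_family_independent(1)[OF T(1,2)]) (simp_all add: T(3))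
        then show ?case by (rule inj_on_imageI2)
      qed
      then have inj: "inj_on (mix I) {1..n}" by (rule AE_torus_const)
      have "AE \<omega> in torus_measure.
          frame_with_bounds (range_function V \<omega>) (a\<^sup>2) (b\<^sup>2) {1..n} (\<lambda>i. if i \<in> I then fiber (\<phi> i) \<omega> else fiber (\<psi> i) \<omega>)"
        using ae
      proof eventually_elim
        case (elim \<omega>)
        then have "riesz_bounds a b {1..n} ((\<lambda>\<theta>. fiber \<theta> \<omega>) \<circ> mix I)"
          using riesz_bounds_reindex[OF finite_atLeastAtMost inj] by blast
        from frame_of_riesz_bounds[OF this] elim show ?case
          by (simp add: mix_fiber image_comp closure_cspan_finite)
      qed
      then show ?thesis using ab by (intro exI[of _ "(a\<^sup>2, b\<^sup>2)"]) simp
    qed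
    then have "\<exists>p. \<forall>I\<in>Pow {1..n}. 0 < fst (p I) \<and> 0 < snd (p I) \<and> (AE \<omega> in torus_measure.
        frame_with_bounds (range_function V \<omega>) (fst (p I)) (snd (p I)) {1..n}
          (\<lambda>i. if i \<in> I then fiber (\<phi> i) \<omega> else fiber (\<psi> i) \<omega>))"
      by (intro bchoice ballI) (simp only: Pow_iff)
    then obtain p where p: "\<And>I. I \<subseteq> {1..n} \<Longrightarrow> 0 < fst (p I) \<and> 0 < snd (p I) \<and> (AE \<omega> in torus_measure.
        frame_with_bounds (range_function V \<omega>) (fst (p I)) (snd (p I)) {1..n}
          (\<lambda>i. if i \<in> I then fiber (\<phi> i) \<omega> else fiber (\<psi> i) \<omega>))"
      by auto
    define a b where "a I = fst (p I)" and "b I = snd (p I)" for I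
    have ab: "\<And>I. I \<subseteq> {1..n} \<Longrightarrow> 0 < a I" "\<And>I. I \<subseteq> {1..n} \<Longrightarrow> 0 < b I"
      "\<And>I. I \<subseteq> {1..n} \<Longrightarrow> AE \<omega> in torus_measure. frame_with_bounds (range_function V \<omega>) (a I) (b I) {1..n}
        (\<lambda>i. if i \<in> I then fiber (\<phi> i) \<omega> else fiber (\<psi> i) \<omega>)"
      using p by (simp_all only: a_def b_def)
    \<comment> \<open>The bounds depend on \<open>I\<close>; there are finitely many sets \<open>I\<close>.\<close>
    define A where "A = Min (a ` Pow {1..n})"
    define B where "B = Max (b ` Pow {1..n})"
    have "A \<in> a ` Pow {1..n}" unfolding A_def by (rule Min_in) auto
    then have A0: "0 < A" using ab(1) by blast
    have A: "\<And>I. I \<subseteq> {1..n} \<Longrightarrow> A \<le> a I" unfolding A_def by auto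
    have B: "\<And>I. I \<subseteq> {1..n} \<Longrightarrow> b I \<le> B" unfolding B_def by auto
    have "0 < B" using B[of "{}"] ab(2)[of "{}"] by simp
    have "AE \<omega> in torus_measure. \<forall>I\<in>Pow {1..n}. frame_with_bounds (range_function V \<omega>) (a I) (b I) {1..n}
        (\<lambda>i. if i \<in> I then fiber (\<phi> i) \<omega> else fiber (\<psi> i) \<omega>)"
      using ab(3) by (subst AE_finite_all) auto
    then have "AE \<omega> in torus_measure. woven_with_bounds (range_function V \<omega>) A B n
        (\<lambda>i. fiber (\<phi> i) \<omega>) (\<lambda>i. fiber (\<psi> i) \<omega>)"
    proof eventually_elim
      case (elim \<omega>)
      show ?case
        unfolding woven_with_bounds_def
        using elim A B A0 by (auto intro: frame_with_bounds_mono)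
    qed
    then show "\<exists>A>0. \<exists>B>0. AE \<omega> in lebesgue_on torus.
       woven_with_bounds (range_function V \<omega>) A B n (\<lambda>i. fiber (\<phi> i) \<omega>) (\<lambda>i. fiber (\<psi> i) \<omega>)"
      using A0 \<open>0 < B\<close> unfolding AE_lebesgue_on_torus by blast
  next
    assume "\<exists>A>0. \<exists>B>0. AE \<omega> in lebesgue_on torus.
       woven_with_bounds (range_function V \<omega>) A B n (\<lambda>i. fiber (\<phi> i) \<omega>) (\<lambda>i. fiber (\<psi> i) \<omega>)"
    then obtain A B where AB: "0 < A" "0 < B" and
      ae: "AE \<omega> in torus_measure. woven_with_bounds (range_function V \<omega>) A B n
        (\<lambda>i. fiber (\<phi> i) \<omega>) (\<lambda>i. fiber (\<psi> i) \<omega>)"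
      unfolding AE_lebesgue_on_torus by blast
    show "woven_generator_sets V n \<phi> \<psi>"
      unfolding woven_generator_sets_def
    proof (intro allI impI)
      fix I assume I: "I \<subseteq> {1..n}"
      have fr: "AE \<omega> in torus_measure. frame_with_bounds (range_function V \<omega>) A B {1..n} ((\<lambda>\<theta>. fiber \<theta> \<omega>) \<circ> mix I)"
        using ae by eventually_elim (use I in \<open>simp add: woven_with_bounds_def mix_fiber\<close>)
      \<comment> \<open>A frame of \<open>n\<close> vectors for a space with \<open>n\<close> independent vectors is a basis.\<close>
      have both: "AE \<omega> in torus_measure. inj_on ((\<lambda>\<theta>. fiber \<theta> \<omega>) \<circ> mix I) {1..n} \<and>
          riesz_bounds (sqrt A) (sqrt B) {1..n} ((\<lambda>\<theta>. fiber \<theta> \<omega>) \<circ> mix I)"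
        using fr dim
      proof eventually_elim
        case (elim \<omega>)
        then obtain T where T: "complex_vector.independent T" "T \<subseteq> range_function V \<omega>" "card T = n" by auto
        let ?x = "(\<lambda>\<theta>. fiber \<theta> \<omega>) \<circ> mix I"
        have "cspan (?x ` {1..n}) = range_function V \<omega>"
          by (rule cspan_eq_of_finite_frame[OF csubspace_range_function _ elim(1)]) simp
        then have "T \<subseteq> cspan (?x ` {1..n})" using T(2) by simp
        from spanning_family_independent[OF T(1) this] T(3)
        have "inj_on ?x {1..n}" "complex_vector.independent (?x ` {1..n})" by simp_all
        then show ?case
          using riesz_bounds_of_independent_frame[OF csubspace_range_function _ elim(1)] by simp
      qed
      have "AE \<omega> in (torus_measure :: (real ^ 'd) measure). inj_on (mix I) {1..n}"
        using both by eventually_elim (auto intro: inj_on_imageI2)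
      then have inj: "inj_on (mix I) {1..n}" by (rule AE_torus_const)
      have "riesz_generator_set V (mix I ` {1..n})"
      proof (rule riesz_generator_set_of_fibers[OF assms(1) gen _ mix_V])
        show "0 < sqrt A" "0 < sqrt B" using AB by simp_all
        show "AE \<omega> in torus_measure. riesz_bounds (sqrt A) (sqrt B) (mix I ` {1..n}) (\<lambda>\<theta>. fiber \<theta> \<omega>)"
          using both by eventually_elim (simp only: riesz_bounds_reindex[OF finite_atLeastAtMost inj])
        show "AE \<omega> in torus_measure. \<forall>x\<in>range_function V \<omega>.
            (\<forall>\<theta>\<in>mix I ` {1..n}. cinner x (fiber \<theta> \<omega>) = 0) \<longrightarrow> x = 0"
          using fr by eventually_elim (auto intro: frame_orthogonal_eq_0)
      qed simp
      then show "riesz_generator_set V (\<phi> ` I \<union> \<psi> ` ({1..n} - I))"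
        by (simp only: mix_image[OF I])
    qed
  qed
qed

end
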